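(* Let $\mathcal{X}\subseteq\mathbb{R}^d$ have non-empty interior, and let $Q$ be a probability measure with support $\mathcal{X}$ and a strictly positive, continuously differentiable Lebesgue density $q$ on $\mathcal{X}$. Let $(X_i)_{i\in\mathbb{N}}$ be i.i.d. with distribution $Q$, and let $X,X'$ be independent with distribution $Q$. Assume: (1) $\Theta\subset\mathbb{R}^p$ is compact and convex with non-empty interior, and $\theta_0\in\arg\min_{\theta\in\Theta}\mathrm{KSD}_q(p_\theta)$ belongs to the interior of $\Theta$. (2) The kernel $k:\mathcal{X}\times\mathcal{X}\to\mathbb{R}$ is bounded, integrally strictly positive definite, in the Stein class of $q$, and has bounded first order derivatives. (3) $\{P_\theta\}_{\theta\in\Theta}$ is an identifiable parametric family of probability measures on $\mathcal{X}$; each $P_\theta$ has support $\mathcal{X}$ and a Lebesgue density $p_\theta$ such that: (a) for every $\theta\in\Theta$, $x\mapsto p_\theta(x)$ is strictly positive and continuously differentiable on $\mathcal{X}$; (b) for every $x\in\mathcal{X}$, $\theta\mapsto p_\theta(x)$ is in $\mathcal{C}^4(\Theta)$; (c) $\mathbb{E}[\sup_{\theta\in\Theta}\|\nabla_\theta^m s_{p_\theta}(X)\|_1^4]<\infty$ for $m\in\{0,1\}$; (d) $\mathbb{E}[\sup_{\theta\in\Theta}\|\nabla_\theta^m s_{p_\theta}(X)\|_1^2]<\infty$ for $m\in\{2,3\}$; (e) $\int_{\mathcal{X}}\|q(x)(s_{p_\theta}(x)-s_q(x))\|_2^2\,dx<\infty$ for all $\theta\in\Theta$. (4) The alternative hypothesis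 $H_1^C$ holds, i.e. $Q\notin\{P_\theta\}_{\theta\in\Theta}$. Let $\hat\theta_n$ be a $\Theta$-valued estimator of $\theta_0$ based on $X_1,\dots,X_n$. Then, almost surely, $$\liminf_{n\to\infty}\widehat{\mathrm{KSD}}{}^2_q(p_{\hat\theta_n})>0.$$
   Context: Notation: $[n]=\{1,\dots,n\}$. For a density $p$, $s_p=\nabla_x\log p$ is its score function. $\nabla^m_\theta f$ denotes the collection of all $m$-th order partial derivatives in $\theta$ ($\nabla^0 f=f$); expectations of vectors and arrays are componentwise, and norms of arrays are taken entrywise, so finiteness is required for each entry. Stein class: a continuously differentiable $f:\mathcal{X}\to\mathbb{R}$ is in the Stein class of $q$ if $\int_{\mathcal{X}}\nabla_x(f(x)q(x))\,dx=0$. A positive definite kernel $k:\mathcal{X}\times\mathcal{X}\to\mathbb{R}$ is in the Stein class of $q$ if it has continuous second-order partial derivatives and $k(x,\cdot)$ is in the Stein class of $q$ for every fixed $x\in\mathcal{X}$. $k$ is integrally strictly positive definite if $\int_{\mathcal{X}}\int_{\mathcal{X}}g(x)k(x,x')g(x')\,dx\,dx'>0$ for every $g$ with $0<\int_{\mathcal{X}}g(x)^2dx<\infty$. Kernel Stein Discrepancy: for a strictly positive continuously differentiable density $p$ with support $\mathcal{X}$ and $\delta_{p,q}=s_p-s_q$ (with $\int_{\mathcal X}\|q\,\delta_{p,q}\|_2^2\,dx<\infty$ and $\mathbb{E}[\delta_{p,q}(X)^Tk(X,X')\delta_{p,q}(X')]<\infty$), $\mathrm{KSD}^2_q(p)=\mathbb{E}_{X,X'\sim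 q}[h_p(X,X')]$ with $X,X'$ independent and $$h_p(x,x')=s_p(x)^Tk(x,x')s_p(x')+s_p(x)^T\nabla_{x'}k(x,x')+\nabla_xk(x,x')^Ts_p(x')+\sum_{i=1}^d\frac{\partial^2}{\partial x_i\partial x_i'}k(x,x').$$ Write $h_\theta:=h_{p_\theta}$. The estimator is $\widehat{\mathrm{KSD}}{}^2_q(p_\theta)=\frac{1}{n(n-1)}\sum_{i,j\in[n],i\ne j}h_\theta(X_i,X_j)$.
   Formalization: The formal theorem also assumes that the interior of X is connected and X lies in its closure (on two disjoint intervals the claim fails: equal scores do not give equal densities); it makes explicit that the expectations defining KSD are finite and that a.e. score is C^3 in theta. *)

theory Defs
  imports "HOL-Probability.Probability"
begin

(* Calculus on a set S that need not be open.  A partial derivative is the ordinary one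
   at interior points and is extended to the remaining points of S by its limit from the
   interior; C^k(S) asks that all partial derivatives up to order k exist in the interior
   and extend continuously to S.  This is meant for sets with S \<subseteq> closure (interior S), where
   the extension is unique. *)

definition pdiff :: "'a::euclidean_space set \<Rightarrow> 'a \<Rightarrow> ('a \<Rightarrow> real) \<Rightarrow> 'a \<Rightarrow> real" where
  "pdiff S b f x =
     (if x \<in> interior S then deriv (\<lambda>t. f (x + t *\<^sub>R b)) 0
      else Lim (at x within interior S) (\<lambda>y. deriv (\<lambda>t. f (y + t *\<^sub>R b)) 0))"

primrec Ck_on :: "nat \<Rightarrow> 'a::euclidean_space set \<Rightarrow> ('a \<Rightarrow> real) \<Rightarrow> bool" where
  "Ck_on 0 S f \<longleftrightarrow> continuous_on S f"
| "Ck_on (Suc m) S f \<longleftrightarrow>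
     continuous_on S f \<and>
     (\<forall>b\<in>Basis. (\<forall>x\<in>interior S. (\<lambda>t. f (x + t *\<^sub>R b)) differentiable (at (0::real))) \<and>
                Ck_on m S (pdiff S b f))"

definition grad :: "'a::euclidean_space set \<Rightarrow> ('a \<Rightarrow> real) \<Rightarrow> 'a \<Rightarrow> 'a" where
  "grad S f x = (\<Sum>b\<in>Basis. pdiff S b f x *\<^sub>R b)"

(* Entrywise 1-norm of the array of all m-th order partial derivatives of F; the lists bs
   enumerate the ordered m-tuples of coordinate directions. *)
definition norm1_deriv ::
  "nat \<Rightarrow> 'b::euclidean_space set \<Rightarrow> ('b \<Rightarrow> 'a::euclidean_space) \<Rightarrow> 'b \<Rightarrow> real" where
  "norm1_deriv m S F x =
     (\<Sum>bs\<in>{bs. length bs = m \<and> set bs \<subseteq> Basis}. \<Sum>i\<in>Basis.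
        \<bar>foldr (pdiff S) bs (\<lambda>y. F y \<bullet> i) x\<bar>)"

(* The score determines a density only up to a factor on each component of interior S, so
   that the discrepancy below separates densities when interior S is connected. *)
definition score :: "'a::euclidean_space set \<Rightarrow> ('a \<Rightarrow> real) \<Rightarrow> 'a \<Rightarrow> 'a" where
  "score S p = grad S (\<lambda>x. ln (p x))"

definition msupport :: "'a::topological_space measure \<Rightarrow> 'a set" where
  "msupport \<mu> = {x. \<forall>U. open U \<longrightarrow> x \<in> U \<longrightarrow> 0 < emeasure \<mu> U}"

(* For closed S this says exactly that S is the topological support of mu.  Taking the
   closure also admits domains such as the open half-line, on which mu is concentrated. *)
definition has_support :: "'a::topological_space measure \<Rightarrow> 'a set \<Rightarrow> bool" where
  "has_support \<mu> S \<longleftrightarrow> (AE x in \<mu>. x \<in> S) \<and> closure S = msupport \<mu>"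

(* Only the values of p on S matter. *)
definition has_C1_pos_density ::
  "'a::euclidean_space measure \<Rightarrow> 'a set \<Rightarrow> ('a \<Rightarrow> real) \<Rightarrow> bool" where
  "has_C1_pos_density \<mu> S p \<longleftrightarrow>
     \<mu> = density lborel (\<lambda>x. ennreal (p x) * indicator S x) \<and>
     (\<forall>x\<in>S. 0 < p x) \<and> Ck_on 1 S p"

(* Integrability is stated explicitly because the Bochner integral of a non-integrable
   function is 0 by convention. *)
definition stein_class ::
  "'a::euclidean_space set \<Rightarrow> ('a \<Rightarrow> real) \<Rightarrow> ('a \<Rightarrow> real) \<Rightarrow> bool" where
  "stein_class S q f \<longleftrightarrow>
     Ck_on 1 S f \<and>
     set_integrable lborel S (grad S (\<lambda>x. f x * q x)) \<and>
     (LINT x:S|lborel. grad S (\<lambda>x. f x * q x) x) = 0"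

definition pos_def_kernel :: "'a set \<Rightarrow> ('a \<Rightarrow> 'a \<Rightarrow> real) \<Rightarrow> bool" where
  "pos_def_kernel S k \<longleftrightarrow>
     (\<forall>x\<in>S. \<forall>y\<in>S. k x y = k y x) \<and>
     (\<forall>F c. finite F \<longrightarrow> F \<subseteq> S \<longrightarrow> 0 \<le> (\<Sum>x\<in>F. \<Sum>y\<in>F. c x * k x y * c y))"

definition kernel_stein_class ::
  "'a::euclidean_space set \<Rightarrow> ('a \<Rightarrow> real) \<Rightarrow> ('a \<Rightarrow> 'a \<Rightarrow> real) \<Rightarrow> bool" where
  "kernel_stein_class S q k \<longleftrightarrow>
     pos_def_kernel S k \<and> Ck_on 2 (S \<times> S) (\<lambda>(x, y). k x y) \<and>
     (\<forall>x\<in>S. stein_class S q (k x))"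

definition int_strictly_pos_def ::
  "'a::euclidean_space set \<Rightarrow> ('a \<Rightarrow> 'a \<Rightarrow> real) \<Rightarrow> bool" where
  "int_strictly_pos_def S k \<longleftrightarrow>
     (\<forall>g\<in>borel_measurable borel.
        0 < (\<integral>\<^sup>+x\<in>S. ennreal ((g x)\<^sup>2) \<partial>lborel) \<longrightarrow>
        (\<integral>\<^sup>+x\<in>S. ennreal ((g x)\<^sup>2) \<partial>lborel) < \<infinity> \<longrightarrow>
        0 < (LINT x:S|lborel. LINT y:S|lborel. g x * k x y * g y))"

definition grad1 ::
  "'a::euclidean_space set \<Rightarrow> ('a \<Rightarrow> 'a \<Rightarrow> real) \<Rightarrow> 'a \<Rightarrow> 'a \<Rightarrow> 'a" where
  "grad1 S k x y = (\<Sum>b\<in>Basis. pdiff (S \<times> S) (b, 0) (\<lambda>(u, v). k u v) (x, y) *\<^sub>R b)"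

definition grad2 ::
  "'a::euclidean_space set \<Rightarrow> ('a \<Rightarrow> 'a \<Rightarrow> real) \<Rightarrow> 'a \<Rightarrow> 'a \<Rightarrow> 'a" where
  "grad2 S k x y = (\<Sum>b\<in>Basis. pdiff (S \<times> S) (0, b) (\<lambda>(u, v). k u v) (x, y) *\<^sub>R b)"

definition mixed_trace ::
  "'a::euclidean_space set \<Rightarrow> ('a \<Rightarrow> 'a \<Rightarrow> real) \<Rightarrow> 'a \<Rightarrow> 'a \<Rightarrow> real" where
  "mixed_trace S k x y =
     (\<Sum>b\<in>Basis. pdiff (S \<times> S) (b, 0) (pdiff (S \<times> S) (0, b) (\<lambda>(u, v). k u v)) (x, y))"

definition stein_kernel ::
  "'a::euclidean_space set \<Rightarrow> ('a \<Rightarrow> 'a \<Rightarrow> real) \<Rightarrow> ('a \<Rightarrow> real) \<Rightarrow> 'a \<Rightarrow> 'a \<Rightarrow> real" where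
  "stein_kernel S k p x y =
     k x y * (score S p x \<bullet> score S p y) + score S p x \<bullet> grad2 S k x y
     + grad1 S k x y \<bullet> score S p y + mixed_trace S k x y"

(* The integral is restricted to S \<times> S, which has full measure when Q is concentrated on S,
   because the integrand carries no information outside S \<times> S. *)
definition KSD2 ::
  "'a::euclidean_space set \<Rightarrow> ('a \<Rightarrow> 'a \<Rightarrow> real) \<Rightarrow> 'a measure \<Rightarrow> ('a \<Rightarrow> real) \<Rightarrow> real" where
  "KSD2 S k Q p = (LINT (x, y):S \<times> S|Q \<Otimes>\<^sub>M Q. stein_kernel S k p x y)"

definition KSD ::
  "'a::euclidean_space set \<Rightarrow> ('a \<Rightarrow> 'a \<Rightarrow> real) \<Rightarrow> 'a measure \<Rightarrow> ('a \<Rightarrow> real) \<Rightarrow> real" where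
  "KSD S k Q p = sqrt (KSD2 S k Q p)"

(* Conditions under which KSD2 is defined, besides square-integrability of q (s_p - s_q):
   E[delta(X) . k(X,X') delta(X')] and E[h_p(X,X')] exist and are finite. *)
definition KSD_defined ::
  "'a::euclidean_space set \<Rightarrow> ('a \<Rightarrow> 'a \<Rightarrow> real) \<Rightarrow> 'a measure \<Rightarrow> ('a \<Rightarrow> real) \<Rightarrow> ('a \<Rightarrow> real) \<Rightarrow> bool"
  where
  "KSD_defined S k Q q p \<longleftrightarrow>
     set_integrable (Q \<Otimes>\<^sub>M Q) (S \<times> S)
       (\<lambda>(x, y). k x y * ((score S p x - score S q x) \<bullet> (score S p y - score S q y))) \<and>
     set_integrable (Q \<Otimes>\<^sub>M Q) (S \<times> S) (\<lambda>(x, y). stein_kernel S k p x y)"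

definition KSD2_hat ::
  "'a::euclidean_space set \<Rightarrow> ('a \<Rightarrow> 'a \<Rightarrow> real) \<Rightarrow> nat \<Rightarrow> (nat \<Rightarrow> 'a) \<Rightarrow> ('a \<Rightarrow> real) \<Rightarrow> real" where
  "KSD2_hat S k n xs p =
     1 / (real n * (real n - 1)) *
     (\<Sum>i\<in>{1..n}. \<Sum>j\<in>{1..n} - {i}. stein_kernel S k p (xs i) (xs j))"

end

theory Submission
  imports Defs
begin

text \<open>
Write \<open>h\<^sub>\<theta>\<close> for the Stein kernel of \<open>p\<^sub>\<theta>\<close> and \<open>U\<^sub>n(h)\<close> for the average of \<open>h(X\<^sub>i, X\<^sub>j)\<close> over
ordered pairs of distinct indices \<open>i, j \<le> n\<close>. Almost surely, \<open>U\<^sub>n(h\<^sub>\<theta>)\<close> is eventually bounded below by a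
positive constant simultaneously for all \<open>\<theta> \<in> \<Theta>\<close>, hence also at the random parameter \<open>\<theta>hat\<^sub>n\<close>. Two facts
yield this uniform bound.

First, the discrepancy of every model is positive (\<open>KSD2_pos\<close>). In the reproducing kernel Hilbert space of
\<open>k\<close> the Stein kernel is an inner product \<open>h(x, y) = \<langle>\<xi>(x), \<xi>(y)\<rangle>\<close>, where
\<open>\<xi>\<^sub>b(x) = s\<^sub>b(x) k(x, \<cdot>) + \<partial>\<^sub>b k(x, \<cdot>)\<close>, so the squared discrepancy is the squared norm of \<open>E \<xi>(X)\<close>. If it
were zero, \<open>E \<xi>(X)\<close> would be orthogonal to every \<open>k(x\<^sub>0, \<cdot>)\<close>, that is
\<open>E[s\<^sub>b(X) k(x\<^sub>0, X) + \<partial>\<^sub>b k(x\<^sub>0, X)] = 0\<close>. Subtracting the same identity for the score of \<open>q\<close>, which is what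
membership of \<open>k(x\<^sub>0, \<cdot>)\<close> in the Stein class says, leaves \<open>\<integral> k(x\<^sub>0, y) q(y) \<delta>\<^sub>b(y) dy = 0\<close> for all
\<open>x\<^sub>0\<close>. Integral strict positive definiteness forces \<open>q \<delta> = 0\<close>, so the two scores agree, the densities are
proportional on the connected interior, hence equal, against the alternative hypothesis. The familiar route
through \<open>E[\<delta>(X) \<cdot> \<delta>(X') k(X, X')]\<close> differentiates the Stein identity in \<open>x\<^sub>0\<close> under the integral, for
which the hypotheses supply no dominating function; the orthogonality argument avoids this. No Hilbert space is
constructed either: difference quotients transfer positive definiteness from \<open>k\<close> to point evaluations
combined with derivatives (\<open>jets_pos_def\<close>), sampling transfers it to integrals (\<open>pos_def_integral_nonneg\<close>),
and the orthogonality is the vanishing of the linear term of a nonnegative quadratic polynomial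
(\<open>stein_op_integral_zero\<close>).

Second, pointwise positivity becomes uniform by Wald's compactness argument (\<open>ustat_uniformly_positive\<close>): near
each \<open>\<theta>\<close> the infimum of the kernels over a small ball still has positive mean, finitely many balls
cover \<open>\<Theta>\<close>, and \<open>U\<^sub>n\<close> of each infimum converges to its mean. The required strong law has to cover kernels
that are merely integrable, since only the first moment of the trace of mixed derivatives of \<open>k\<close> is
controlled. It is proved as \<open>ustat_strong_law\<close>: by exchangeability \<open>U\<^sub>n\<close> is a reversed martingale, so a
maximal inequality upgrades convergence in mean, which follows from truncation, to almost sure convergence.
\<close>

section \<open>U-statistics and exchangeability\<close>

text \<open>
For \<open>n < 2\<close> the denominator is 0 and so is the value.
\<close>

definition ustat :: "('a \<Rightarrow> 'a \<Rightarrow> real) \<Rightarrow> nat \<Rightarrow> (nat \<Rightarrow> 'a) \<Rightarrow> real" where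
  "ustat h n x = 1 / (real n * (real n - 1)) * (\<Sum>i\<in>{1..n}. \<Sum>j\<in>{1..n} - {i}. h (x i) (x j))"

lemma ustat_cong:
  assumes "\<And>i. i \<in> {1..n} \<Longrightarrow> x i = y i"
  shows "ustat h n x = ustat h n y"
  unfolding ustat_def using assms by (auto intro!: sum.cong arg_cong2[where f = "(*)"])

text \<open>
The source of the reversed martingale property: events in terms of \<open>U\<^sub>n, U\<^bsub>n+1\<^esub>, \<dots>\<close> inherit this
invariance.
\<close>

lemma ustat_permute:
  assumes \<sigma>: "\<sigma> permutes {1..n}"
  shows "ustat h n (\<lambda>i. x (\<sigma> i)) = ustat h n x"
proof -
  have bij: "bij_betw \<sigma> {1..n} {1..n}"
    using \<sigma> by (rule permutes_imp_bij)
  have inner: "(\<Sum>j\<in>{1..n} - {i}. h (x (\<sigma> i)) (x (\<sigma> j))) = (\<Sum>j\<in>{1..n} - {\<sigma> i}. h (x (\<sigma> i)) (x j))"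
    if "i \<in> {1..n}" for i
  proof -
    have "bij_betw \<sigma> ({1..n} - {i}) ({1..n} - {\<sigma> i})"
      using bij_betw_DiffI[OF bij, of "{i}" "{\<sigma> i}"] that permutes_in_image[OF \<sigma>] by simp
    then show ?thesis
      by (rule sum.reindex_bij_betw[where g = "\<lambda>j. h (x (\<sigma> i)) (x j)"])
  qed
  have "(\<Sum>i\<in>{1..n}. \<Sum>j\<in>{1..n} - {i}. h (x (\<sigma> i)) (x (\<sigma> j)))
      = (\<Sum>i\<in>{1..n}. \<Sum>j\<in>{1..n} - {\<sigma> i}. h (x (\<sigma> i)) (x j))"
    by (rule sum.cong[OF refl]) (rule inner)
  also have "\<dots> = (\<Sum>i\<in>{1..n}. \<Sum>j\<in>{1..n} - {i}. h (x i) (x j))"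
    by (rule sum.reindex_bij_betw[OF bij, where g = "\<lambda>i. \<Sum>j\<in>{1..n} - {i}. h (x i) (x j)"])
  finally show ?thesis
    by (simp add: ustat_def)
qed

lemma offdiag_count:
  assumes "n \<ge> 2"
  shows "(\<Sum>i\<in>{1..n}. \<Sum>j\<in>{1..n} - {i}. (c::real)) = real n * (real n - 1) * c"
proof -
  have "(\<Sum>j\<in>{1..n} - {i}. c) = (real n - 1) * c" if "i \<in> {1..n}" for i
    using that assms by (simp add: of_nat_diff)
  then have "(\<Sum>i\<in>{1..n}. \<Sum>j\<in>{1..n} - {i}. c) = (\<Sum>i\<in>{1..n}. (real n - 1) * c)"
    by (rule sum.cong[OF refl])
  then show ?thesis by simp
qed

lemma ustat_const: "n \<ge> 2 \<Longrightarrow> ustat (\<lambda>_ _. c) n x = c"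
  unfolding ustat_def offdiag_count by simp

lemma ustat_mono:
  assumes "\<And>i j. i \<in> {1..n} \<Longrightarrow> j \<in> {1..n} \<Longrightarrow> g (x i) (x j) \<le> h (x i) (x j)"
  shows "ustat g n x \<le> ustat h n x"
proof -
  have "0 \<le> 1 / (real n * (real n - 1))"
    by (cases n) auto
  then show ?thesis
    unfolding ustat_def by (intro mult_left_mono sum_mono assms) auto
qed

lemma ustat_diff: "ustat g n x - ustat h n x = ustat (\<lambda>a b. g a b - h a b) n x"
  by (simp add: ustat_def sum_subtractf right_diff_distrib)

text \<open>
This is why all the variables \<open>h(X\<^sub>i, X\<^sub>j)\<close> with \<open>i \<noteq> j\<close> look alike to a symmetric event. Two
transpositions suffice: after \<open>i\<close> has been moved, the second one does not touch \<open>i'\<close>.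
\<close>

lemma permutation_of_two_points:
  assumes "i \<in> A" "j \<in> A" "i' \<in> A" "j' \<in> A" "i \<noteq> j" "i' \<noteq> j'"
  obtains \<sigma> where "\<sigma> permutes A" "\<sigma> i = i'" "\<sigma> j = j'"
proof
  let ?r = "Transposition.transpose i i'"
  let ?\<sigma> = "Transposition.transpose (?r j) j' \<circ> ?r"
  have r: "?r j \<in> A" "?r j \<noteq> i'"
    using assms by (auto simp: Transposition.transpose_def)
  show "?\<sigma> permutes A"
    using assms r by (intro permutes_compose permutes_swap_id)
  show "?\<sigma> i = i'" "?\<sigma> j = j'"
    using assms r by (auto simp: Transposition.transpose_def)
qed

text \<open>
The codomain measure of the observations is their common law itself, so that no separate measurable
structure has to be carried along.
\<close>

locale iid_sample = prob_space M for M :: "'w measure" +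
  fixes Q :: "'a measure" and X :: "nat \<Rightarrow> 'w \<Rightarrow> 'a"
  assumes indep: "indep_vars (\<lambda>_. Q) X {1..}"
    and distr_X: "\<And>i. i \<ge> 1 \<Longrightarrow> distr M Q (X i) = Q"
begin

lemma X_measurable: "i \<ge> 1 \<Longrightarrow> X i \<in> M \<rightarrow>\<^sub>M Q"
  using indep unfolding indep_vars_def by auto

lemma prob_space_Q: "prob_space Q"
  using prob_space_distr[OF X_measurable[of 1]] distr_X[of 1] by simp

lemma joint_law:
  assumes "inj_on \<sigma> I" "\<sigma> ` I \<subseteq> {1..}" "I \<noteq> {}"
  shows "distr M (\<Pi>\<^sub>M i\<in>I. Q) (\<lambda>\<omega>. \<lambda>i\<in>I. X (\<sigma> i) \<omega>) = (\<Pi>\<^sub>M i\<in>I. Q)"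
proof -
  have "indep_vars (\<lambda>j. \<Pi>\<^sub>M i\<in>{\<sigma> j}. Q) (\<lambda>j \<omega>. \<lambda>i\<in>{\<sigma> j}. X i \<omega>) I"
    using assms by (intro indep_vars_restrict[OF indep]) (auto simp: disjoint_family_on_def inj_on_def)
  then have "indep_vars (\<lambda>_. Q) (\<lambda>j \<omega>. (\<lambda>x. x (\<sigma> j)) (\<lambda>i\<in>{\<sigma> j}. X i \<omega>)) I"
    by (rule indep_vars_compose2) auto
  then have "indep_vars (\<lambda>_. Q) (\<lambda>i. X (\<sigma> i)) I"
    by simp
  then have "distr M (\<Pi>\<^sub>M i\<in>I. Q) (\<lambda>\<omega>. \<lambda>i\<in>I. X (\<sigma> i) \<omega>) = (\<Pi>\<^sub>M i\<in>I. distr M Q (X (\<sigma> i)))"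
    using assms X_measurable by (subst indep_vars_iff_distr_eq_PiM'[symmetric]) auto
  also have "\<dots> = (\<Pi>\<^sub>M i\<in>I. Q)"
    using assms distr_X by (intro PiM_cong) auto
  finally show ?thesis .
qed

text \<open>
Exchangeability of an independent and identically distributed sample: both families have the product
law.
\<close>

lemma expectation_permute:
  fixes F :: "(nat \<Rightarrow> 'a) \<Rightarrow> real"
  assumes F: "F \<in> borel_measurable (\<Pi>\<^sub>M i\<in>{1..K}. Q)" and \<sigma>: "\<sigma> permutes {1..K}" and "K \<ge> 1"
  shows "(\<integral>\<omega>. F (\<lambda>i\<in>{1..K}. X (\<sigma> i) \<omega>) \<partial>M) = (\<integral>\<omega>. F (\<lambda>i\<in>{1..K}. X i \<omega>) \<partial>M)"
proof -
  have *: "(\<integral>\<omega>. F (\<lambda>i\<in>{1..K}. X (\<tau> i) \<omega>) \<partial>M) = (\<integral>x. F x \<partial>(\<Pi>\<^sub>M i\<in>{1..K}. Q))"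
    if \<tau>: "\<tau> permutes {1..K}" for \<tau>
  proof -
    have pos: "1 \<le> \<tau> i" if "i \<in> {1..K}" for i
      using permutes_in_image[OF \<tau>] that by (metis atLeastAtMost_iff)
    have "(\<lambda>\<omega>. \<lambda>i\<in>{1..K}. X (\<tau> i) \<omega>) \<in> M \<rightarrow>\<^sub>M (\<Pi>\<^sub>M i\<in>{1..K}. Q)"
      using pos by (intro measurable_restrict X_measurable) auto
    then have "(\<integral>\<omega>. F (\<lambda>i\<in>{1..K}. X (\<tau> i) \<omega>) \<partial>M)
        = (\<integral>x. F x \<partial>(distr M (\<Pi>\<^sub>M i\<in>{1..K}. Q) (\<lambda>\<omega>. \<lambda>i\<in>{1..K}. X (\<tau> i) \<omega>)))"
      using F by (subst integral_distr) auto
    also have "distr M (\<Pi>\<^sub>M i\<in>{1..K}. Q) (\<lambda>\<omega>. \<lambda>i\<in>{1..K}. X (\<tau> i) \<omega>) = (\<Pi>\<^sub>M i\<in>{1..K}. Q)"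
      using pos \<open>K \<ge> 1\<close> permutes_inj_on[OF \<tau>] by (intro joint_law) auto
    finally show ?thesis .
  qed
  show ?thesis
    using *[OF \<sigma>] *[OF permutes_id] by simp
qed

lemma pair_indep:
  assumes "A \<inter> B = {}" "A \<subseteq> {1..}" "B \<subseteq> {1..}"
    "f \<in> (\<Pi>\<^sub>M i\<in>A. Q) \<rightarrow>\<^sub>M N" "g \<in> (\<Pi>\<^sub>M i\<in>B. Q) \<rightarrow>\<^sub>M L"
  shows "indep_var N (\<lambda>\<omega>. f (\<lambda>i\<in>A. X i \<omega>)) L (\<lambda>\<omega>. g (\<lambda>i\<in>B. X i \<omega>))"
  using indep_var_compose[OF indep_var_restrict[OF indep assms(1-3)] assms(4,5)]
  by (simp add: comp_def)

lemma pair_law: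
  assumes "i \<ge> 1" "j \<ge> 1" "i \<noteq> j"
  shows "distr M (Q \<Otimes>\<^sub>M Q) (\<lambda>\<omega>. (X i \<omega>, X j \<omega>)) = Q \<Otimes>\<^sub>M Q"
proof -
  have "indep_var Q (\<lambda>\<omega>. (\<lambda>x. x i) (\<lambda>i\<in>{i}. X i \<omega>)) Q (\<lambda>\<omega>. (\<lambda>x. x j) (\<lambda>i\<in>{j}. X i \<omega>))"
    using assms by (intro pair_indep) auto
  then have "indep_var Q (X i) Q (X j)"
    by simp
  then have "distr M Q (X i) \<Otimes>\<^sub>M distr M Q (X j) = distr M (Q \<Otimes>\<^sub>M Q) (\<lambda>\<omega>. (X i \<omega>, X j \<omega>))"
    unfolding indep_var_distribution_eq by simp
  then show ?thesis
    using assms distr_X by simp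
qed

lemma pair_measurable: "i \<ge> 1 \<Longrightarrow> j \<ge> 1 \<Longrightarrow> (\<lambda>\<omega>. (X i \<omega>, X j \<omega>)) \<in> M \<rightarrow>\<^sub>M Q \<Otimes>\<^sub>M Q"
  by (intro measurable_Pair X_measurable)

lemma pair_integral:
  fixes g :: "'a \<Rightarrow> 'a \<Rightarrow> real"
  assumes "(\<lambda>(a, b). g a b) \<in> borel_measurable (Q \<Otimes>\<^sub>M Q)" "i \<ge> 1" "j \<ge> 1" "i \<noteq> j"
  shows "(\<integral>\<omega>. g (X i \<omega>) (X j \<omega>) \<partial>M) = (\<integral>(a, b). g a b \<partial>(Q \<Otimes>\<^sub>M Q))"
proof -
  have "(\<integral>(a, b). g a b \<partial>(distr M (Q \<Otimes>\<^sub>M Q) (\<lambda>\<omega>. (X i \<omega>, X j \<omega>)))) = (\<integral>\<omega>. g (X i \<omega>) (X j \<omega>) \<partial>M)"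
    using assms pair_measurable by (subst integral_distr) auto
  then show ?thesis
    using pair_law[OF assms(2-4)] by simp
qed

lemma pair_integrable:
  fixes g :: "'a \<Rightarrow> 'a \<Rightarrow> real"
  assumes "integrable (Q \<Otimes>\<^sub>M Q) (\<lambda>(a, b). g a b)" "i \<ge> 1" "j \<ge> 1" "i \<noteq> j"
  shows "integrable M (\<lambda>\<omega>. g (X i \<omega>) (X j \<omega>))"
proof -
  have "integrable (distr M (Q \<Otimes>\<^sub>M Q) (\<lambda>\<omega>. (X i \<omega>, X j \<omega>))) (\<lambda>(a, b). g a b)"
    using pair_law[OF assms(2-4)] assms(1) by simp
  then show ?thesis
    using assms pair_measurable by (subst (asm) integrable_distr_eq) (auto simp: case_prod_unfold)
qed

lemma ustat_integrable:
  assumes "integrable (Q \<Otimes>\<^sub>M Q) (\<lambda>(a, b). h a b)"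
  shows "integrable M (\<lambda>\<omega>. ustat h n (\<lambda>i. X i \<omega>))"
  unfolding ustat_def
  by (intro integrable_mult_right Bochner_Integration.integrable_sum pair_integrable[OF assms]) auto

lemma ustat_abs_integral_le:
  assumes h: "integrable (Q \<Otimes>\<^sub>M Q) (\<lambda>(a, b). h a b)" and n: "n \<ge> 2"
  shows "(\<integral>\<omega>. \<bar>ustat h n (\<lambda>i. X i \<omega>)\<bar> \<partial>M) \<le> (\<integral>(a, b). \<bar>h a b\<bar> \<partial>(Q \<Otimes>\<^sub>M Q))"
proof -
  let ?g = "\<lambda>a b. \<bar>h a b\<bar>"
  have g: "integrable (Q \<Otimes>\<^sub>M Q) (\<lambda>(a, b). ?g a b)"
    using integrable_abs[OF h] by (simp add: case_prod_unfold)
  have "\<bar>ustat h n x\<bar> \<le> ustat ?g n x" for x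
    using n unfolding ustat_def abs_mult
    by (intro mult_mono order_trans[OF sum_abs] sum_mono) (auto intro!: sum_nonneg)
  then have "(\<integral>\<omega>. \<bar>ustat h n (\<lambda>i. X i \<omega>)\<bar> \<partial>M) \<le> (\<integral>\<omega>. ustat ?g n (\<lambda>i. X i \<omega>) \<partial>M)"
    by (intro integral_mono integrable_abs ustat_integrable h g)
  also have "\<dots> = 1 / (real n * (real n - 1)) *
      (\<Sum>i\<in>{1..n}. \<Sum>j\<in>{1..n} - {i}. \<integral>(a, b). ?g a b \<partial>(Q \<Otimes>\<^sub>M Q))"
    unfolding ustat_def
    apply (subst integral_mult_right_zero)
    apply (subst Bochner_Integration.integral_sum)
     apply (intro Bochner_Integration.integrable_sum pair_integrable[OF g]; auto)
    apply (intro arg_cong2[where f = "(*)"] refl sum.cong)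
    apply (subst Bochner_Integration.integral_sum)
     apply (intro pair_integrable[OF g]; auto)
    apply (intro sum.cong refl pair_integral)
    using g by auto
  also have "\<dots> = (\<integral>(a, b). ?g a b \<partial>(Q \<Otimes>\<^sub>M Q))"
    unfolding offdiag_count[OF n] using n by simp
  finally show ?thesis .
qed

lemma ustat_measurable_PiM:
  assumes "(\<lambda>(a, b). h a b) \<in> borel_measurable (Q \<Otimes>\<^sub>M Q)" "n \<le> K"
  shows "ustat h n \<in> borel_measurable (\<Pi>\<^sub>M i\<in>{1..K}. Q)"
proof -
  have "(\<lambda>x. h (x i) (x j)) \<in> borel_measurable (\<Pi>\<^sub>M i\<in>{1..K}. Q)" if "i \<in> {1..n}" "j \<in> {1..n}" for i j
  proof -
    have "(\<lambda>x. (x i, x j)) \<in> (\<Pi>\<^sub>M i\<in>{1..K}. Q) \<rightarrow>\<^sub>M Q \<Otimes>\<^sub>M Q"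
      using that assms by (intro measurable_Pair measurable_component_singleton) auto
    from measurable_compose[OF this assms(1)] show ?thesis by simp
  qed
  then show ?thesis
    unfolding ustat_def by (intro borel_measurable_times borel_measurable_sum borel_measurable_const) auto
qed

lemma ustat_restrict: "n \<le> K \<Longrightarrow> ustat h n (\<lambda>i\<in>{1..K}. x i) = ustat h n x"
  by (intro ustat_cong) auto

text \<open>
By exchangeability \<open>E[h(X\<^sub>i, X\<^sub>j) \<phi>]\<close> is the same for all pairs of distinct \<open>i, j \<le> n\<close> when
\<open>\<phi>\<close> is symmetric in the first \<open>n\<close> observations, so every average of these numbers has the same value.
This is the reversed martingale property of \<open>U\<^sub>n\<close>; testing against \<open>\<phi>\<close> replaces conditioning on the
symmetric sigma-algebra.
\<close>

lemma ustat_reverse_martingale: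
  fixes \<phi> :: "(nat \<Rightarrow> 'a) \<Rightarrow> real"
  assumes h: "integrable (Q \<Otimes>\<^sub>M Q) (\<lambda>(a, b). h a b)"
    and \<phi>: "\<phi> \<in> borel_measurable (\<Pi>\<^sub>M i\<in>{1..K}. Q)" "\<And>x. \<bar>\<phi> x\<bar> \<le> 1"
    and symm: "\<And>x \<sigma>. \<sigma> permutes {1..n} \<Longrightarrow> \<phi> (\<lambda>i\<in>{1..K}. x (\<sigma> i)) = \<phi> (\<lambda>i\<in>{1..K}. x i)"
    and N: "2 \<le> N" "N \<le> n" "n \<le> K"
  shows "(\<integral>\<omega>. ustat h N (\<lambda>i. X i \<omega>) * \<phi> (\<lambda>i\<in>{1..K}. X i \<omega>) \<partial>M)
       = (\<integral>\<omega>. ustat h n (\<lambda>i. X i \<omega>) * \<phi> (\<lambda>i\<in>{1..K}. X i \<omega>) \<partial>M)"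
proof -
  let ?\<phi> = "\<lambda>\<omega>. \<phi> (\<lambda>i\<in>{1..K}. X i \<omega>)"
  define e where "e i j = (\<integral>\<omega>. h (X i \<omega>) (X j \<omega>) * ?\<phi> \<omega> \<partial>M)" for i j
  have \<phi>_M: "?\<phi> \<in> borel_measurable M"
    by (rule measurable_compose[OF _ \<phi>(1)]) (auto intro!: measurable_restrict X_measurable)
  have int: "integrable M (\<lambda>\<omega>. h (X i \<omega>) (X j \<omega>) * ?\<phi> \<omega>)" if "1 \<le> i" "1 \<le> j" "i \<noteq> j" for i j
  proof (rule Bochner_Integration.integrable_bound)
    show "integrable M (\<lambda>\<omega>. h (X i \<omega>) (X j \<omega>))"
      by (rule pair_integrable[OF h that])
    then show "(\<lambda>\<omega>. h (X i \<omega>) (X j \<omega>) * ?\<phi> \<omega>) \<in> borel_measurable M"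
      using \<phi>_M by measurable
    show "AE \<omega> in M. norm (h (X i \<omega>) (X j \<omega>) * ?\<phi> \<omega>) \<le> norm (h (X i \<omega>) (X j \<omega>))"
      using \<phi>(2) by (auto simp: abs_mult intro!: mult_left_le)
  qed
  have e_eq: "e i j = e 1 2" if ij: "i \<in> {1..n}" "j \<in> {1..n}" "i \<noteq> j" for i j
  proof -
    obtain \<sigma> where \<sigma>: "\<sigma> permutes {1..n}" "\<sigma> 1 = i" "\<sigma> 2 = j"
      using permutation_of_two_points[of 1 "{1..n}" 2 i j] ij N by auto
    have \<sigma>K: "\<sigma> permutes {1..K}"
      using N by (intro permutes_subset[OF \<sigma>(1)]) auto
    let ?F = "\<lambda>x. h (x 1) (x 2) * \<phi> (\<lambda>i\<in>{1..K}. x i)"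
    have "(\<lambda>x. (x 1, x 2)) \<in> (\<Pi>\<^sub>M i\<in>{1..K}. Q) \<rightarrow>\<^sub>M Q \<Otimes>\<^sub>M Q"
      using N by (intro measurable_Pair measurable_component_singleton) auto
    from measurable_compose[OF this borel_measurable_integrable[OF h]]
    have "(\<lambda>x. h (x 1) (x 2)) \<in> borel_measurable (\<Pi>\<^sub>M i\<in>{1..K}. Q)" by simp
    moreover have "(\<lambda>x. \<phi> (\<lambda>i\<in>{1..K}. x i)) \<in> borel_measurable (\<Pi>\<^sub>M i\<in>{1..K}. Q)"
      by (rule measurable_compose[OF _ \<phi>(1)]) (auto intro!: measurable_restrict measurable_component_singleton)
    ultimately have F: "?F \<in> borel_measurable (\<Pi>\<^sub>M i\<in>{1..K}. Q)"
      by measurable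
    have restr: "(\<lambda>i\<in>{1..K}. (\<lambda>i\<in>{1..K}. f i) i) = (\<lambda>i\<in>{1..K}. f i)" for f :: "nat \<Rightarrow> 'a"
      by auto
    have "e 1 2 = (\<integral>\<omega>. ?F (\<lambda>i\<in>{1..K}. X i \<omega>) \<partial>M)"
      unfolding e_def restr using N by simp
    also have "\<dots> = (\<integral>\<omega>. ?F (\<lambda>i\<in>{1..K}. X (\<sigma> i) \<omega>) \<partial>M)"
      using N by (intro expectation_permute[OF F \<sigma>K, symmetric]) auto
    also have "\<dots> = e i j"
      unfolding e_def restr using N \<sigma>(2,3) symm[OF \<sigma>(1), of "\<lambda>i. X i _"] by simp
    finally show ?thesis by simp
  qed
  have U: "(\<integral>\<omega>. ustat h m (\<lambda>i. X i \<omega>) * ?\<phi> \<omega> \<partial>M) = e 1 2" if m: "2 \<le> m" "m \<le> n" for m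
  proof -
    have "(\<integral>\<omega>. ustat h m (\<lambda>i. X i \<omega>) * ?\<phi> \<omega> \<partial>M)
        = (\<integral>\<omega>. 1 / (real m * (real m - 1)) *
            (\<Sum>i\<in>{1..m}. \<Sum>j\<in>{1..m} - {i}. h (X i \<omega>) (X j \<omega>) * ?\<phi> \<omega>) \<partial>M)"
      unfolding ustat_def by (simp add: sum_distrib_right mult.assoc)
    also have "\<dots> = 1 / (real m * (real m - 1)) * (\<Sum>i\<in>{1..m}. \<Sum>j\<in>{1..m} - {i}. e i j)"
      unfolding e_def
      apply (subst integral_mult_right_zero)
      apply (subst Bochner_Integration.integral_sum)
       apply (intro Bochner_Integration.integrable_sum int; auto)
      apply (intro arg_cong2[where f = "(*)"] refl sum.cong)
      apply (subst Bochner_Integration.integral_sum)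
       apply (intro int; auto)
      apply simp
      done
    also have "(\<Sum>i\<in>{1..m}. \<Sum>j\<in>{1..m} - {i}. e i j) = (\<Sum>i\<in>{1..m}. \<Sum>j\<in>{1..m} - {i}. e 1 2)"
      using m by (intro sum.cong refl e_eq) auto
    also have "1 / (real m * (real m - 1)) * \<dots> = e 1 2"
      unfolding offdiag_count[OF m(1)] using m by simp
    finally show ?thesis .
  qed
  show ?thesis
    using U[of N] U[of n] N by simp
qed

end

section \<open>Maximal inequality and strong law for U-statistics\<close>

context iid_sample
begin

text \<open>
Doob's maximal inequality in reversed time. Splitting the event by the last index \<open>n \<le> K\<close> at which
the threshold is exceeded gives events that are symmetric in the first \<open>n\<close> observations, because they
only involve \<open>U\<^sub>n, \<dots>, U\<^sub>K\<close>. On each of them the reversed martingale identity replaces \<open>U\<^sub>n\<close> by \<open>U\<^sub>N\<close>.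
The bound does not depend on \<open>K\<close>.
\<close>

lemma ustat_maximal_centered:
  assumes h: "integrable (Q \<Otimes>\<^sub>M Q) (\<lambda>(a, b). h a b)"
    and N: "2 \<le> N" "N \<le> K" and \<epsilon>: "0 < \<epsilon>"
  shows "\<epsilon> * prob {\<omega>\<in>space M. \<exists>n\<in>{N..K}. \<epsilon> \<le> \<bar>ustat h n (\<lambda>i. X i \<omega>)\<bar>}
    \<le> (\<integral>\<omega>. \<bar>ustat h N (\<lambda>i. X i \<omega>)\<bar> \<partial>M)"
proof -
  \<comment> \<open>\<open>\<phi> n\<close> is the sign of \<open>U\<^sub>n\<close> on the event that \<open>n\<close> is the last index in \<open>N..K\<close> with a large value.\<close>
  define is_last where "is_last n x \<longleftrightarrow> \<epsilon> \<le> \<bar>ustat h n x\<bar> \<and> (\<forall>m\<in>{n<..K}. \<bar>ustat h m x\<bar> < \<epsilon>)" for n x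
  define \<phi> where "\<phi> n x = sgn (ustat h n x) * (of_bool (is_last n x) :: real)" for n x
  let ?X = "\<lambda>\<omega> i. X i \<omega>"
  let ?XK = "\<lambda>\<omega>. \<lambda>i\<in>{1..K}. X i \<omega>"
  let ?A = "{\<omega>\<in>space M. \<exists>n\<in>{N..K}. \<epsilon> \<le> \<bar>ustat h n (?X \<omega>)\<bar>}"
  note [measurable] = borel_measurable_integrable[OF h]
  have U_meas: "(\<lambda>\<omega>. ustat h n (?X \<omega>)) \<in> borel_measurable M" for n
    by (rule borel_measurable_integrable[OF ustat_integrable[OF h]])
  \<comment> \<open>The product form makes measurability evident.\<close>
  have \<phi>_alt: "\<phi> n x = sgn (ustat h n x) * (if \<epsilon> \<le> \<bar>ustat h n x\<bar> then 1 else 0)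
      * (\<Prod>m\<in>{n<..K}. if \<bar>ustat h m x\<bar> < \<epsilon> then 1 else 0)" for n x
    by (auto simp: \<phi>_def is_last_def)
  have \<phi>_meas: "\<phi> n \<in> borel_measurable (\<Pi>\<^sub>M i\<in>{1..K}. Q)" if "n \<le> K" for n
  proof -
    have *: "ustat h m \<in> borel_measurable (\<Pi>\<^sub>M i\<in>{1..K}. Q)" if "m \<le> K" for m
      using that by (intro ustat_measurable_PiM) auto
    note [measurable] = *[OF \<open>n \<le> K\<close>]
    have "(\<lambda>x. \<Prod>m\<in>{n<..K}. if \<bar>ustat h m x\<bar> < \<epsilon> then 1 else (0::real)) \<in> borel_measurable (\<Pi>\<^sub>M i\<in>{1..K}. Q)"
    proof (rule borel_measurable_prod)
      fix m assume "m \<in> {n<..K}"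
      then have [measurable]: "ustat h m \<in> borel_measurable (\<Pi>\<^sub>M i\<in>{1..K}. Q)"
        by (intro *) auto
      show "(\<lambda>x. if \<bar>ustat h m x\<bar> < \<epsilon> then 1 else (0::real)) \<in> borel_measurable (\<Pi>\<^sub>M i\<in>{1..K}. Q)"
        by measurable
    qed
    then show ?thesis
      unfolding \<phi>_alt[abs_def] by measurable
  qed
  have \<phi>_le: "\<bar>\<phi> n x\<bar> \<le> 1" for n x
    by (simp add: \<phi>_def abs_mult abs_sgn_eq)
  have \<phi>_restrict: "\<phi> n (\<lambda>i\<in>{1..K}. x i) = \<phi> n x" if "n \<le> K" for n x
  proof -
    have "is_last n (\<lambda>i\<in>{1..K}. x i) \<longleftrightarrow> is_last n x"
      unfolding is_last_def using that
      by (intro conj_cong ball_cong refl) (simp_all add: ustat_restrict del: One_nat_def)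
    then show ?thesis
      using that by (simp add: \<phi>_def ustat_restrict del: One_nat_def)
  qed
  have \<phi>_M: "(\<lambda>\<omega>. \<phi> n (?X \<omega>)) \<in> borel_measurable M" if "n \<le> K" for n
  proof -
    have "(\<lambda>\<omega>. \<phi> n (?XK \<omega>)) \<in> borel_measurable M"
      by (rule measurable_compose[OF _ \<phi>_meas[OF that]]) (auto intro!: measurable_restrict X_measurable)
    then show ?thesis
      by (simp add: \<phi>_restrict[OF that] del: One_nat_def)
  qed
  have symm: "\<phi> n (\<lambda>i\<in>{1..K}. x (\<sigma> i)) = \<phi> n (\<lambda>i\<in>{1..K}. x i)"
    if "n \<le> K" "\<sigma> permutes {1..n}" for n x \<sigma>
  proof -
    have "ustat h m (\<lambda>i. x (\<sigma> i)) = ustat h m x" if "n \<le> m" for m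
      using that by (intro ustat_permute permutes_subset[OF \<open>\<sigma> permutes {1..n}\<close>]) auto
    then have "\<phi> n (\<lambda>i. x (\<sigma> i)) = \<phi> n x"
      by (simp add: \<phi>_def is_last_def)
    then show ?thesis
      by (simp add: \<phi>_restrict[OF that(1)] del: One_nat_def)
  qed
  have int: "integrable M (\<lambda>\<omega>. ustat h m (?X \<omega>) * \<phi> n (?X \<omega>))" if "n \<le> K" for m n
  proof (rule Bochner_Integration.integrable_bound[OF ustat_integrable[OF h, of m]])
    show "(\<lambda>\<omega>. ustat h m (?X \<omega>) * \<phi> n (?X \<omega>)) \<in> borel_measurable M"
      using U_meas \<phi>_M[OF that] by measurable
    show "AE \<omega> in M. norm (ustat h m (?X \<omega>) * \<phi> n (?X \<omega>)) \<le> norm (ustat h m (?X \<omega>))"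
      using \<phi>_le by (auto simp: abs_mult intro!: mult_left_le)
  qed
  have reverse: "(\<integral>\<omega>. ustat h N (?X \<omega>) * \<phi> n (?X \<omega>) \<partial>M) = (\<integral>\<omega>. ustat h n (?X \<omega>) * \<phi> n (?X \<omega>) \<partial>M)"
    if "n \<in> {N..K}" for n
  proof -
    have "n \<le> K" using that by simp
    then show ?thesis
      using ustat_reverse_martingale[OF h \<phi>_meas \<phi>_le symm, where N = N and n = n] that N
      by (simp only: \<phi>_restrict) simp
  qed
  have A_meas [measurable]: "?A \<in> sets M"
  proof -
    have "?A = (\<Union>n\<in>{N..K}. {\<omega>\<in>space M. \<epsilon> \<le> \<bar>ustat h n (?X \<omega>)\<bar>})"
      by auto
    also have "\<dots> \<in> sets M"
      using U_meas by (intro sets.finite_UN) (auto intro!: borel_measurable_le)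
    finally show ?thesis .
  qed
  have indicator_le: "\<epsilon> * indicator ?A \<omega> \<le> (\<Sum>n\<in>{N..K}. ustat h n (?X \<omega>) * \<phi> n (?X \<omega>))"
    if "\<omega> \<in> space M" for \<omega>
  proof -
    have nonneg: "0 \<le> ustat h n (?X \<omega>) * \<phi> n (?X \<omega>)" for n
      unfolding \<phi>_def by (simp add: mult.assoc[symmetric] abs_sgn[symmetric])
    show ?thesis
    proof (cases "\<omega> \<in> ?A")
      case True
      let ?L = "{n\<in>{N..K}. \<epsilon> \<le> \<bar>ustat h n (?X \<omega>)\<bar>}"
      have L: "finite ?L" "?L \<noteq> {}"
        using True by auto
      define n where "n = Max ?L"
      have n: "n \<in> ?L"
        unfolding n_def using L by (rule Max_in)
      have "is_last n (?X \<omega>)"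
        unfolding is_last_def
      proof (intro conjI ballI)
        fix m assume m: "m \<in> {n<..K}"
        show "\<bar>ustat h m (?X \<omega>)\<bar> < \<epsilon>"
        proof (rule ccontr)
          assume "\<not> ?thesis"
          with m n have "m \<in> ?L" by auto
          then have "m \<le> n"
            unfolding n_def using L(1) by (intro Max_ge)
          with m show False by simp
        qed
      qed (use n in simp)
      then have "\<epsilon> \<le> ustat h n (?X \<omega>) * \<phi> n (?X \<omega>)"
        using n unfolding \<phi>_def by (simp add: abs_sgn[symmetric])
      also have "\<dots> \<le> (\<Sum>n\<in>{N..K}. ustat h n (?X \<omega>) * \<phi> n (?X \<omega>))"
        using n nonneg by (intro member_le_sum) auto
      finally show ?thesis
        using True by simp
    qed (auto intro!: sum_nonneg nonneg)
  qed
  have disj: "(\<Sum>n\<in>{N..K}. \<bar>\<phi> n x\<bar>) \<le> 1" for x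
  proof (cases "\<exists>n\<in>{N..K}. is_last n x")
    case True
    then obtain n where n: "n \<in> {N..K}" "is_last n x" by blast
    have "\<bar>\<phi> m x\<bar> = 0" if "m \<in> {N..K} - {n}" for m
      using that n by (force simp: \<phi>_def is_last_def not_less neq_iff)
    then have "(\<Sum>m\<in>{N..K}. \<bar>\<phi> m x\<bar>) = \<bar>\<phi> n x\<bar>"
      using n by (subst sum.remove[of _ n]) auto
    then show ?thesis
      using \<phi>_le by simp
  qed (simp add: \<phi>_def)
  have "\<epsilon> * prob ?A = (\<integral>\<omega>. \<epsilon> * indicator ?A \<omega> \<partial>M)"
    by (simp add: measure_def[symmetric])
  also have "\<dots> \<le> (\<integral>\<omega>. (\<Sum>n\<in>{N..K}. ustat h n (?X \<omega>) * \<phi> n (?X \<omega>)) \<partial>M)"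
    by (intro integral_mono indicator_le Bochner_Integration.integrable_sum int)
      (auto intro!: integrable_mult_right integrable_real_indicator simp: emeasure_eq_measure)
  also have "\<dots> = (\<Sum>n\<in>{N..K}. \<integral>\<omega>. ustat h N (?X \<omega>) * \<phi> n (?X \<omega>) \<partial>M)"
    by (subst Bochner_Integration.integral_sum) (auto intro!: int sum.cong simp: reverse)
  also have "\<dots> = (\<integral>\<omega>. (\<Sum>n\<in>{N..K}. ustat h N (?X \<omega>) * \<phi> n (?X \<omega>)) \<partial>M)"
    by (subst Bochner_Integration.integral_sum) (auto intro!: int)
  also have "\<dots> \<le> (\<integral>\<omega>. \<bar>ustat h N (?X \<omega>)\<bar> \<partial>M)"
  proof (intro integral_mono Bochner_Integration.integrable_sum int integrable_abs ustat_integrable h)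
    fix \<omega>
    have "(\<Sum>n\<in>{N..K}. ustat h N (?X \<omega>) * \<phi> n (?X \<omega>)) \<le> \<bar>\<Sum>n\<in>{N..K}. ustat h N (?X \<omega>) * \<phi> n (?X \<omega>)\<bar>"
      by simp
    also have "\<dots> \<le> (\<Sum>n\<in>{N..K}. \<bar>ustat h N (?X \<omega>) * \<phi> n (?X \<omega>)\<bar>)"
      by (rule sum_abs)
    also have "\<dots> = \<bar>ustat h N (?X \<omega>)\<bar> * (\<Sum>n\<in>{N..K}. \<bar>\<phi> n (?X \<omega>)\<bar>)"
      by (simp add: abs_mult sum_distrib_left)
    also have "\<dots> \<le> \<bar>ustat h N (?X \<omega>)\<bar>"
      using disj by (intro mult_left_le) auto
    finally show "(\<Sum>n\<in>{N..K}. ustat h N (?X \<omega>) * \<phi> n (?X \<omega>)) \<le> \<bar>ustat h N (?X \<omega>)\<bar>" .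
  qed auto
  finally show ?thesis .
qed

text \<open>
Pairs of pairs without a common index are uncorrelated, and only a fraction of order \<open>1 / n\<close> of them
share an index.
\<close>

lemma ustat_second_moment_le:
  assumes g: "(\<lambda>(a, b). g a b) \<in> borel_measurable (Q \<Otimes>\<^sub>M Q)" and B: "\<And>a b. \<bar>g a b\<bar> \<le> B"
    and centered: "(\<integral>(a, b). g a b \<partial>(Q \<Otimes>\<^sub>M Q)) = 0" and n: "2 \<le> n"
  shows "(\<integral>\<omega>. (ustat g n (\<lambda>i. X i \<omega>))\<^sup>2 \<partial>M) \<le> 4 * B\<^sup>2 / (real n - 1)"
proof -
  define G where "G i j \<omega> = g (X i \<omega>) (X j \<omega>)" for i j \<omega>
  let ?I = "{1..n}"
  have B0: "0 \<le> B"
    using B[of undefined undefined] by simp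
  have G_meas: "G i j \<in> borel_measurable M" if "i \<in> ?I" "j \<in> ?I" for i j
    unfolding G_def using measurable_compose[OF pair_measurable g, of i j] that by simp
  have int: "integrable M (\<lambda>\<omega>. G i j \<omega> * G k l \<omega>)" if "i \<in> ?I" "j \<in> ?I" "k \<in> ?I" "l \<in> ?I" for i j k l
  proof (rule integrable_const_bound[where B = "B * B"])
    show "AE \<omega> in M. norm (G i j \<omega> * G k l \<omega>) \<le> B * B"
      using B B0 by (auto simp: G_def abs_mult intro!: mult_mono)
    show "(\<lambda>\<omega>. G i j \<omega> * G k l \<omega>) \<in> borel_measurable M"
      using G_meas[of i j] G_meas[of k l] that by simp
  qed
  \<comment> \<open>\<open>c\<close> is at least 1 when the two pairs share an index, and its sum over \<open>k, l\<close> is easy to bound.\<close>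
  define c where "c i j k l = (of_bool (k = i) + of_bool (k = j) + of_bool (l = i) + of_bool (l = j) :: real)"
    for i j k l :: nat
  have cov: "(\<integral>\<omega>. G i j \<omega> * G k l \<omega> \<partial>M) \<le> B\<^sup>2 * c i j k l"
    if "i \<in> ?I" "j \<in> ?I - {i}" "k \<in> ?I" "l \<in> ?I - {k}" for i j k l
  proof (cases "{i, j} \<inter> {k, l} = {}")
    case True
    have m: "(\<lambda>x. g (x a) (x b)) \<in> borel_measurable (\<Pi>\<^sub>M i\<in>{a, b}. Q)" for a b :: nat
    proof -
      have "(\<lambda>x. (x a, x b)) \<in> (\<Pi>\<^sub>M i\<in>{a, b}. Q) \<rightarrow>\<^sub>M Q \<Otimes>\<^sub>M Q"
        by (intro measurable_Pair measurable_component_singleton) auto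
      from measurable_compose[OF this g] show ?thesis by simp
    qed
    have "indep_var borel (\<lambda>\<omega>. (\<lambda>x. g (x i) (x j)) (\<lambda>m\<in>{i, j}. X m \<omega>))
                    borel (\<lambda>\<omega>. (\<lambda>x. g (x k) (x l)) (\<lambda>m\<in>{k, l}. X m \<omega>))"
      using that True by (intro pair_indep m) auto
    then have ind: "indep_var borel (G i j) borel (G k l)"
      unfolding G_def by simp
    have i: "integrable M (G a b)" if "a \<in> ?I" "b \<in> ?I" for a b
      using G_meas[OF that] B by (intro integrable_const_bound[where B = B]) (auto simp: G_def)
    have "(\<integral>\<omega>. G i j \<omega> * G k l \<omega> \<partial>M) = (\<integral>\<omega>. G i j \<omega> \<partial>M) * (\<integral>\<omega>. G k l \<omega> \<partial>M)"
      using that by (intro indep_var_lebesgue_integral i ind) auto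
    also have "(\<integral>\<omega>. G i j \<omega> \<partial>M) = 0"
      unfolding G_def using pair_integral[OF g, of i j] that centered by auto
    finally show ?thesis
      by (simp add: c_def)
  next
    case False
    then have "1 \<le> c i j k l"
      by (auto simp: c_def)
    have "(\<integral>\<omega>. G i j \<omega> * G k l \<omega> \<partial>M) \<le> (\<integral>\<omega>. B * B \<partial>M)"
    proof (intro integral_mono int)
      fix \<omega>
      have "G i j \<omega> * G k l \<omega> \<le> \<bar>G i j \<omega>\<bar> * \<bar>G k l \<omega>\<bar>"
        by (simp add: abs_mult[symmetric])
      also have "\<dots> \<le> B * B"
        using B B0 by (auto simp: G_def intro!: mult_mono)
      finally show "G i j \<omega> * G k l \<omega> \<le> B * B" .
    qed (use that in auto)
    also have "\<dots> = B\<^sup>2 * 1"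
      by (simp add: prob_space power2_eq_square)
    also have "\<dots> \<le> B\<^sup>2 * c i j k l"
      using \<open>1 \<le> c i j k l\<close> by (intro mult_left_mono) auto
    finally show ?thesis .
  qed
  have c_sum: "(\<Sum>k\<in>?I. \<Sum>l\<in>?I - {k}. c i j k l) \<le> 4 * real n" if "i \<in> ?I" "j \<in> ?I" for i j
  proof -
    have "(\<Sum>k\<in>?I. \<Sum>l\<in>?I - {k}. c i j k l) \<le> (\<Sum>k\<in>?I. \<Sum>l\<in>?I. c i j k l)"
      by (intro sum_mono sum_mono2) (auto simp: c_def)
    also have "\<dots> = (\<Sum>k\<in>?I. real n * (of_bool (k = i) + of_bool (k = j)) + 2)"
      using that by (intro sum.cong refl) (simp add: c_def sum.distrib of_bool_def distrib_left)
    also have "\<dots> = 4 * real n"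
      using that by (simp only: sum.distrib sum_distrib_left[symmetric]) (simp add: of_bool_def)
    finally show ?thesis .
  qed
  define \<kappa> where "\<kappa> = 1 / (real n * (real n - 1))"
  have square: "(\<Sum>i\<in>?I. \<Sum>j\<in>?I - {i}. G i j \<omega>)\<^sup>2
      = (\<Sum>i\<in>?I. \<Sum>j\<in>?I - {i}. \<Sum>k\<in>?I. \<Sum>l\<in>?I - {k}. G i j \<omega> * G k l \<omega>)" for \<omega>
    unfolding power2_eq_square sum_distrib_right unfolding sum_distrib_left ..
  have "(\<integral>\<omega>. (ustat g n (\<lambda>i. X i \<omega>))\<^sup>2 \<partial>M)
      = (\<integral>\<omega>. \<kappa>\<^sup>2 * (\<Sum>i\<in>?I. \<Sum>j\<in>?I - {i}. \<Sum>k\<in>?I. \<Sum>l\<in>?I - {k}. G i j \<omega> * G k l \<omega>) \<partial>M)"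
    unfolding ustat_def \<kappa>_def[symmetric] G_def[symmetric] power_mult_distrib square ..
  also have "\<dots> = \<kappa>\<^sup>2 * (\<Sum>i\<in>?I. \<Sum>j\<in>?I - {i}. \<Sum>k\<in>?I. \<Sum>l\<in>?I - {k}. \<integral>\<omega>. G i j \<omega> * G k l \<omega> \<partial>M)"
  proof -
    have "(\<integral>\<omega>. (\<Sum>i\<in>?I. \<Sum>j\<in>?I - {i}. \<Sum>k\<in>?I. \<Sum>l\<in>?I - {k}. G i j \<omega> * G k l \<omega>) \<partial>M)
      = (\<Sum>i\<in>?I. \<Sum>j\<in>?I - {i}. \<Sum>k\<in>?I. \<Sum>l\<in>?I - {k}. \<integral>\<omega>. G i j \<omega> * G k l \<omega> \<partial>M)"
      apply (subst Bochner_Integration.integral_sum,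
          (intro Bochner_Integration.integrable_sum int; auto)[1], rule sum.cong[OF refl])+
      apply (rule refl)
      done
    then show ?thesis by simp
  qed
  also have "\<dots> \<le> \<kappa>\<^sup>2 * (\<Sum>i\<in>?I. \<Sum>j\<in>?I - {i}. \<Sum>k\<in>?I. \<Sum>l\<in>?I - {k}. B\<^sup>2 * c i j k l)"
    by (intro mult_left_mono sum_mono cov) auto
  also have "\<dots> \<le> \<kappa>\<^sup>2 * (\<Sum>i\<in>?I. \<Sum>j\<in>?I - {i}. B\<^sup>2 * (4 * real n))"
  proof (intro mult_left_mono sum_mono)
    fix i j assume "i \<in> ?I" "j \<in> ?I - {i}"
    then have "B\<^sup>2 * (\<Sum>k\<in>?I. \<Sum>l\<in>?I - {k}. c i j k l) \<le> B\<^sup>2 * (4 * real n)"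
      by (intro mult_left_mono c_sum) auto
    then show "(\<Sum>k\<in>?I. \<Sum>l\<in>?I - {k}. B\<^sup>2 * c i j k l) \<le> B\<^sup>2 * (4 * real n)"
      by (simp only: sum_distrib_left)
  qed simp
  also have "\<dots> = 4 * B\<^sup>2 / (real n - 1)"
  proof -
    have "(1 / (a * b))\<^sup>2 * (a * b * (B\<^sup>2 * (4 * a))) = 4 * B\<^sup>2 / b" if "a \<noteq> 0" "b \<noteq> 0" for a b :: real
      using that by (simp add: power2_eq_square)
    then show ?thesis
      unfolding offdiag_count[OF n] \<kappa>_def using n by simp
  qed
  finally show ?thesis .
qed

lemma ustat_diff_integrable:
  fixes h :: "'a \<Rightarrow> 'a \<Rightarrow> real"
  assumes h: "integrable (Q \<Otimes>\<^sub>M Q) (\<lambda>(a, b). h a b)"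
  shows "integrable (Q \<Otimes>\<^sub>M Q) (\<lambda>(a, b). h a b - c)"
    and "(\<integral>(a, b). h a b - c \<partial>(Q \<Otimes>\<^sub>M Q)) = (\<integral>(a, b). h a b \<partial>(Q \<Otimes>\<^sub>M Q)) - c"
proof -
  interpret Q: prob_space Q by (rule prob_space_Q)
  interpret QQ: pair_prob_space Q Q ..
  show "integrable (Q \<Otimes>\<^sub>M Q) (\<lambda>(a, b). h a b - c)"
    using h by (simp add: case_prod_unfold)
  show "(\<integral>(a, b). h a b - c \<partial>(Q \<Otimes>\<^sub>M Q)) = (\<integral>(a, b). h a b \<partial>(Q \<Otimes>\<^sub>M Q)) - c"
    using h by (simp add: case_prod_unfold QQ.P.prob_space)
qed

lemma ustat_centered: "2 \<le> n \<Longrightarrow> ustat (\<lambda>a b. h a b - c) n x = ustat h n x - c"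
  using ustat_diff[of h n x "\<lambda>_ _. c"] ustat_const[of n c x] by simp

lemma ustat_maximal:
  assumes h: "integrable (Q \<Otimes>\<^sub>M Q) (\<lambda>(a, b). h a b)"
    and N: "2 \<le> N" "N \<le> K" and \<epsilon>: "0 < \<epsilon>"
  shows "\<epsilon> * prob {\<omega>\<in>space M. \<exists>n\<in>{N..K}. \<epsilon> \<le> \<bar>ustat h n (\<lambda>i. X i \<omega>) - c\<bar>}
    \<le> (\<integral>\<omega>. \<bar>ustat h N (\<lambda>i. X i \<omega>) - c\<bar> \<partial>M)"
proof -
  have *: "ustat (\<lambda>a b. h a b - c) n x = ustat h n x - c" if "n \<in> {N..K}" for n x
    using that N by (intro ustat_centered) auto
  have "(\<exists>n\<in>{N..K}. \<epsilon> \<le> \<bar>ustat (\<lambda>a b. h a b - c) n x\<bar>) \<longleftrightarrow> (\<exists>n\<in>{N..K}. \<epsilon> \<le> \<bar>ustat h n x - c\<bar>)" for x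
    by (intro bex_cong refl) (simp only: *)
  then show ?thesis
    using ustat_maximal_centered[OF ustat_diff_integrable(1)[OF h, of c] N \<epsilon>] N
    by (simp add: ustat_centered)
qed

text \<open>
Convergence in mean for bounded kernels, from the second moment bound and the inequality between first
and second moments.
\<close>

lemma ustat_L1_bounded:
  assumes h: "(\<lambda>(a, b). h a b) \<in> borel_measurable (Q \<Otimes>\<^sub>M Q)" and B: "\<And>a b. \<bar>h a b\<bar> \<le> B"
  shows "(\<lambda>n. \<integral>\<omega>. \<bar>ustat h n (\<lambda>i. X i \<omega>) - (\<integral>(a, b). h a b \<partial>(Q \<Otimes>\<^sub>M Q))\<bar> \<partial>M) \<longlonglongrightarrow> 0"
proof -
  interpret Q: prob_space Q by (rule prob_space_Q)
  interpret QQ: pair_prob_space Q Q ..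
  define c where "c = (\<integral>(a, b). h a b \<partial>(Q \<Otimes>\<^sub>M Q))"
  define g where "g a b = h a b - c" for a b
  have B0: "0 \<le> B"
    using B[of undefined undefined] by simp
  have int_h: "integrable (Q \<Otimes>\<^sub>M Q) (\<lambda>(a, b). h a b)"
    using h B by (intro QQ.P.integrable_const_bound[where B = B]) auto
  have int_g: "integrable (Q \<Otimes>\<^sub>M Q) (\<lambda>(a, b). g a b)"
    unfolding g_def by (rule ustat_diff_integrable[OF int_h])
  have g0: "(\<integral>(a, b). g a b \<partial>(Q \<Otimes>\<^sub>M Q)) = 0"
    unfolding g_def using ustat_diff_integrable(2)[OF int_h] by (simp add: c_def)
  have "\<bar>c\<bar> \<le> (\<integral>(a, b). \<bar>h a b\<bar> \<partial>(Q \<Otimes>\<^sub>M Q))"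
    unfolding c_def using integral_abs_bound[of "Q \<Otimes>\<^sub>M Q" "\<lambda>(a, b). h a b"] by (simp add: case_prod_unfold)
  also have "\<dots> \<le> (\<integral>x. B \<partial>(Q \<Otimes>\<^sub>M Q))"
    using int_h B by (intro integral_mono) (auto simp: case_prod_unfold)
  also have "\<dots> = B"
    by (simp add: QQ.P.prob_space)
  finally have g_le: "\<bar>g a b\<bar> \<le> 2 * B" for a b
    unfolding g_def using B[of a b] by linarith
  have bound: "(\<integral>\<omega>. \<bar>ustat h n (\<lambda>i. X i \<omega>) - c\<bar> \<partial>M) \<le> 4 * B / sqrt (real n - 1)" if n: "2 \<le> n" for n
  proof -
    let ?U = "\<lambda>\<omega>. \<bar>ustat g n (\<lambda>i. X i \<omega>)\<bar>"
    have U_int: "integrable M ?U"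
      by (intro integrable_abs ustat_integrable int_g)
    have U_le: "?U \<omega> \<le> 2 * B" for \<omega>
    proof -
      have "g a b \<le> 2 * B" "- (2 * B) \<le> g a b" for a b
        using g_le[of a b] by linarith+
      then have "ustat g n (\<lambda>i. X i \<omega>) \<le> ustat (\<lambda>_ _. 2 * B) n (\<lambda>i. X i \<omega>)"
           "ustat (\<lambda>_ _. - (2 * B)) n (\<lambda>i. X i \<omega>) \<le> ustat g n (\<lambda>i. X i \<omega>)"
        by (intro ustat_mono; simp)+
      then show ?thesis
        by (simp add: ustat_const[OF n] abs_le_iff)
    qed
    have U2_int: "integrable M (\<lambda>\<omega>. (?U \<omega>)\<^sup>2)"
    proof (rule integrable_const_bound[where B = "(2 * B)\<^sup>2"])
      show "AE \<omega> in M. norm ((?U \<omega>)\<^sup>2) \<le> (2 * B)\<^sup>2"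
        using power_mono[OF U_le, where n = 2] by auto
      show "(\<lambda>\<omega>. (?U \<omega>)\<^sup>2) \<in> borel_measurable M"
        using borel_measurable_integrable[OF U_int] by measurable
    qed
    have "0 \<le> variance ?U"
      by (rule variance_positive)
    also have "variance ?U = (\<integral>\<omega>. (?U \<omega>)\<^sup>2 \<partial>M) - (\<integral>\<omega>. ?U \<omega> \<partial>M)\<^sup>2"
      by (rule variance_eq[OF U_int U2_int])
    finally have "(\<integral>\<omega>. ?U \<omega> \<partial>M)\<^sup>2 \<le> (\<integral>\<omega>. (ustat g n (\<lambda>i. X i \<omega>))\<^sup>2 \<partial>M)"
      by simp
    also have "\<dots> \<le> 4 * (2 * B)\<^sup>2 / (real n - 1)"
      by (rule ustat_second_moment_le[OF borel_measurable_integrable[OF int_g] g_le g0 n])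
    also have "\<dots> = (4 * B / sqrt (real n - 1))\<^sup>2"
      using n by (simp add: power_divide power_mult_distrib)
    finally have "(\<integral>\<omega>. ?U \<omega> \<partial>M) \<le> 4 * B / sqrt (real n - 1)"
      using B0 n by (rule_tac power2_le_imp_le) auto
    then show ?thesis
      unfolding g_def using n by (simp add: ustat_centered)
  qed
  have "(\<lambda>n. 4 * B / sqrt (real n - 1)) \<longlonglongrightarrow> 0"
    by real_asymp
  then have "(\<lambda>n. \<integral>\<omega>. \<bar>ustat h n (\<lambda>i. X i \<omega>) - c\<bar> \<partial>M) \<longlonglongrightarrow> 0"
    by (rule Lim_null_comparison[rotated])
      (use bound in \<open>auto intro!: eventually_mono[OF eventually_ge_at_top[of 2]]\<close>)
  then show ?thesis
    by (simp add: c_def)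
qed

text \<open>
Truncating the kernel reduces convergence in mean to bounded kernels, since \<open>E \<bar>U\<^sub>n(r)\<bar>\<close> is at most
\<open>E \<bar>r(X, X')\<bar>\<close> for the remainder \<open>r\<close>, uniformly in \<open>n\<close>.
\<close>

lemma ustat_L1_law:
  assumes h: "integrable (Q \<Otimes>\<^sub>M Q) (\<lambda>(a, b). h a b)"
  shows "(\<lambda>n. \<integral>\<omega>. \<bar>ustat h n (\<lambda>i. X i \<omega>) - (\<integral>(a, b). h a b \<partial>(Q \<Otimes>\<^sub>M Q))\<bar> \<partial>M) \<longlonglongrightarrow> 0"
proof -
  interpret Q: prob_space Q by (rule prob_space_Q)
  interpret QQ: pair_prob_space Q Q ..
  define c where "c = (\<integral>(a, b). h a b \<partial>(Q \<Otimes>\<^sub>M Q))"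
  define t where "t R a b = (if \<bar>h a b\<bar> \<le> real R then h a b else 0)" for R a b
  define r where "r R a b = h a b - t R a b" for R a b
  note [measurable] = borel_measurable_integrable[OF h]
  have t_meas [measurable]: "(\<lambda>(a, b). t R a b) \<in> borel_measurable (Q \<Otimes>\<^sub>M Q)" for R
    unfolding t_def case_prod_unfold using borel_measurable_integrable[OF h]
    by (simp add: case_prod_unfold)
  have t_int: "integrable (Q \<Otimes>\<^sub>M Q) (\<lambda>(a, b). t R a b)" for R
    by (rule QQ.P.integrable_const_bound[where B = R]) (auto simp: t_def)
  have r_int: "integrable (Q \<Otimes>\<^sub>M Q) (\<lambda>(a, b). r R a b)" for R
    unfolding r_def using h t_int by (simp add: case_prod_unfold)
  have r_lim: "(\<lambda>R. \<integral>(a, b). \<bar>r R a b\<bar> \<partial>(Q \<Otimes>\<^sub>M Q)) \<longlonglongrightarrow> (\<integral>x. 0 \<partial>(Q \<Otimes>\<^sub>M Q))"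
  proof (rule integral_dominated_convergence[where w = "\<lambda>(a, b). \<bar>h a b\<bar>"])
    show "integrable (Q \<Otimes>\<^sub>M Q) (\<lambda>(a, b). \<bar>h a b\<bar>)"
      using integrable_abs[OF h] by (simp add: case_prod_unfold)
    show "AE x in Q \<Otimes>\<^sub>M Q. (\<lambda>R. case x of (a, b) \<Rightarrow> \<bar>r R a b\<bar>) \<longlonglongrightarrow> 0"
    proof (rule AE_I2)
      fix x :: "'a \<times> 'a"
      obtain a b where x: "x = (a, b)" by (cases x)
      obtain R0 :: nat where R0: "\<bar>h a b\<bar> \<le> real R0"
        using real_arch_simple by blast
      have "\<forall>\<^sub>F R in sequentially. \<bar>r R a b\<bar> = 0"
        using eventually_ge_at_top[of R0]
        by eventually_elim (use R0 in \<open>auto simp: r_def t_def\<close>)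
      then show "(\<lambda>R. case x of (a, b) \<Rightarrow> \<bar>r R a b\<bar>) \<longlonglongrightarrow> 0"
        unfolding x by (simp add: tendsto_eventually)
    qed
    show "AE x in Q \<Otimes>\<^sub>M Q. norm (case x of (a, b) \<Rightarrow> \<bar>r R a b\<bar>) \<le> (case x of (a, b) \<Rightarrow> \<bar>h a b\<bar>)" for R
      by (auto simp: r_def t_def)
    show "(\<lambda>(a, b). \<bar>r R a b\<bar>) \<in> borel_measurable (Q \<Otimes>\<^sub>M Q)" for R
      using borel_measurable_integrable[OF r_int[of R]] by (simp add: case_prod_unfold)
  qed simp
  show ?thesis
    unfolding c_def[symmetric]
  proof (rule LIMSEQ_I)
    fix \<epsilon> :: real assume \<epsilon>: "0 < \<epsilon>"
    then have "\<forall>\<^sub>F R in sequentially. (\<integral>(a, b). \<bar>r R a b\<bar> \<partial>(Q \<Otimes>\<^sub>M Q)) < \<epsilon> / 3"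
      by (intro order_tendstoD(2)[OF r_lim]) simp
    then obtain R where R: "(\<integral>(a, b). \<bar>r R a b\<bar> \<partial>(Q \<Otimes>\<^sub>M Q)) < \<epsilon> / 3"
      using eventually_happens'[OF sequentially_bot] by blast
    define c' where "c' = (\<integral>(a, b). t R a b \<partial>(Q \<Otimes>\<^sub>M Q))"
    have "c - c' = (\<integral>(a, b). r R a b \<partial>(Q \<Otimes>\<^sub>M Q))"
      unfolding c_def c'_def r_def using h t_int[of R] by (simp add: case_prod_unfold)
    then have c: "\<bar>c' - c\<bar> \<le> (\<integral>(a, b). \<bar>r R a b\<bar> \<partial>(Q \<Otimes>\<^sub>M Q))"
      using integral_abs_bound[of "Q \<Otimes>\<^sub>M Q" "\<lambda>(a, b). r R a b"]
      by (simp add: case_prod_unfold abs_minus_commute[of c'])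
    have "(\<lambda>n. \<integral>\<omega>. \<bar>ustat (t R) n (\<lambda>i. X i \<omega>) - c'\<bar> \<partial>M) \<longlonglongrightarrow> 0"
      unfolding c'_def by (rule ustat_L1_bounded[where B = R]) (auto simp: t_def[abs_def] intro: t_meas[unfolded t_def])
    from LIMSEQ_D[OF this, of "\<epsilon> / 3"] \<epsilon> obtain n0
      where n0: "\<And>n. n \<ge> n0 \<Longrightarrow> \<bar>\<integral>\<omega>. \<bar>ustat (t R) n (\<lambda>i. X i \<omega>) - c'\<bar> \<partial>M\<bar> < \<epsilon> / 3"
      by auto
    have "(\<integral>\<omega>. \<bar>ustat h n (\<lambda>i. X i \<omega>) - c\<bar> \<partial>M) < \<epsilon>" if n: "n \<ge> max n0 2" for n
    proof -
      have "(\<integral>\<omega>. \<bar>ustat h n (\<lambda>i. X i \<omega>) - c\<bar> \<partial>M)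
        \<le> (\<integral>\<omega>. (\<bar>ustat (r R) n (\<lambda>i. X i \<omega>)\<bar> + \<bar>ustat (t R) n (\<lambda>i. X i \<omega>) - c'\<bar>) + \<bar>c' - c\<bar> \<partial>M)"
      proof (rule integral_mono)
        fix \<omega>
        have "ustat (r R) n (\<lambda>i. X i \<omega>) = ustat h n (\<lambda>i. X i \<omega>) - ustat (t R) n (\<lambda>i. X i \<omega>)"
          unfolding r_def by (rule ustat_diff[symmetric])
        then show "\<bar>ustat h n (\<lambda>i. X i \<omega>) - c\<bar>
          \<le> (\<bar>ustat (r R) n (\<lambda>i. X i \<omega>)\<bar> + \<bar>ustat (t R) n (\<lambda>i. X i \<omega>) - c'\<bar>) + \<bar>c' - c\<bar>"
          by linarith
      qed (auto intro!: integrable_abs ustat_integrable h r_int t_int Bochner_Integration.integrable_diff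
            Bochner_Integration.integrable_add)
      also have "\<dots> = (\<integral>\<omega>. \<bar>ustat (r R) n (\<lambda>i. X i \<omega>)\<bar> \<partial>M)
          + (\<integral>\<omega>. \<bar>ustat (t R) n (\<lambda>i. X i \<omega>) - c'\<bar> \<partial>M) + \<bar>c' - c\<bar>"
        using ustat_integrable[OF r_int, of R n] ustat_integrable[OF t_int, of R n]
        by (simp add: prob_space)
      also have "\<dots> < \<epsilon> / 3 + \<epsilon> / 3 + \<epsilon> / 3"
        using ustat_abs_integral_le[OF r_int, of n R] R c n0[of n] n by linarith
      finally show ?thesis by simp
    qed
    then show "\<exists>no. \<forall>n\<ge>no. norm ((\<integral>\<omega>. \<bar>ustat h n (\<lambda>i. X i \<omega>) - c\<bar> \<partial>M) - 0) < \<epsilon>"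
      by (intro exI[of _ "max n0 2"]) auto
  qed
qed

text \<open>
Letting \<open>K\<close> and then \<open>N\<close> tend to infinity in the maximal inequality, the probability of exceeding
\<open>\<epsilon>\<close> infinitely often is bounded by \<open>E \<bar>U\<^sub>N - c\<bar> / \<epsilon>\<close>, which tends to zero by convergence in mean.
\<close>

theorem ustat_strong_law:
  assumes h: "integrable (Q \<Otimes>\<^sub>M Q) (\<lambda>(a, b). h a b)"
  shows "AE \<omega> in M. (\<lambda>n. ustat h n (\<lambda>i. X i \<omega>)) \<longlonglongrightarrow> (\<integral>(a, b). h a b \<partial>(Q \<Otimes>\<^sub>M Q))"
proof -
  define c where "c = (\<integral>(a, b). h a b \<partial>(Q \<Otimes>\<^sub>M Q))"
  define D where "D n \<omega> = \<bar>ustat h n (\<lambda>i. X i \<omega>) - c\<bar>" for n \<omega>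
  have D_meas [measurable]: "D n \<in> borel_measurable M" for n
    unfolding D_def using borel_measurable_integrable[OF ustat_integrable[OF h]] by measurable
  have D_lim: "(\<lambda>n. \<integral>\<omega>. D n \<omega> \<partial>M) \<longlonglongrightarrow> 0"
    unfolding D_def c_def by (rule ustat_L1_law[OF h])
  have tail: "AE \<omega> in M. \<exists>N. \<forall>n\<ge>N. D n \<omega> < \<epsilon>" if \<epsilon>: "0 < \<epsilon>" for \<epsilon>
  proof -
    define A where "A N K = {\<omega>\<in>space M. \<exists>n\<in>{N..K}. \<epsilon> \<le> D n \<omega>}" for N K
    define T where "T N = {\<omega>\<in>space M. \<exists>n\<ge>N. \<epsilon> \<le> D n \<omega>}" for N
    have [measurable]: "A N K \<in> sets M" "T N \<in> sets M" for N K
      unfolding A_def T_def by measurable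
    have T_le: "prob (T N) \<le> (\<integral>\<omega>. D N \<omega> \<partial>M) / \<epsilon>" if N: "2 \<le> N" for N
    proof (rule LIMSEQ_le_const2)
      have "T N = (\<Union>K. A N K)"
        unfolding A_def T_def by auto (meson atLeastAtMost_iff order_refl)
      moreover have "incseq (A N)"
        unfolding A_def incseq_def by fastforce
      ultimately show "(\<lambda>K. prob (A N K)) \<longlonglongrightarrow> prob (T N)"
        using finite_Lim_measure_incseq[of "A N"] by (auto simp: image_subset_iff)
      have "prob (A N K) \<le> (\<integral>\<omega>. D N \<omega> \<partial>M) / \<epsilon>" if "K \<ge> N" for K
        using ustat_maximal[OF h N that \<epsilon>, of c] \<epsilon>
        by (simp add: A_def D_def field_simps)
      then show "\<exists>K0. \<forall>K\<ge>K0. prob (A N K) \<le> (\<integral>\<omega>. D N \<omega> \<partial>M) / \<epsilon>"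
        by blast
    qed
    have "prob (\<Inter>N. T N) \<le> 0"
    proof (rule LIMSEQ_le_const)
      show "(\<lambda>N. (\<integral>\<omega>. D N \<omega> \<partial>M) / \<epsilon>) \<longlonglongrightarrow> 0"
        using tendsto_divide[OF D_lim tendsto_const[of \<epsilon>]] \<epsilon> by simp
      have "prob (\<Inter>N. T N) \<le> (\<integral>\<omega>. D N \<omega> \<partial>M) / \<epsilon>" if "N \<ge> 2" for N
        using T_le[OF that] by (rule order_trans[rotated]) (intro finite_measure_mono, auto)
      then show "\<exists>N. \<forall>n\<ge>N. prob (\<Inter>N. T N) \<le> (\<integral>\<omega>. D n \<omega> \<partial>M) / \<epsilon>"
        by blast
    qed
    then have "emeasure M (\<Inter>N. T N) = 0"
      by (simp add: emeasure_eq_measure measure_le_0_iff)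
    then show ?thesis
      by (intro AE_I[of _ _ "\<Inter>N. T N"]) (auto simp: T_def not_less)
  qed
  have "AE \<omega> in M. \<forall>j::nat. \<exists>N. \<forall>n\<ge>N. D n \<omega> < 1 / real (Suc j)"
    unfolding AE_all_countable by (intro allI tail) simp
  then show ?thesis
    unfolding c_def[symmetric]
  proof eventually_elim
    case (elim \<omega>)
    show ?case
    proof (rule LIMSEQ_I)
      fix \<epsilon> :: real assume "0 < \<epsilon>"
      then obtain j where j: "1 / real (Suc j) < \<epsilon>"
        using nat_approx_posE by blast
      from elim obtain N where "\<And>n. n \<ge> N \<Longrightarrow> D n \<omega> < 1 / real (Suc j)"
        by blast
      with j show "\<exists>N. \<forall>n\<ge>N. norm (ustat h n (\<lambda>i. X i \<omega>) - c) < \<epsilon>"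
        unfolding D_def by (intro exI[of _ N]) force
    qed
  qed
qed

end

section \<open>Consequences of the strong law for families of kernels and for positive definite kernels\<close>

context iid_sample
begin

text \<open>
Wald's argument for lower bounds that are uniform over a compact parameter set. For a small ball around
\<open>\<theta>\<close> the infimum \<open>m\<close> of the kernels over the ball has positive mean by dominated convergence, and \<open>U\<^sub>n(m)\<close>
bounds \<open>U\<^sub>n(h\<^sub>\<eta>)\<close> from below for all \<open>\<eta>\<close> in the ball at once. Infima are taken over a countable dense set
to keep them measurable; continuity in the parameter makes them lower bounds on the whole ball.
\<close>

theorem ustat_uniformly_positive:
  fixes h :: "'t::{metric_space, second_countable_topology} \<Rightarrow> 'a \<Rightarrow> 'a \<Rightarrow> real"
  assumes compact: "compact \<Theta>"
    and meas: "\<And>\<theta>. \<theta> \<in> \<Theta> \<Longrightarrow> (\<lambda>(a, b). h \<theta> a b) \<in> borel_measurable (Q \<Otimes>\<^sub>M Q)"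
    and cont: "\<And>a b. continuous_on \<Theta> (\<lambda>\<theta>. h \<theta> a b)"
    and dom: "\<And>\<theta> a b. \<theta> \<in> \<Theta> \<Longrightarrow> \<bar>h \<theta> a b\<bar> \<le> H a b"
    and H: "integrable (Q \<Otimes>\<^sub>M Q) (\<lambda>(a, b). H a b)"
    and pos: "\<And>\<theta>. \<theta> \<in> \<Theta> \<Longrightarrow> 0 < (\<integral>(a, b). h \<theta> a b \<partial>(Q \<Otimes>\<^sub>M Q))"
  shows "AE \<omega> in M. \<exists>c>0. \<forall>\<^sub>F n in sequentially. \<forall>\<theta>\<in>\<Theta>. c \<le> ustat (h \<theta>) n (\<lambda>i. X i \<omega>)"
proof -
  obtain D where D: "countable D" "D \<subseteq> \<Theta>" "\<Theta> \<subseteq> closure D"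
    using separable[of \<Theta>] by blast
  define m where "m U a b = (INF \<theta>\<in>D \<inter> U. h \<theta> a b)" for U a b
  have bdd: "bdd_below ((\<lambda>\<theta>. h \<theta> a b) ` (D \<inter> U))" for a b U
  proof (rule bdd_belowI2[of _ "- H a b"])
    fix \<theta> assume "\<theta> \<in> D \<inter> U"
    then have "\<bar>h \<theta> a b\<bar> \<le> H a b"
      using D(2) by (intro dom) auto
    then show "- H a b \<le> h \<theta> a b" by linarith
  qed
  have nonempty: "D \<inter> U \<noteq> {}" if "open U" "\<theta> \<in> \<Theta> \<inter> U" for \<theta> U
    using that D(3) open_Int_closure_eq_empty[of U D] by (auto simp: Int_commute)
  have m_le: "m U a b \<le> h \<theta> a b" if U: "open U" and \<theta>: "\<theta> \<in> \<Theta> \<inter> U" for U \<theta> a b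
  proof -
    have "\<theta> \<in> closure (D \<inter> U)"
      using open_Int_closure_subset[OF U, of D] \<theta> D(3) by (auto simp: Int_commute)
    then obtain s where s: "\<And>n. s n \<in> D \<inter> U" "s \<longlonglongrightarrow> \<theta>"
      unfolding closure_sequential by blast
    have "(\<lambda>n. h (s n) a b) \<longlonglongrightarrow> h \<theta> a b"
      using \<theta> s D(2) by (intro continuous_on_tendsto_compose[OF cont]) (auto intro!: always_eventually)
    moreover have "m U a b \<le> h (s n) a b" for n
      unfolding m_def using s(1) by (intro cINF_lower bdd)
    ultimately show ?thesis
      by (intro LIMSEQ_le_const) auto
  qed
  have m_ge: "l \<le> m U a b" if "open U" "\<theta> \<in> \<Theta> \<inter> U" "\<And>\<eta>. \<eta> \<in> \<Theta> \<inter> U \<Longrightarrow> l \<le> h \<eta> a b" for l U \<theta> a b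
    unfolding m_def using nonempty[OF that(1,2)] that(3) D(2) by (intro cINF_greatest) auto
  have m_abs: "\<bar>m U a b\<bar> \<le> H a b" if U: "open U" "\<theta> \<in> \<Theta> \<inter> U" for U \<theta> a b
  proof -
    have "- H a b \<le> h \<eta> a b" "h \<eta> a b \<le> H a b" if "\<eta> \<in> \<Theta>" for \<eta>
      using dom[OF that, of a b] by linarith+
    then show ?thesis
      using m_le[OF U, of a b] m_ge[OF U, of "- H a b" a b] U(2) by (force simp: abs_le_iff)
  qed
  have m_meas: "(\<lambda>(a, b). m U a b) \<in> borel_measurable (Q \<Otimes>\<^sub>M Q)" for U
  proof -
    have "(\<lambda>x. INF \<theta>\<in>D \<inter> U. (case x of (a, b) \<Rightarrow> h \<theta> a b)) \<in> borel_measurable (Q \<Otimes>\<^sub>M Q)"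
      using D bdd by (intro borel_measurable_cINF meas) (auto simp: case_prod_unfold)
    then show ?thesis
      by (simp add: m_def case_prod_unfold)
  qed
  have m_int: "integrable (Q \<Otimes>\<^sub>M Q) (\<lambda>(a, b). m U a b)" if "open U" "\<theta> \<in> \<Theta> \<inter> U" for U \<theta>
    by (rule Bochner_Integration.integrable_bound[OF H m_meas]) (use m_abs[OF that] in \<open>auto simp: case_prod_unfold intro!: AE_I2 order_trans[OF _ abs_ge_self]\<close>)
  have "\<exists>r>0. 0 < (\<integral>(a, b). m (ball \<theta> r) a b \<partial>(Q \<Otimes>\<^sub>M Q))" if \<theta>: "\<theta> \<in> \<Theta>" for \<theta>
  proof -
    let ?U = "\<lambda>j. ball \<theta> (1 / real (Suc j))"
    have U: "open (?U j)" "\<theta> \<in> \<Theta> \<inter> ?U j" for j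
      using \<theta> by auto
    have "(\<lambda>j. \<integral>(a, b). m (?U j) a b \<partial>(Q \<Otimes>\<^sub>M Q)) \<longlonglongrightarrow> (\<integral>(a, b). h \<theta> a b \<partial>(Q \<Otimes>\<^sub>M Q))"
    proof (rule integral_dominated_convergence[OF _ _ H])
      show "AE x in Q \<Otimes>\<^sub>M Q. (\<lambda>j. case x of (a, b) \<Rightarrow> m (?U j) a b) \<longlonglongrightarrow> (case x of (a, b) \<Rightarrow> h \<theta> a b)"
      proof (rule AE_I2, clarify)
        fix a b
        show "(\<lambda>j. m (?U j) a b) \<longlonglongrightarrow> h \<theta> a b"
        proof (rule LIMSEQ_I)
          fix \<epsilon> :: real assume \<epsilon>: "0 < \<epsilon>"
          then obtain \<delta> where \<delta>: "0 < \<delta>" "\<And>\<eta>. \<eta> \<in> \<Theta> \<Longrightarrow> dist \<eta> \<theta> < \<delta> \<Longrightarrow> dist (h \<eta> a b) (h \<theta> a b) < \<epsilon> / 2"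
            using cont[of a b] \<theta> unfolding continuous_on_iff by (meson half_gt_zero)
          obtain j0 where j0: "1 / real (Suc j0) < \<delta>"
            using nat_approx_posE[OF \<delta>(1)] by blast
          have "norm (m (?U j) a b - h \<theta> a b) < \<epsilon>" if "j \<ge> j0" for j
          proof -
            have "1 / real (Suc j) \<le> 1 / real (Suc j0)"
              using that by (intro divide_left_mono) auto
            then have near: "dist (h \<eta> a b) (h \<theta> a b) < \<epsilon> / 2" if "\<eta> \<in> \<Theta> \<inter> ?U j" for \<eta>
              using that j0 by (intro \<delta>(2)) (auto simp: dist_commute)
            have "h \<theta> a b - \<epsilon> / 2 \<le> h \<eta> a b" if "\<eta> \<in> \<Theta> \<inter> ?U j" for \<eta>
              using near[OF that] unfolding dist_real_def by linarith
            then have "h \<theta> a b - \<epsilon> / 2 \<le> m (?U j) a b"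
              by (rule m_ge[OF U])
            with m_le[OF U, of j a b] \<epsilon> show ?thesis
              unfolding real_norm_def by linarith
          qed
          then show "\<exists>j0. \<forall>j\<ge>j0. norm (m (?U j) a b - h \<theta> a b) < \<epsilon>"
            by blast
        qed
      qed
      show "AE x in Q \<Otimes>\<^sub>M Q. norm (case x of (a, b) \<Rightarrow> m (?U j) a b) \<le> (case x of (a, b) \<Rightarrow> H a b)" for j
        using m_abs[OF U] by auto
    qed (use meas[OF \<theta>] m_meas in auto)
    from order_tendstoD(1)[OF this pos[OF \<theta>]]
    obtain j where "0 < (\<integral>(a, b). m (?U j) a b \<partial>(Q \<Otimes>\<^sub>M Q))"
      using eventually_happens'[OF sequentially_bot] by blast
    then show ?thesis
      by (intro exI[of _ "1 / real (Suc j)"]) simp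
  qed
  then obtain r where r: "\<And>\<theta>. \<theta> \<in> \<Theta> \<Longrightarrow> 0 < r \<theta>"
      "\<And>\<theta>. \<theta> \<in> \<Theta> \<Longrightarrow> 0 < (\<integral>(a, b). m (ball \<theta> (r \<theta>)) a b \<partial>(Q \<Otimes>\<^sub>M Q))"
    by metis
  have "\<Theta> \<subseteq> (\<Union>\<theta>\<in>\<Theta>. ball \<theta> (r \<theta>))"
    using r(1) by (auto intro!: bexI)
  then obtain C where C: "C \<subseteq> \<Theta>" "finite C" "\<Theta> \<subseteq> (\<Union>\<theta>\<in>C. ball \<theta> (r \<theta>))"
    by (rule compactE_image[OF compact open_ball])
  define e where "e \<theta> = (\<integral>(a, b). m (ball \<theta> (r \<theta>)) a b \<partial>(Q \<Otimes>\<^sub>M Q))" for \<theta>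
  have e_pos: "0 < e \<theta>" if "\<theta> \<in> C" for \<theta>
    using r(2) that C(1) by (auto simp: e_def)
  \<comment> \<open>The element 1 covers the case of an empty parameter set.\<close>
  define c where "c = Min (insert 1 ((\<lambda>\<theta>. e \<theta> / 2) ` C))"
  have c_pos: "0 < c"
    unfolding c_def using C(2) e_pos by (subst Min_gr_iff) auto
  have c_less: "c < e \<theta>" if "\<theta> \<in> C" for \<theta>
  proof -
    have "c \<le> e \<theta> / 2"
      unfolding c_def using C(2) that by (intro Min_le) auto
    with e_pos[OF that] show ?thesis by simp
  qed
  have "AE \<omega> in M. \<forall>\<theta>\<in>C. (\<lambda>n. ustat (m (ball \<theta> (r \<theta>))) n (\<lambda>i. X i \<omega>)) \<longlonglongrightarrow> e \<theta>"
    unfolding e_def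
  proof (intro AE_finite_allI[OF C(2)] ustat_strong_law)
    fix \<theta> assume "\<theta> \<in> C"
    then show "integrable (Q \<Otimes>\<^sub>M Q) (\<lambda>(a, b). m (ball \<theta> (r \<theta>)) a b)"
      using C(1) r(1) by (intro m_int[of _ \<theta>]) auto
  qed
  then show ?thesis
  proof eventually_elim
    case (elim \<omega>)
    have "\<forall>\<^sub>F n in sequentially. \<forall>\<theta>\<in>C. c < ustat (m (ball \<theta> (r \<theta>))) n (\<lambda>i. X i \<omega>)"
      using elim c_less by (intro eventually_ball_finite[OF C(2)]) (auto intro: order_tendstoD(1))
    then have "\<forall>\<^sub>F n in sequentially. \<forall>\<theta>\<in>\<Theta>. c \<le> ustat (h \<theta>) n (\<lambda>i. X i \<omega>)"
    proof eventually_elim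
      case (elim n)
      show ?case
      proof
        fix \<theta> assume \<theta>: "\<theta> \<in> \<Theta>"
        then obtain \<eta> where \<eta>: "\<eta> \<in> C" "\<theta> \<in> ball \<eta> (r \<eta>)"
          using C(3) by blast
        have "c \<le> ustat (m (ball \<eta> (r \<eta>))) n (\<lambda>i. X i \<omega>)"
          using elim \<eta>(1) by (simp add: less_imp_le)
        also have "\<dots> \<le> ustat (h \<theta>) n (\<lambda>i. X i \<omega>)"
          using \<theta> \<eta>(2) by (intro ustat_mono m_le) auto
        finally show "c \<le> ustat (h \<theta>) n (\<lambda>i. X i \<omega>)" .
      qed
    qed
    with c_pos show ?case by blast
  qed
qed

text \<open>
The product law is the law of \<open>(X\<^sub>1, X\<^sub>2)\<close>, so functions of one coordinate can be integrated along the
sample.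
\<close>

lemma integrable_fst_snd:
  fixes a :: "'a \<Rightarrow> real"
  assumes a: "integrable Q a"
  shows "integrable (Q \<Otimes>\<^sub>M Q) (\<lambda>(x, y). a x)" "integrable (Q \<Otimes>\<^sub>M Q) (\<lambda>(x, y). a y)"
    "(\<integral>(x, y). a x \<partial>(Q \<Otimes>\<^sub>M Q)) = (\<integral>x. a x \<partial>Q)" "(\<integral>(x, y). a y \<partial>(Q \<Otimes>\<^sub>M Q)) = (\<integral>x. a x \<partial>Q)"
proof -
  note [measurable] = borel_measurable_integrable[OF a]
  have X12: "X 1 \<in> M \<rightarrow>\<^sub>M Q" "X 2 \<in> M \<rightarrow>\<^sub>M Q" "(\<lambda>\<omega>. (X 1 \<omega>, X 2 \<omega>)) \<in> M \<rightarrow>\<^sub>M Q \<Otimes>\<^sub>M Q"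
    by (auto intro: X_measurable pair_measurable)
  have i: "integrable M (\<lambda>\<omega>. a (X 1 \<omega>))" "integrable M (\<lambda>\<omega>. a (X 2 \<omega>))"
    using a X12(1,2) distr_X[of 1] distr_X[of 2]
    by (auto simp: integrable_distr_eq[of _ M Q, symmetric])
  have e: "(\<integral>\<omega>. a (X i \<omega>) \<partial>M) = (\<integral>x. a x \<partial>Q)" if "i \<ge> 1" for i
    using integral_distr[OF X_measurable[OF that], of a] distr_X[OF that] by simp
  have law: "distr M (Q \<Otimes>\<^sub>M Q) (\<lambda>\<omega>. (X 1 \<omega>, X 2 \<omega>)) = Q \<Otimes>\<^sub>M Q"
    by (intro pair_law) auto
  show "integrable (Q \<Otimes>\<^sub>M Q) (\<lambda>(x, y). a x)"
    using i(1) by (subst law[symmetric], subst integrable_distr_eq[OF X12(3)]) auto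
  show "integrable (Q \<Otimes>\<^sub>M Q) (\<lambda>(x, y). a y)"
    using i(2) by (subst law[symmetric], subst integrable_distr_eq[OF X12(3)]) auto
  show "(\<integral>(x, y). a x \<partial>(Q \<Otimes>\<^sub>M Q)) = (\<integral>x. a x \<partial>Q)"
    using pair_integral[of "\<lambda>x y. a x" 1 2] e[of 1] by simp
  show "(\<integral>(x, y). a y \<partial>(Q \<Otimes>\<^sub>M Q)) = (\<integral>x. a x \<partial>Q)"
    using pair_integral[of "\<lambda>x y. a y" 1 2] e[of 2] by simp
qed

lemma integrable_product:
  fixes a :: "'a \<Rightarrow> real"
  assumes a: "integrable Q a"
  shows "integrable (Q \<Otimes>\<^sub>M Q) (\<lambda>(x, y). a x * a y)"
proof -
  have [measurable]: "a \<in> borel_measurable Q"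
    using a by simp
  have i: "integrable M (\<lambda>\<omega>. a (X i \<omega>))" if "i \<ge> 1" for i
    using a X_measurable[OF that] distr_X[OF that]
    by (simp add: integrable_distr_eq[of _ M Q, symmetric])
  have "indep_var borel (\<lambda>\<omega>. (\<lambda>x. a (x 1)) (\<lambda>i\<in>{1}. X i \<omega>)) borel (\<lambda>\<omega>. (\<lambda>x. a (x 2)) (\<lambda>i\<in>{2}. X i \<omega>))"
    by (rule pair_indep) auto
  then have "indep_var borel (\<lambda>\<omega>. a (X 1 \<omega>)) borel (\<lambda>\<omega>. a (X 2 \<omega>))"
    by simp
  then have "integrable M (\<lambda>\<omega>. a (X 1 \<omega>) * a (X 2 \<omega>))"
    by (rule indep_var_integrable) (auto intro: i)
  then show ?thesis
    using pair_measurable[of 1 2]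
    by (subst pair_law[of 1 2, symmetric]) (auto simp: integrable_distr_eq case_prod_unfold)
qed

lemma AE_sample:
  assumes "AE x in Q. P x"
  shows "AE \<omega> in M. \<forall>i\<ge>1. P (X i \<omega>)"
proof -
  have "AE \<omega> in M. P (X i \<omega>)" if "i \<ge> 1" for i
  proof (rule AE_distrD[OF X_measurable[OF that]])
    show "AE x in distr M Q (X i). P x"
      unfolding distr_X[OF that] by (rule assms)
  qed
  then have "AE \<omega> in M. \<forall>i. i \<ge> 1 \<longrightarrow> P (X i \<omega>)"
    unfolding AE_all_countable by (intro allI) (auto intro: AE_I2)
  then show ?thesis .
qed

lemma AE_product:
  assumes S: "S \<in> sets Q" "AE x in Q. x \<in> S"
  shows "AE z in Q \<Otimes>\<^sub>M Q. z \<in> S \<times> S"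
proof -
  interpret Q: prob_space Q by (rule prob_space_Q)
  interpret QQ: pair_prob_space Q Q ..
  have "{z \<in> space (Q \<Otimes>\<^sub>M Q). z \<in> S \<times> S} = S \<times> S"
    using sets.sets_into_space[OF S(1)] by (auto simp: space_pair_measure)
  moreover have "AE x in Q. AE y in Q. (x, y) \<in> S \<times> S"
    using S(2) by eventually_elim (use S(2) in simp)
  ultimately show ?thesis
    using S(1) by (intro QQ.AE_pair_measure) auto
qed

text \<open>
Only off the diagonal is \<open>G\<close> known to be integrable, so the diagonal is truncated. Restricted to the set
where it is at most \<open>R\<close>, the full double sum over the sample is nonnegative and differs from
\<open>n (n - 1) U\<^sub>n\<close> by at most \<open>n R\<close>, so the limit of \<open>U\<^sub>n\<close> is nonnegative; then \<open>R\<close> tends to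
infinity.
\<close>

lemma pos_def_integral_nonneg:
  fixes G :: "'a \<Rightarrow> 'a \<Rightarrow> real"
  assumes G: "integrable (Q \<Otimes>\<^sub>M Q) (\<lambda>(a, b). G a b)"
    and S: "S \<in> sets Q" "AE x in Q. x \<in> S"
    and pd: "\<And>(I :: nat set) z. finite I \<Longrightarrow> (\<And>i. i \<in> I \<Longrightarrow> z i \<in> S) \<Longrightarrow> 0 \<le> (\<Sum>i\<in>I. \<Sum>j\<in>I. G (z i) (z j))"
  shows "0 \<le> (\<integral>(a, b). G a b \<partial>(Q \<Otimes>\<^sub>M Q))"
proof -
  note G_meas [measurable] = borel_measurable_integrable[OF G]
  have diag [measurable]: "(\<lambda>x. G x x) \<in> borel_measurable Q"
    using measurable_compose[OF measurable_Pair[OF measurable_ident measurable_ident] G_meas] by simp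
  define A where "A R = {x\<in>S. G x x \<le> real R}" for R
  have A_meas: "A R \<in> sets Q" for R
  proof -
    have "A R = S \<inter> {x\<in>space Q. G x x \<le> real R}"
      using sets.sets_into_space[OF S(1)] by (auto simp: A_def)
    also have "\<dots> \<in> sets Q"
      using S(1) by measurable
    finally show ?thesis .
  qed
  define g where "g R a b = indicator (A R \<times> A R) (a, b) * G a b" for R a b
  have g_int: "integrable (Q \<Otimes>\<^sub>M Q) (\<lambda>(a, b). g R a b)" for R
    using integrable_mult_indicator[OF pair_measureI[OF A_meas A_meas] G, of R R]
    by (simp add: g_def case_prod_unfold)
  have g_nonneg: "0 \<le> (\<integral>(a, b). g R a b \<partial>(Q \<Otimes>\<^sub>M Q))" for R
  proof -
    have lower: "- (real R / (real n - 1)) \<le> ustat (g R) n x" if n: "2 \<le> n" for n and x :: "nat \<Rightarrow> 'a"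
    proof -
      let ?I = "{i\<in>{1..n}. x i \<in> A R}"
      have "0 \<le> (\<Sum>i\<in>?I. \<Sum>j\<in>?I. G (x i) (x j))"
        by (rule pd) (auto simp: A_def)
      also have "\<dots> = (\<Sum>i\<in>{1..n}. \<Sum>j\<in>{1..n}. g R (x i) (x j))"
        unfolding g_def by (rule sum.mono_neutral_cong_left; auto intro!: sum.mono_neutral_cong_left)
      also have "\<dots> = (\<Sum>i\<in>{1..n}. \<Sum>j\<in>{1..n} - {i}. g R (x i) (x j)) + (\<Sum>i\<in>{1..n}. g R (x i) (x i))"
        by (subst sum.distrib[symmetric], rule sum.cong[OF refl], subst sum.remove) auto
      also have "(\<Sum>i\<in>{1..n}. g R (x i) (x i)) \<le> (\<Sum>i\<in>{1..n}. real R)"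
        by (intro sum_mono) (auto simp: g_def A_def indicator_def)
      finally have "- (real n * real R) \<le> (\<Sum>i\<in>{1..n}. \<Sum>j\<in>{1..n} - {i}. g R (x i) (x j))"
        by simp
      then have "1 / (real n * (real n - 1)) * (- (real n * real R)) \<le> ustat (g R) n x"
        unfolding ustat_def using n by (intro mult_left_mono) auto
      then show ?thesis
        using n by simp
    qed
    \<comment> \<open>One sample point at which the strong law holds is enough.\<close>
    obtain \<omega> where \<omega>: "(\<lambda>n. ustat (g R) n (\<lambda>i. X i \<omega>)) \<longlonglongrightarrow> (\<integral>(a, b). g R a b \<partial>(Q \<Otimes>\<^sub>M Q))"
      using eventually_happens'[OF ae_filter_bot ustat_strong_law[OF g_int]] by blast
    have "(\<lambda>n. - (real R / (real n - 1))) \<longlonglongrightarrow> 0"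
      by real_asymp
    then show ?thesis
      using \<omega> by (rule LIMSEQ_le) (use lower in blast)
  qed
  have "(\<lambda>R. \<integral>(a, b). g R a b \<partial>(Q \<Otimes>\<^sub>M Q)) \<longlonglongrightarrow> (\<integral>(a, b). G a b \<partial>(Q \<Otimes>\<^sub>M Q))"
  proof (rule integral_dominated_convergence[where w = "\<lambda>(a, b). \<bar>G a b\<bar>"])
    show "integrable (Q \<Otimes>\<^sub>M Q) (\<lambda>(a, b). \<bar>G a b\<bar>)"
      using integrable_abs[OF G] by (simp add: case_prod_unfold)
    show "AE z in Q \<Otimes>\<^sub>M Q. (\<lambda>R. case z of (a, b) \<Rightarrow> g R a b) \<longlonglongrightarrow> (case z of (a, b) \<Rightarrow> G a b)"
      using AE_product[OF S]
    proof eventually_elim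
      case (elim z)
      obtain a b where z: "z = (a, b)" by (cases z)
      obtain N :: nat where "max (G a a) (G b b) \<le> real N"
        using real_arch_simple by blast
      then have "g R a b = G a b" if "R \<ge> N" for R
        using elim that by (auto simp: g_def A_def z)
      then have "\<forall>\<^sub>F R in sequentially. g R a b = G a b"
        by (auto simp: eventually_sequentially)
      then show ?case
        by (simp add: z tendsto_eventually)
    qed
    show "AE z in Q \<Otimes>\<^sub>M Q. norm (case z of (a, b) \<Rightarrow> g R a b) \<le> (case z of (a, b) \<Rightarrow> \<bar>G a b\<bar>)" for R
      by (auto simp: g_def indicator_def)
  qed (use g_int in \<open>auto intro: borel_measurable_integrable\<close>)
  then show ?thesis
    using g_nonneg by (intro LIMSEQ_le_const) auto
qed

end

lemma iid_sample_borel: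
  assumes M: "prob_space M" and ind: "prob_space.indep_vars M (\<lambda>_. borel) X {1..}"
    and d: "\<And>i. i \<ge> 1 \<Longrightarrow> distr M borel (X i) = Q" and Q: "sets Q = sets borel"
  shows "iid_sample M Q X"
proof -
  interpret prob_space M by (rule M)
  show ?thesis
  proof
    show "indep_vars (\<lambda>_. Q) X {1..}"
      using ind unfolding indep_vars_def2 by (simp add: Q cong: measurable_cong_sets)
    show "distr M Q (X i) = Q" if "i \<ge> 1" for i
      using d[OF that] by (metis Q distr_cong)
  qed
qed

section \<open>Partial derivatives on sets that need not be open\<close>

text \<open>
The value of a partial derivative outside the interior is a limit of values at interior points, so a
continuous candidate that is right in the interior is right everywhere. All calculus rules below reach the
remaining points through this lemma.
\<close>

lemma pdiff_eqI:
  assumes S: "S \<subseteq> closure (interior S)"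
    and deriv: "\<And>y. y \<in> interior S \<Longrightarrow> ((\<lambda>t. f (y + t *\<^sub>R b)) has_real_derivative g y) (at 0)"
    and g: "continuous_on S g" and x: "x \<in> S"
  shows "pdiff S b f x = g x"
proof (cases "x \<in> interior S")
  case True
  then show ?thesis
    using deriv by (simp add: pdiff_def DERIV_imp_deriv)
next
  case False
  have "(g \<longlongrightarrow> g x) (at x within interior S)"
    using g x by (meson continuous_on_def interior_subset tendsto_within_subset)
  moreover have "\<forall>\<^sub>F y in at x within interior S. g y = deriv (\<lambda>t. f (y + t *\<^sub>R b)) 0"
    by (auto simp: eventually_at_filter DERIV_imp_deriv[OF deriv] intro!: always_eventually)
  ultimately have "((\<lambda>y. deriv (\<lambda>t. f (y + t *\<^sub>R b)) 0) \<longlongrightarrow> g x) (at x within interior S)"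
    by (rule Lim_transform_eventually)
  moreover have "\<not> trivial_limit (at x within interior S)"
    using S x False by (auto simp: trivial_limit_within closure_def)
  ultimately show ?thesis
    using False by (simp add: pdiff_def tendsto_Lim)
qed

lemma Ck_on_continuous: "Ck_on m S f \<Longrightarrow> continuous_on S f"
  by (cases m) auto

lemma Ck_on_pdiff: "Ck_on (Suc m) S f \<Longrightarrow> b \<in> Basis \<Longrightarrow> Ck_on m S (pdiff S b f)"
  by simp

lemma pdiff_continuous: "Ck_on (Suc m) S f \<Longrightarrow> b \<in> Basis \<Longrightarrow> continuous_on S (pdiff S b f)"
  by (rule Ck_on_continuous[OF Ck_on_pdiff])

lemma line_derivative:
  assumes "Ck_on (Suc m) S f" "b \<in> Basis" "x + s *\<^sub>R b \<in> interior S"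
  shows "((\<lambda>t. f (x + t *\<^sub>R b)) has_real_derivative pdiff S b f (x + s *\<^sub>R b)) (at s)"
proof -
  have "((\<lambda>t. f ((x + s *\<^sub>R b) + t *\<^sub>R b)) has_real_derivative pdiff S b f (x + s *\<^sub>R b)) (at 0)"
    using assms by (simp add: pdiff_def DERIV_deriv_iff_real_differentiable)
  then have "((\<lambda>t. f (x + (t + s) *\<^sub>R b)) has_real_derivative pdiff S b f (x + s *\<^sub>R b)) (at 0)"
    by (simp add: algebra_simps)
  then show ?thesis
    using DERIV_shift[of "\<lambda>t. f (x + t *\<^sub>R b)" "pdiff S b f (x + s *\<^sub>R b)" 0 s] by simp
qed

lemma pdiff_derivative:
  assumes "Ck_on (Suc m) S f" "b \<in> Basis" "x \<in> interior S"
  shows "((\<lambda>t. f (x + t *\<^sub>R b)) has_real_derivative pdiff S b f x) (at 0)"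
  using line_derivative[of m S f b x 0] assms by simp

lemma grad_inner: "b \<in> Basis \<Longrightarrow> grad S f x \<bullet> b = pdiff S b f x"
  by (simp add: grad_def inner_sum_left inner_Basis sum.If_cases if_distrib cong: if_cong)

lemma pdiff_mult:
  assumes S: "S \<subseteq> closure (interior S)" and f: "Ck_on 1 S f" and g: "Ck_on 1 S g"
    and b: "b \<in> Basis" and x: "x \<in> S"
  shows "pdiff S b (\<lambda>x. f x * g x) x = pdiff S b f x * g x + f x * pdiff S b g x"
proof (rule pdiff_eqI[OF S _ _ x])
  fix y assume "y \<in> interior S"
  then show "((\<lambda>t. f (y + t *\<^sub>R b) * g (y + t *\<^sub>R b)) has_real_derivative
      pdiff S b f y * g y + f y * pdiff S b g y) (at 0)"
    using f g b by (auto intro!: derivative_eq_intros pdiff_derivative[of 0])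
next
  show "continuous_on S (\<lambda>x. pdiff S b f x * g x + f x * pdiff S b g x)"
    using f g b Ck_on_continuous[OF f] Ck_on_continuous[OF g]
    by (intro continuous_intros pdiff_continuous[of 0]) auto
qed

lemma score_inner:
  assumes S: "S \<subseteq> closure (interior S)" and p: "Ck_on 1 S p" "\<And>x. x \<in> S \<Longrightarrow> 0 < p x"
    and b: "b \<in> Basis" and x: "x \<in> S"
  shows "score S p x \<bullet> b = pdiff S b p x / p x"
  unfolding score_def grad_inner[OF b]
proof (rule pdiff_eqI[OF S _ _ x])
  fix y assume y: "y \<in> interior S"
  have "0 < p y"
    by (rule p(2)[OF subsetD[OF interior_subset y]])
  then show "((\<lambda>t. ln (p (y + t *\<^sub>R b))) has_real_derivative pdiff S b p y / p y) (at 0)"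
    using p(1) b y by (auto intro!: derivative_eq_intros pdiff_derivative[of 0])
next
  have "p x \<noteq> 0" if "x \<in> S" for x
    using p(2)[OF that] by simp
  then show "continuous_on S (\<lambda>x. pdiff S b p x / p x)"
    using p(1) b Ck_on_continuous[OF p(1)] by (intro continuous_intros pdiff_continuous[of 0]) auto
qed

lemma score_continuous:
  assumes S: "S \<subseteq> closure (interior S)" and p: "Ck_on 1 S p" "\<And>x. x \<in> S \<Longrightarrow> 0 < p x"
  shows "continuous_on S (score S p)"
proof -
  have "p x \<noteq> 0" if "x \<in> S" for x
    using p(2)[OF that] by simp
  then have "continuous_on S (\<lambda>x. \<Sum>b\<in>Basis. (pdiff S b p x / p x) *\<^sub>R b)"
    using p(1) Ck_on_continuous[OF p(1)] by (intro continuous_intros pdiff_continuous[of 0]) auto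
  moreover have "score S p x = (\<Sum>b\<in>Basis. (pdiff S b p x / p x) *\<^sub>R b)" if "x \<in> S" for x
    using score_inner[OF S p _ that]
    by (subst euclidean_representation[symmetric]) (auto intro!: sum.cong)
  ultimately show ?thesis
    by (simp cong: continuous_on_cong)
qed

text \<open>
Vanishing partial derivatives allow a walk along the coordinate directions, one at a time, without
changing the value; no total differentiability is involved.
\<close>

lemma constant_on_cube:
  fixes f :: "'a::euclidean_space \<Rightarrow> real"
  assumes zero: "\<And>y b. b \<in> Basis \<Longrightarrow> y \<in> U \<Longrightarrow> ((\<lambda>t. f (y + t *\<^sub>R b)) has_real_derivative 0) (at 0)"
    and cube: "\<And>c. (\<forall>b\<in>Basis. \<bar>c b\<bar> < r) \<Longrightarrow> x + (\<Sum>b\<in>Basis. c b *\<^sub>R b) \<in> U"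
    and r: "0 < r" and c: "\<forall>b\<in>Basis. \<bar>c b\<bar> < r" and B: "B \<subseteq> Basis"
  shows "f (x + (\<Sum>b\<in>B. c b *\<^sub>R b)) = f x"
  using finite_subset[OF B finite_Basis] B
proof (induction B rule: finite_induct)
  case (insert b B)
  let ?y = "x + (\<Sum>b\<in>B. c b *\<^sub>R b)"
  have b: "b \<in> Basis" "b \<notin> B" "finite B" "B \<subseteq> Basis"
    using insert by auto
  have U: "?y + t *\<^sub>R b \<in> U" if "\<bar>t\<bar> < r" for t
  proof -
    \<comment> \<open>The coordinates of \<open>y + t b - x\<close>, where \<open>y\<close> is the point reached so far, all of size less than \<open>r\<close>.\<close>
    define d where "d b' = (if b' = b then t else if b' \<in> B then c b' else 0)" for b'
    have "(\<Sum>b'\<in>Basis. d b' *\<^sub>R b') = (\<Sum>b'\<in>insert b B. d b' *\<^sub>R b')"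
      using b by (intro sum.mono_neutral_right) (auto simp: d_def)
    also have "\<dots> = t *\<^sub>R b + (\<Sum>b'\<in>B. d b' *\<^sub>R b')"
      using b(2,3) by (simp add: d_def)
    also have "(\<Sum>b'\<in>B. d b' *\<^sub>R b') = (\<Sum>b'\<in>B. c b' *\<^sub>R b')"
      using b by (intro sum.cong) (auto simp: d_def)
    finally have "?y + t *\<^sub>R b = x + (\<Sum>b'\<in>Basis. d b' *\<^sub>R b')"
      by (simp add: algebra_simps)
    moreover have "\<forall>b'\<in>Basis. \<bar>d b'\<bar> < r"
      using that c r by (auto simp: d_def)
    ultimately show ?thesis
      using cube[of d] by (simp only:)
  qed
  have "((\<lambda>t. f (?y + t *\<^sub>R b)) has_real_derivative 0) (at s)" if "\<bar>s\<bar> < r" for s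
  proof -
    have "((\<lambda>t. f (?y + s *\<^sub>R b + t *\<^sub>R b)) has_real_derivative 0) (at 0)"
      by (rule zero[OF b(1) U[OF that]])
    then have "((\<lambda>t. f (?y + (t + s) *\<^sub>R b)) has_real_derivative 0) (at 0)"
      by (simp add: algebra_simps)
    then show ?thesis
      using DERIV_shift[of "\<lambda>t. f (?y + t *\<^sub>R b)" 0 0 s] by simp
  qed
  then have "((\<lambda>t. f (?y + t *\<^sub>R b)) has_real_derivative 0) (at s within {-r<..<r})" if "s \<in> {-r<..<r}" for s
    using that by (auto simp: abs_less_iff intro: has_field_derivative_at_within)
  then obtain k where k: "\<forall>t\<in>{-r<..<r}. f (?y + t *\<^sub>R b) = k"
    using has_field_derivative_zero_constant[of "{-r<..<r}" "\<lambda>t. f (?y + t *\<^sub>R b)"] by auto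
  have "\<bar>c b\<bar> < r"
    using c b(1) by blast
  then have "c b \<in> {-r<..<r}" "0 \<in> {-r<..<r}"
    using r by (auto simp: abs_less_iff)
  then have "f (?y + c b *\<^sub>R b) = f (?y + 0 *\<^sub>R b)"
    using bspec[OF k] by metis
  then show ?case
    using insert by (simp add: algebra_simps)
qed simp

lemma constant_of_partials_zero:
  fixes f :: "'a::euclidean_space \<Rightarrow> real"
  assumes U: "open U" "connected U"
    and zero: "\<And>y b. b \<in> Basis \<Longrightarrow> y \<in> U \<Longrightarrow> ((\<lambda>t. f (y + t *\<^sub>R b)) has_real_derivative 0) (at 0)"
    and x: "x \<in> U" and y: "y \<in> U"
  shows "f x = f y"
proof -
  have "\<exists>T. openin (top_of_set U) T \<and> x \<in> T \<and> (\<forall>y\<in>T. f y = f x)" if x: "x \<in> U" for x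
  proof -
    obtain e where e: "0 < e" "ball x e \<subseteq> U"
      using U(1) x openE by blast
    define r where "r = e / real DIM('a)"
    have r: "0 < r"
      using e(1) by (simp add: r_def)
    have cube: "x + (\<Sum>b\<in>Basis. c b *\<^sub>R b) \<in> U" if c: "\<forall>b\<in>Basis. \<bar>c b\<bar> < r" for c
    proof -
      have "norm (\<Sum>b\<in>Basis. c b *\<^sub>R b) \<le> (\<Sum>b\<in>Basis. \<bar>c b\<bar>)"
        by (rule order_trans[OF norm_sum]) simp
      also have "\<dots> < (\<Sum>b\<in>(Basis::'a set). r)"
        using c by (intro sum_strict_mono) auto
      also have "\<dots> = e"
        by (simp add: r_def)
      finally show ?thesis
        using e(2) by (auto simp: dist_norm subset_iff)
    qed
    have const: "f y = f x" if y: "y \<in> ball x (min e r)" for y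
    proof -
      have "\<forall>b\<in>Basis. \<bar>(y - x) \<bullet> b\<bar> < r"
        using y Basis_le_norm[of _ "y - x"] by (force simp: dist_norm norm_minus_commute)
      from constant_on_cube[OF zero cube r this subset_refl]
      show ?thesis
        by (simp add: euclidean_representation)
    qed
    have "openin (top_of_set U) (ball x (min e r))"
      using e U(1) by (intro open_subset) (auto simp: subset_iff)
    moreover have "x \<in> ball x (min e r)"
      using e(1) r by simp
    ultimately show ?thesis
      using const by blast
  qed
  from locally_constant_imp_constant[OF U(2) this] x y show ?thesis
    unfolding constant_on_def by auto
qed

section \<open>Positive definiteness of derivatives of a kernel\<close>

lemma Pair_Basis: "b \<in> Basis \<Longrightarrow> (b, 0) \<in> Basis" "b \<in> Basis \<Longrightarrow> (0, b) \<in> Basis"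
  by (simp_all add: Basis_prod_def)

lemma Times_subset_closure_interior:
  "S \<subseteq> closure (interior S) \<Longrightarrow> T \<subseteq> closure (interior T) \<Longrightarrow> S \<times> T \<subseteq> closure (interior (S \<times> T))"
  by (auto simp: interior_Times closure_Times)

text \<open>
Positive definiteness for families of points with repetitions: the weights of equal points are added up.
The repetitions occur when the points of a family are shifted.
\<close>

lemma pos_def_kernel_indexed:
  assumes k: "pos_def_kernel S k" and I: "finite I" and z: "\<And>i. i \<in> I \<Longrightarrow> z i \<in> S"
  shows "0 \<le> (\<Sum>i\<in>I. \<Sum>j\<in>I. c i * k (z i) (z j) * c j)"
proof -
  define C where "C u = (\<Sum>i\<in>{i\<in>I. z i = u}. c i)" for u
  have group: "(\<Sum>u\<in>z ` I. \<Sum>i\<in>{i\<in>I. z i = u}. g i) = (\<Sum>i\<in>I. g i)" for g :: "_ \<Rightarrow> real"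
    using I by (intro sum.group) auto
  have "0 \<le> (\<Sum>u\<in>z ` I. \<Sum>v\<in>z ` I. C u * k u v * C v)"
    using k I z unfolding pos_def_kernel_def by (auto simp: image_subset_iff)
  also have "\<dots> = (\<Sum>u\<in>z ` I. \<Sum>i\<in>{i\<in>I. z i = u}. \<Sum>v\<in>z ` I. \<Sum>j\<in>{j\<in>I. z j = v}. c i * k (z i) (z j) * c j)"
  proof (rule sum.cong[OF refl])
    fix u
    have "(\<Sum>v\<in>z ` I. C u * k u v * C v)
        = (\<Sum>v\<in>z ` I. \<Sum>i\<in>{i\<in>I. z i = u}. \<Sum>j\<in>{j\<in>I. z j = v}. c i * k (z i) (z j) * c j)"
    proof (rule sum.cong[OF refl])
      fix v
      have "C u * k u v * C v = (\<Sum>i\<in>{i\<in>I. z i = u}. \<Sum>j\<in>{j\<in>I. z j = v}. c i * k u v * c j)"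
        unfolding C_def sum_distrib_right unfolding sum_distrib_left ..
      also have "\<dots> = (\<Sum>i\<in>{i\<in>I. z i = u}. \<Sum>j\<in>{j\<in>I. z j = v}. c i * k (z i) (z j) * c j)"
        by (intro sum.cong refl) auto
      finally show "C u * k u v * C v
          = (\<Sum>i\<in>{i\<in>I. z i = u}. \<Sum>j\<in>{j\<in>I. z j = v}. c i * k (z i) (z j) * c j)" .
    qed
    also have "\<dots> = (\<Sum>i\<in>{i\<in>I. z i = u}. \<Sum>v\<in>z ` I. \<Sum>j\<in>{j\<in>I. z j = v}. c i * k (z i) (z j) * c j)"
      by (rule sum.swap)
    finally show "(\<Sum>v\<in>z ` I. C u * k u v * C v)
        = (\<Sum>i\<in>{i\<in>I. z i = u}. \<Sum>v\<in>z ` I. \<Sum>j\<in>{j\<in>I. z j = v}. c i * k (z i) (z j) * c j)" .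
  qed
  also have "\<dots> = (\<Sum>i\<in>I. \<Sum>j\<in>I. c i * k (z i) (z j) * c j)"
    unfolding group by (simp only: group)
  finally show ?thesis .
qed

locale C2_kernel =
  fixes S :: "'a::euclidean_space set" and k :: "'a \<Rightarrow> 'a \<Rightarrow> real"
  assumes regular: "S \<subseteq> closure (interior S)"
    and pos_def: "pos_def_kernel S k"
    and C2: "Ck_on 2 (S \<times> S) (\<lambda>(x, y). k x y)"
begin

definition D1 :: "'a \<Rightarrow> 'a \<Rightarrow> 'a \<Rightarrow> real" where
  "D1 b x y = pdiff (S \<times> S) (b, 0) (\<lambda>(u, v). k u v) (x, y)"

definition D2 :: "'a \<Rightarrow> 'a \<Rightarrow> 'a \<Rightarrow> real" where
  "D2 b x y = pdiff (S \<times> S) (0, b) (\<lambda>(u, v). k u v) (x, y)"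

definition D12 :: "'a \<Rightarrow> 'a \<Rightarrow> 'a \<Rightarrow> real" where
  "D12 b x y = pdiff (S \<times> S) (b, 0) (pdiff (S \<times> S) (0, b) (\<lambda>(u, v). k u v)) (x, y)"

lemma C2_Suc: "Ck_on (Suc (Suc 0)) (S \<times> S) (\<lambda>(x, y). k x y)"
  using C2 by (simp add: numeral_2_eq_2)

lemma k_continuous: "continuous_on (S \<times> S) (\<lambda>(x, y). k x y)"
  by (rule Ck_on_continuous[OF C2])

lemma D1_continuous: "b \<in> Basis \<Longrightarrow> continuous_on (S \<times> S) (\<lambda>(x, y). D1 b x y)"
  using pdiff_continuous[OF C2_Suc Pair_Basis(1)] by (simp add: D1_def case_prod_unfold)

lemma D2_continuous: "b \<in> Basis \<Longrightarrow> continuous_on (S \<times> S) (\<lambda>(x, y). D2 b x y)"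
  using pdiff_continuous[OF C2_Suc Pair_Basis(2)] by (simp add: D2_def case_prod_unfold)

lemma D12_continuous: "b \<in> Basis \<Longrightarrow> continuous_on (S \<times> S) (\<lambda>(x, y). D12 b x y)"
  using pdiff_continuous[OF Ck_on_pdiff[OF C2_Suc Pair_Basis(2)] Pair_Basis(1)]
  by (simp add: D12_def case_prod_unfold)

lemma D1_line:
  assumes "b \<in> Basis" "x + s *\<^sub>R b \<in> interior S" "y \<in> interior S"
  shows "((\<lambda>t. k (x + t *\<^sub>R b) y) has_real_derivative D1 b (x + s *\<^sub>R b) y) (at s)"
  using line_derivative[OF C2_Suc Pair_Basis(1)[OF assms(1)], of "(x, y)" s] assms
  by (simp add: interior_Times D1_def)

lemma D2_line:
  assumes "b \<in> Basis" "x \<in> interior S" "y + s *\<^sub>R b \<in> interior S"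
  shows "((\<lambda>t. k x (y + t *\<^sub>R b)) has_real_derivative D2 b x (y + s *\<^sub>R b)) (at s)"
  using line_derivative[OF C2_Suc Pair_Basis(2)[OF assms(1)], of "(x, y)" s] assms
  by (simp add: interior_Times D2_def)

lemma D12_line:
  assumes "b \<in> Basis" "x + s *\<^sub>R b \<in> interior S" "y \<in> interior S"
  shows "((\<lambda>t. D2 b (x + t *\<^sub>R b) y) has_real_derivative D12 b (x + s *\<^sub>R b) y) (at s)"
  using line_derivative[OF Ck_on_pdiff[OF C2_Suc Pair_Basis(2)[OF assms(1)]] Pair_Basis(1)[OF assms(1)], of "(x, y)" s] assms
  by (simp add: interior_Times D2_def D12_def)

lemma k_sym: "x \<in> S \<Longrightarrow> y \<in> S \<Longrightarrow> k x y = k y x"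
  using pos_def by (simp add: pos_def_kernel_def)

lemma interior_line:
  assumes "x \<in> interior S" "b \<in> Basis"
  shows "\<exists>d>0. \<forall>t. \<bar>t\<bar> < d \<longrightarrow> x + t *\<^sub>R b \<in> interior S"
proof -
  obtain d where d: "0 < d" "ball x d \<subseteq> interior S"
    using assms openE[OF open_interior] by blast
  show ?thesis
    by (rule exI[of _ d]) (use d assms(2) in \<open>auto simp: subset_iff dist_norm\<close>)
qed

lemma D1_eq_D2:
  assumes b: "b \<in> Basis" and x: "x \<in> S" and y: "y \<in> S"
  shows "D1 b x y = D2 b y x"
proof -
  have "pdiff (S \<times> S) (b, 0) (\<lambda>(u, v). k u v) (x, y) = (\<lambda>(x, y). D2 b y x) (x, y)"
  proof (rule pdiff_eqI)
    show "S \<times> S \<subseteq> closure (interior (S \<times> S))"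
      using regular by (intro Times_subset_closure_interior)
    have "continuous_on (S \<times> S) (\<lambda>z. (\<lambda>(x, y). D2 b x y) (snd z, fst z))"
      by (rule continuous_on_compose2[OF D2_continuous[OF b]]) (auto intro!: continuous_intros)
    then show "continuous_on (S \<times> S) (\<lambda>(x, y). D2 b y x)"
      by (simp add: case_prod_unfold)
    fix z assume "z \<in> interior (S \<times> S)"
    then obtain u v where z: "z = (u, v)" "u \<in> interior S" "v \<in> interior S"
      by (auto simp: interior_Times)
    obtain d where d: "0 < d" "\<And>t. \<bar>t\<bar> < d \<Longrightarrow> u + t *\<^sub>R b \<in> interior S"
      using interior_line[OF z(2) b] by blast
    have "((\<lambda>t. k v (u + t *\<^sub>R b)) has_real_derivative D2 b v u) (at 0)"
      using D2_line[OF b z(3), of u 0] z(2) by simp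
    then have "((\<lambda>t. k (u + t *\<^sub>R b) v) has_real_derivative D2 b v u) (at 0)"
    proof (rule has_field_derivative_transform_within[where d = d])
      fix t :: real assume "dist t 0 < d"
      then have "u + t *\<^sub>R b \<in> S" "v \<in> S"
        using d(2)[of t] b z interior_subset by (auto simp: dist_real_def)
      then show "k v (u + t *\<^sub>R b) = k (u + t *\<^sub>R b) v"
        by (rule k_sym[OF _ _, rotated])
    qed (use d(1) in auto)
    then show "((\<lambda>t. case z + t *\<^sub>R (b, 0) of (u, v) \<Rightarrow> k u v) has_real_derivative (case z of (x, y) \<Rightarrow> D2 b y x)) (at 0)"
      by (simp add: z)
  qed (use x y in auto)
  then show ?thesis
    by (simp add: D1_def)
qed

lemma interior_approx:
  assumes "x \<in> S"
  shows "\<exists>s :: nat \<Rightarrow> 'a. (\<forall>n. s n \<in> interior S) \<and> s \<longlonglongrightarrow> x"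
  using assms regular unfolding closure_sequential subset_iff by blast

lemma continuous_on_Times_seq:
  assumes "continuous_on (S \<times> S) (\<lambda>(x, y). f x y)" "x \<in> S" "y \<in> S" "s \<longlonglongrightarrow> x" "t \<longlonglongrightarrow> y"
    "\<And>n. s n \<in> S" "\<And>n. t n \<in> S"
  shows "(\<lambda>n. f (s n) (t n)) \<longlonglongrightarrow> (f x y :: real)"
  using continuous_on_tendsto_compose[OF assms(1) tendsto_Pair[OF assms(4,5)]] assms
  by (simp add: always_eventually)

text \<open>
For \<open>x\<close> outside the interior the left side differentiates the section \<open>k(x, \<cdot>)\<close> itself, while the right
side is a limit of derivatives at interior points. They agree because the difference quotients at interior
points \<open>s\<^sub>n\<close> near \<open>x\<close> are within \<open>\<epsilon>\<close> of the limit derivative, uniformly in \<open>n\<close>. This identifies the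
gradient occurring in the Stein class with the one in the Stein kernel.
\<close>

lemma pdiff_slice:
  assumes b: "b \<in> Basis" and x: "x \<in> S" and y: "y \<in> S"
  shows "pdiff S b (k x) y = D2 b x y"
proof (rule pdiff_eqI[OF regular _ _ y])
  have "continuous_on S (\<lambda>y. (\<lambda>(x, y). D2 b x y) (x, y))"
    by (rule continuous_on_compose2[OF D2_continuous[OF b]]) (use x in \<open>auto intro!: continuous_intros\<close>)
  then show "continuous_on S (D2 b x)"
    by simp
  fix y assume y: "y \<in> interior S"
  then have yS: "y \<in> S"
    using interior_subset by blast
  obtain s where s: "\<And>n. s n \<in> interior S" "s \<longlonglongrightarrow> x"
    using interior_approx[OF x] by blast
  have sS: "s n \<in> S" for n
    using s(1) interior_subset by blast
  obtain r where r: "0 < r" "\<And>t. \<bar>t\<bar> < r \<Longrightarrow> y + t *\<^sub>R b \<in> interior S"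
    using interior_line[OF y b] by blast
  have line: "y + t *\<^sub>R b \<in> interior S" "y + t *\<^sub>R b \<in> S" if "\<bar>t\<bar> < r" for t
    using r(2)[OF that] b interior_subset by auto
  show "((\<lambda>t. k x (y + t *\<^sub>R b)) has_real_derivative D2 b x y) (at 0)"
    unfolding DERIV_def
  proof (rule LIM_I)
    fix \<epsilon> :: real assume \<epsilon>: "0 < \<epsilon>"
    obtain \<delta> where \<delta>: "0 < \<delta>"
      "\<And>z. z \<in> S \<times> S \<Longrightarrow> dist z (x, y) < \<delta> \<Longrightarrow> dist ((\<lambda>(x, y). D2 b x y) z) (D2 b x y) < \<epsilon> / 2"
      using D2_continuous[OF b] x yS \<epsilon> unfolding continuous_on_iff by (metis (mono_tags, lifting) SigmaI half_gt_zero old.prod.case)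
    have "norm ((k x (y + (0 + t) *\<^sub>R b) - k x (y + 0 *\<^sub>R b)) / t - D2 b x y) < \<epsilon>"
      if t: "t \<noteq> 0" "\<bar>t\<bar> < min r (\<delta> / 2)" for t
    proof -
      \<comment> \<open>The slope \<open>D2 b x y\<close> is subtracted, so that the derivative of the remainder is at most \<open>\<epsilon> / 2\<close>.\<close>
      have bound: "\<bar>k (s n) (y + t *\<^sub>R b) - k (s n) y - t * D2 b x y\<bar> \<le> \<epsilon> / 2 * \<bar>t\<bar>"
        if n: "dist (s n) x < \<delta> / 2" for n
      proof -
        let ?w = "\<lambda>u. k (s n) (y + u *\<^sub>R b) - u * D2 b x y"
        let ?I = "{- \<bar>t\<bar>..\<bar>t\<bar>}"
        have "norm (?w t - ?w 0) \<le> \<epsilon> / 2 * norm (t - 0)"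
        proof (rule field_differentiable_bound[of ?I ?w "\<lambda>u. D2 b (s n) (y + u *\<^sub>R b) - D2 b x y"])
          fix u assume "u \<in> ?I"
          then have u: "\<bar>u\<bar> < r" "\<bar>u\<bar> < \<delta> / 2"
            using t by auto
          have "(?w has_real_derivative D2 b (s n) (y + u *\<^sub>R b) - D2 b x y) (at u)"
            using D2_line[OF b s(1) line(1)[OF u(1)], of n] by (auto intro!: derivative_eq_intros)
          then show "(?w has_real_derivative D2 b (s n) (y + u *\<^sub>R b) - D2 b x y) (at u within ?I)"
            by (rule has_field_derivative_at_within)
          have "dist (s n, y + u *\<^sub>R b) (x, y) \<le> dist (s n) x + dist (y + u *\<^sub>R b) y"
            unfolding dist_Pair_Pair by (rule sqrt_sum_squares_le_sum) auto
          also have "\<dots> < \<delta>"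
            using n u(2) b by (simp add: dist_norm)
          finally show "norm (D2 b (s n) (y + u *\<^sub>R b) - D2 b x y) \<le> \<epsilon> / 2"
            using \<delta>(2)[of "(s n, y + u *\<^sub>R b)"] sS line(2)[OF u(1)] by (simp add: dist_real_def)
        qed auto
        then show ?thesis by (simp add: algebra_simps)
      qed
      have near: "\<forall>\<^sub>F n in sequentially. dist (s n) x < \<delta> / 2"
        using s(2) \<delta>(1) by (intro tendstoD) auto
      have lim: "(\<lambda>n. k (s n) (y + u *\<^sub>R b)) \<longlonglongrightarrow> k x (y + u *\<^sub>R b)" if "\<bar>u\<bar> < r" for u
        using x s(2) sS line(2)[OF that] by (intro continuous_on_Times_seq[OF k_continuous]) auto
      have "(\<lambda>n. \<bar>k (s n) (y + t *\<^sub>R b) - k (s n) y - t * D2 b x y\<bar>)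
          \<longlonglongrightarrow> \<bar>k x (y + t *\<^sub>R b) - k x y - t * D2 b x y\<bar>"
        using lim[of t] lim[of 0] t r(1) by (intro tendsto_intros) auto
      then have "\<bar>k x (y + t *\<^sub>R b) - k x y - t * D2 b x y\<bar> \<le> \<epsilon> / 2 * \<bar>t\<bar>"
        by (rule tendsto_upperbound) (use near bound in \<open>auto elim: eventually_mono\<close>)
      also have "\<dots> < \<epsilon> * \<bar>t\<bar>"
        using \<epsilon> t by simp
      finally have "\<bar>k x (y + t *\<^sub>R b) - k x y - t * D2 b x y\<bar> / \<bar>t\<bar> < \<epsilon>"
        using t by (simp add: divide_less_eq)
      moreover have "(k x (y + t *\<^sub>R b) - k x y) / t - D2 b x y = (k x (y + t *\<^sub>R b) - k x y - t * D2 b x y) / t"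
        using t by (simp add: field_simps)
      ultimately show ?thesis
        by (simp add: abs_divide)
    qed
    then show "\<exists>d>0. \<forall>t. t \<noteq> 0 \<and> norm (t - 0) < d \<longrightarrow>
        norm ((k x (y + (0 + t) *\<^sub>R b) - k x (y + 0 *\<^sub>R b)) / t - D2 b x y) < \<epsilon>"
      using r(1) \<delta>(1) by (intro exI[of _ "min r (\<delta> / 2)"]) auto
  qed
qed

text \<open>
Two applications of the mean value theorem express the second difference quotient as a mixed derivative
at a nearby point.
\<close>

lemma second_difference_limit:
  assumes b: "b \<in> Basis" and x: "x \<in> interior S" and y: "y \<in> interior S"
  shows "((\<lambda>h. (k (x + h *\<^sub>R b) (y + h *\<^sub>R b) - k (x + h *\<^sub>R b) y - k x (y + h *\<^sub>R b) + k x y) / h\<^sup>2)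
    \<longlongrightarrow> D12 b x y) (at_right 0)"
proof (rule tendstoI)
  fix \<epsilon> :: real assume \<epsilon>: "0 < \<epsilon>"
  obtain r where r: "0 < r" "\<And>t. \<bar>t\<bar> < r \<Longrightarrow> x + t *\<^sub>R b \<in> interior S"
    using interior_line[OF x b] by blast
  obtain r' where r': "0 < r'" "\<And>t. \<bar>t\<bar> < r' \<Longrightarrow> y + t *\<^sub>R b \<in> interior S"
    using interior_line[OF y b] by blast
  have S: "x \<in> S" "y \<in> S"
    using x y interior_subset by auto
  obtain \<delta> where \<delta>: "0 < \<delta>"
    "\<And>z. z \<in> S \<times> S \<Longrightarrow> dist z (x, y) < \<delta> \<Longrightarrow> dist ((\<lambda>(x, y). D12 b x y) z) (D12 b x y) < \<epsilon>"
    using D12_continuous[OF b] S \<epsilon> unfolding continuous_on_iff by (metis (mono_tags, lifting) SigmaI old.prod.case)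
  have "dist ((k (x + h *\<^sub>R b) (y + h *\<^sub>R b) - k (x + h *\<^sub>R b) y - k x (y + h *\<^sub>R b) + k x y) / h\<^sup>2) (D12 b x y) < \<epsilon>"
    if h: "0 < h" "h < Min {r, r', \<delta> / 2}" for h
  proof -
    have lx: "x + t *\<^sub>R b \<in> interior S" and ly: "y + t *\<^sub>R b \<in> interior S" if "0 \<le> t" "t \<le> h" for t
      using r(2)[of t] r'(2)[of t] that h b by auto
    have "\<exists>\<tau>>0. \<tau> < h \<and>
        (\<lambda>t. k (x + h *\<^sub>R b) (y + t *\<^sub>R b) - k x (y + t *\<^sub>R b)) h
          - (\<lambda>t. k (x + h *\<^sub>R b) (y + t *\<^sub>R b) - k x (y + t *\<^sub>R b)) 0
        = (h - 0) * (\<lambda>t. D2 b (x + h *\<^sub>R b) (y + t *\<^sub>R b) - D2 b x (y + t *\<^sub>R b)) \<tau>"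
      using h lx[of h] x by (intro MVT2 DERIV_diff D2_line b ly) auto
    then obtain \<tau> where \<tau>: "0 < \<tau>" "\<tau> < h" and eq1:
        "k (x + h *\<^sub>R b) (y + h *\<^sub>R b) - k x (y + h *\<^sub>R b) - (k (x + h *\<^sub>R b) y - k x y)
        = h * (D2 b (x + h *\<^sub>R b) (y + \<tau> *\<^sub>R b) - D2 b x (y + \<tau> *\<^sub>R b))"
      by auto
    have "\<exists>\<sigma>>0. \<sigma> < h \<and>
        (\<lambda>t. D2 b (x + t *\<^sub>R b) (y + \<tau> *\<^sub>R b)) h - (\<lambda>t. D2 b (x + t *\<^sub>R b) (y + \<tau> *\<^sub>R b)) 0
        = (h - 0) * (\<lambda>t. D12 b (x + t *\<^sub>R b) (y + \<tau> *\<^sub>R b)) \<sigma>"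
      using h \<tau> by (intro MVT2 D12_line b lx ly) auto
    then obtain \<sigma> where \<sigma>: "0 < \<sigma>" "\<sigma> < h" and eq2:
        "D2 b (x + h *\<^sub>R b) (y + \<tau> *\<^sub>R b) - D2 b x (y + \<tau> *\<^sub>R b) = h * D12 b (x + \<sigma> *\<^sub>R b) (y + \<tau> *\<^sub>R b)"
      by auto
    have "k (x + h *\<^sub>R b) (y + h *\<^sub>R b) - k (x + h *\<^sub>R b) y - k x (y + h *\<^sub>R b) + k x y
        = h\<^sup>2 * D12 b (x + \<sigma> *\<^sub>R b) (y + \<tau> *\<^sub>R b)"
      using eq1 unfolding eq2 by (simp add: power2_eq_square algebra_simps)
    then have "(k (x + h *\<^sub>R b) (y + h *\<^sub>R b) - k (x + h *\<^sub>R b) y - k x (y + h *\<^sub>R b) + k x y) / h\<^sup>2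
        = D12 b (x + \<sigma> *\<^sub>R b) (y + \<tau> *\<^sub>R b)"
      using h by simp
    moreover have "dist (D12 b (x + \<sigma> *\<^sub>R b) (y + \<tau> *\<^sub>R b)) (D12 b x y) < \<epsilon>"
    proof -
      have "dist (x + \<sigma> *\<^sub>R b, y + \<tau> *\<^sub>R b) (x, y) \<le> dist (x + \<sigma> *\<^sub>R b) x + dist (y + \<tau> *\<^sub>R b) y"
        unfolding dist_Pair_Pair by (rule sqrt_sum_squares_le_sum) auto
      also have "\<dots> < \<delta>"
        using \<sigma> \<tau> h b by (simp add: dist_norm)
      finally show ?thesis
        using \<delta>(2)[of "(x + \<sigma> *\<^sub>R b, y + \<tau> *\<^sub>R b)"] lx[of \<sigma>] ly[of \<tau>] \<sigma> \<tau> interior_subset[of S]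
        by (auto simp: subset_iff)
    qed
    ultimately show ?thesis by simp
  qed
  moreover have "0 < Min {r, r', \<delta> / 2}"
    using r(1) r'(1) \<delta>(1) by simp
  ultimately show "\<forall>\<^sub>F h in at_right 0.
      dist ((k (x + h *\<^sub>R b) (y + h *\<^sub>R b) - k (x + h *\<^sub>R b) y - k x (y + h *\<^sub>R b) + k x y) / h\<^sup>2) (D12 b x y) < \<epsilon>"
    unfolding eventually_at_right_field by blast
qed

text \<open>
The inner product, in the reproducing kernel Hilbert space, of the functionals
\<open>f \<mapsto> \<alpha> f(x) + \<beta> \<partial>\<^sub>b f(x)\<close> and \<open>f \<mapsto> \<alpha>' f(y) + \<beta>' \<partial>\<^sub>b f(y)\<close>.
\<close>

definition jet :: "'a \<Rightarrow> real \<Rightarrow> real \<Rightarrow> 'a \<Rightarrow> real \<Rightarrow> real \<Rightarrow> 'a \<Rightarrow> real" where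
  "jet b \<alpha> \<beta> x \<alpha>' \<beta>' y =
     \<alpha> * \<alpha>' * k x y + \<alpha> * \<beta>' * D2 b x y + \<beta> * \<alpha>' * D1 b x y + \<beta> * \<beta>' * D12 b x y"

text \<open>
The functional \<open>\<alpha> f(x) + \<beta> \<partial>\<^sub>b f(x)\<close> is the limit of the combination of point evaluations with weight
\<open>\<alpha> - \<beta> / h\<close> at \<open>x\<close> and \<open>\<beta> / h\<close> at \<open>x + h b\<close>, for which positive definiteness of the kernel applies.
\<close>

lemma jets_pos_def_interior:
  assumes I: "finite I" and b: "b \<in> Basis" and z: "\<And>i. i \<in> I \<Longrightarrow> z i \<in> interior S"
  shows "0 \<le> (\<Sum>i\<in>I. \<Sum>j\<in>I. jet b (\<alpha> i) (\<beta> i) (z i) (\<alpha> j) (\<beta> j) (z j))"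
proof -
  define F where "F h i j =
      \<alpha> i * \<alpha> j * k (z i) (z j)
    + \<alpha> i * \<beta> j * ((k (z i) (z j + h *\<^sub>R b) - k (z i) (z j)) / h)
    + \<beta> i * \<alpha> j * ((k (z i + h *\<^sub>R b) (z j) - k (z i) (z j)) / h)
    + \<beta> i * \<beta> j * ((k (z i + h *\<^sub>R b) (z j + h *\<^sub>R b) - k (z i + h *\<^sub>R b) (z j)
        - k (z i) (z j + h *\<^sub>R b) + k (z i) (z j)) / h\<^sup>2)" for h i j
  have zS: "z i \<in> S" if "i \<in> I" for i
    using z[OF that] interior_subset by blast
  have inside: "\<forall>\<^sub>F h in at_right 0. \<forall>i\<in>I. z i + h *\<^sub>R b \<in> S"
  proof (rule eventually_ball_finite[OF I], rule ballI)
    fix i assume "i \<in> I"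
    then obtain d where d: "0 < d" "\<And>t. \<bar>t\<bar> < d \<Longrightarrow> z i + t *\<^sub>R b \<in> interior S"
      using interior_line[OF z b] by blast
    then show "\<forall>\<^sub>F h in at_right 0. z i + h *\<^sub>R b \<in> S"
      unfolding eventually_at_right_field using interior_subset[of S]
      by (intro exI[of _ d]) auto
  qed
  have F_nonneg: "0 \<le> (\<Sum>i\<in>I. \<Sum>j\<in>I. F h i j)" if h: "0 < h" "\<forall>i\<in>I. z i + h *\<^sub>R b \<in> S" for h
  proof -
    define c where "c p = (if snd p then \<beta> (fst p) / h else \<alpha> (fst p) - \<beta> (fst p) / h)" for p
    define y where "y p = (if snd p then z (fst p) + h *\<^sub>R b else z (fst p))" for p
    have "0 \<le> (\<Sum>p\<in>I \<times> UNIV. \<Sum>q\<in>I \<times> UNIV. c p * k (y p) (y q) * c q)"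
      using h zS I by (intro pos_def_kernel_indexed[OF pos_def]) (auto simp: y_def)
    also have "\<dots> = (\<Sum>i\<in>I. \<Sum>j\<in>I. \<Sum>e\<in>UNIV. \<Sum>e'\<in>UNIV. c (i, e) * k (y (i, e)) (y (j, e')) * c (j, e'))"
      unfolding sum.cartesian_product' by (intro sum.cong refl) (rule sum.swap)
    also have "\<dots> = (\<Sum>i\<in>I. \<Sum>j\<in>I. F h i j)"
      by (intro sum.cong refl)
        (use h(1) in \<open>simp add: UNIV_bool c_def y_def F_def field_simps power2_eq_square\<close>)
    finally show ?thesis .
  qed
  have "((\<lambda>h. \<Sum>i\<in>I. \<Sum>j\<in>I. F h i j) \<longlongrightarrow>
      (\<Sum>i\<in>I. \<Sum>j\<in>I. jet b (\<alpha> i) (\<beta> i) (z i) (\<alpha> j) (\<beta> j) (z j))) (at_right 0)"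
  proof (intro tendsto_sum)
    fix i j assume ij: "i \<in> I" "j \<in> I"
    have "((\<lambda>h. (k (z i) (z j + h *\<^sub>R b) - k (z i) (z j)) / h) \<longlongrightarrow> D2 b (z i) (z j)) (at_right 0)"
      using D2_line[OF b z[OF ij(1)], of "z j" 0] z[OF ij(2)]
      by (auto simp: DERIV_def intro: tendsto_within_subset)
    moreover have "((\<lambda>h. (k (z i + h *\<^sub>R b) (z j) - k (z i) (z j)) / h) \<longlongrightarrow> D1 b (z i) (z j)) (at_right 0)"
      using D1_line[OF b _ z[OF ij(2)], of "z i" 0] z[OF ij(1)]
      by (auto simp: DERIV_def intro: tendsto_within_subset)
    ultimately show "((\<lambda>h. F h i j) \<longlongrightarrow> jet b (\<alpha> i) (\<beta> i) (z i) (\<alpha> j) (\<beta> j) (z j)) (at_right 0)"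
      unfolding F_def jet_def using second_difference_limit[OF b z[OF ij(1)] z[OF ij(2)]]
      by (intro tendsto_intros)
  qed
  moreover have "\<forall>\<^sub>F h in at_right 0. 0 \<le> (\<Sum>i\<in>I. \<Sum>j\<in>I. F h i j)"
    using inside eventually_at_right_less[of 0] by eventually_elim (rule F_nonneg)
  ultimately show ?thesis
    by (rule tendsto_lowerbound) (simp add: trivial_limit_at_right_real)
qed

text \<open>
Points outside the interior are reached by continuity of the kernel and its derivatives; the weights
\<open>\<alpha>, \<beta>\<close> stay fixed, so nothing has to be known about their dependence on the point.
\<close>

lemma jets_pos_def:
  assumes I: "finite I" and b: "b \<in> Basis" and z: "\<And>i. i \<in> I \<Longrightarrow> z i \<in> S"
  shows "0 \<le> (\<Sum>i\<in>I. \<Sum>j\<in>I. jet b (\<alpha> i) (\<beta> i) (z i) (\<alpha> j) (\<beta> j) (z j))"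
proof -
  have "\<forall>i\<in>I. \<exists>s :: nat \<Rightarrow> 'a. (\<forall>n. s n \<in> interior S) \<and> s \<longlonglongrightarrow> z i"
    using interior_approx z by blast
  then obtain s :: "_ \<Rightarrow> nat \<Rightarrow> 'a"
    where s: "\<And>i n. i \<in> I \<Longrightarrow> s i n \<in> interior S" "\<And>i. i \<in> I \<Longrightarrow> s i \<longlonglongrightarrow> z i"
    by metis
  have sS: "s i n \<in> S" if "i \<in> I" for i n
    using s(1)[OF that] interior_subset by blast
  have "(\<lambda>n. \<Sum>i\<in>I. \<Sum>j\<in>I. jet b (\<alpha> i) (\<beta> i) (s i n) (\<alpha> j) (\<beta> j) (s j n)) \<longlonglongrightarrow>
      (\<Sum>i\<in>I. \<Sum>j\<in>I. jet b (\<alpha> i) (\<beta> i) (z i) (\<alpha> j) (\<beta> j) (z j))"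
  proof (intro tendsto_sum)
    fix i j assume ij: "i \<in> I" "j \<in> I"
    note lim = continuous_on_Times_seq[OF _ z[OF ij(1)] z[OF ij(2)] s(2)[OF ij(1)] s(2)[OF ij(2)] sS[OF ij(1)] sS[OF ij(2)]]
    show "(\<lambda>n. jet b (\<alpha> i) (\<beta> i) (s i n) (\<alpha> j) (\<beta> j) (s j n)) \<longlonglongrightarrow> jet b (\<alpha> i) (\<beta> i) (z i) (\<alpha> j) (\<beta> j) (z j)"
      unfolding jet_def
      by (intro tendsto_intros lim k_continuous D1_continuous D2_continuous D12_continuous b)
  qed
  then show ?thesis
    by (rule LIMSEQ_le_const) (auto intro!: jets_pos_def_interior I b s)
qed

lemma stein_kernel_eq_jets:
  "stein_kernel S k p x y = (\<Sum>b\<in>Basis. jet b (score S p x \<bullet> b) 1 x (score S p y \<bullet> b) 1 y)"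
proof -
  have "score S p x \<bullet> grad2 S k x y = (\<Sum>b\<in>Basis. (score S p x \<bullet> b) * D2 b x y)"
    by (simp add: grad2_def inner_sum_right D2_def mult.commute)
  moreover have "grad1 S k x y \<bullet> score S p y = (\<Sum>b\<in>Basis. D1 b x y * (score S p y \<bullet> b))"
    by (simp add: grad1_def inner_sum_left D1_def inner_commute[of "score S p y"])
  moreover have "mixed_trace S k x y = (\<Sum>b\<in>Basis. D12 b x y)"
    by (simp add: mixed_trace_def D12_def)
  moreover have "k x y * (score S p x \<bullet> score S p y) = (\<Sum>b\<in>Basis. (score S p x \<bullet> b) * (score S p y \<bullet> b) * k x y)"
    by (subst euclidean_inner) (simp add: sum_distrib_left mult_ac)
  ultimately show ?thesis
    by (simp add: stein_kernel_def jet_def sum.distrib mult.commute)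
qed

text \<open>
Component \<open>b\<close> of the Stein operator of \<open>p\<close> applied to \<open>k(x\<^sub>0, \<cdot>)\<close>, evaluated at \<open>x\<close>; equivalently
the inner product of \<open>\<xi>\<^sub>b(x)\<close> with \<open>k(x\<^sub>0, \<cdot>)\<close>.
\<close>

definition stein_op :: "('a \<Rightarrow> real) \<Rightarrow> 'a \<Rightarrow> 'a \<Rightarrow> 'a \<Rightarrow> real" where
  "stein_op p b x\<^sub>0 x = (score S p x \<bullet> b) * k x\<^sub>0 x + D2 b x\<^sub>0 x"

text \<open>
The Gram matrix of the vectors \<open>\<xi>(z\<^sub>i) + t k(x\<^sub>0, \<cdot>) e\<close>, where \<open>e\<close> is the unit vector of direction
\<open>b\<^sub>0\<close>. It has nonnegative entry sum because, direction by direction, it arises from the jets at the points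
\<open>z\<^sub>i\<close> together with one point evaluation at \<open>x\<^sub>0\<close> of weight \<open>t\<close> times the number of points.
\<close>

lemma stein_kernel_bordered_pos_def:
  fixes z :: "'i \<Rightarrow> 'a"
  assumes I: "finite I" and z: "\<And>i. i \<in> I \<Longrightarrow> z i \<in> S" and x0: "x\<^sub>0 \<in> S" and b0: "b\<^sub>0 \<in> Basis"
  shows "0 \<le> (\<Sum>i\<in>I. \<Sum>j\<in>I. stein_kernel S k p (z i) (z j)
      + t * (stein_op p b\<^sub>0 x\<^sub>0 (z i) + stein_op p b\<^sub>0 x\<^sub>0 (z j)) + t\<^sup>2 * k x\<^sub>0 x\<^sub>0)"
proof -
  \<comment> \<open>The factor \<open>card I\<close> distributes one copy of \<open>t\<close> to each summand of the double sum.\<close>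
  define T where "T b = (if b = b\<^sub>0 then t * real (card I) else 0)" for b :: 'a
  define J where "J b i j = jet b (score S p (z i) \<bullet> b) 1 (z i) (score S p (z j) \<bullet> b) 1 (z j)" for b i j
  define A where "A b i = stein_op p b x\<^sub>0 (z i)" for b i
  have "0 \<le> (\<Sum>i\<in>I. \<Sum>j\<in>I. J b i j) + 2 * T b * (\<Sum>i\<in>I. A b i) + (T b)\<^sup>2 * k x\<^sub>0 x\<^sub>0"
    if b: "b \<in> Basis" for b
  proof -
    \<comment> \<open>The index \<open>None\<close> stands for the point \<open>x\<^sub>0\<close>, which enters without derivative.\<close>
    let ?I = "insert None (Some ` I)"
    define y where "y = case_option x\<^sub>0 z"
    define \<alpha> where "\<alpha> = case_option (T b) (\<lambda>i. score S p (z i) \<bullet> b)"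
    define \<beta> where "\<beta> = case_option 0 (\<lambda>i::'i. 1::real)"
    let ?J = "\<lambda>i j. jet b (\<alpha> i) (\<beta> i) (y i) (\<alpha> j) (\<beta> j) (y j)"
    have "0 \<le> (\<Sum>i\<in>?I. \<Sum>j\<in>?I. ?J i j)"
      using I z x0 by (intro jets_pos_def b) (auto simp: y_def)
    also have "\<dots> = ?J None None + (\<Sum>j\<in>I. ?J None (Some j)) + ((\<Sum>i\<in>I. ?J (Some i) None)
        + (\<Sum>i\<in>I. \<Sum>j\<in>I. ?J (Some i) (Some j)))"
      using I by (simp add: sum.reindex sum.distrib)
    also have "?J None None = (T b)\<^sup>2 * k x\<^sub>0 x\<^sub>0"
      by (simp add: jet_def \<alpha>_def \<beta>_def y_def power2_eq_square)
    also have "(\<Sum>j\<in>I. ?J None (Some j)) = T b * (\<Sum>i\<in>I. A b i)"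
      by (simp add: jet_def \<alpha>_def \<beta>_def y_def A_def stein_op_def sum_distrib_left algebra_simps)
    also have "(\<Sum>i\<in>I. ?J (Some i) None) = T b * (\<Sum>i\<in>I. A b i)"
      unfolding sum_distrib_left
    proof (rule sum.cong[OF refl])
      fix i assume "i \<in> I"
      then show "?J (Some i) None = T b * A b i"
        using D1_eq_D2[OF b z x0] k_sym[OF z x0]
        by (simp add: jet_def \<alpha>_def \<beta>_def y_def A_def stein_op_def algebra_simps)
    qed
    also have "(\<Sum>i\<in>I. \<Sum>j\<in>I. ?J (Some i) (Some j)) = (\<Sum>i\<in>I. \<Sum>j\<in>I. J b i j)"
      by (simp add: J_def \<alpha>_def \<beta>_def y_def)
    finally show ?thesis by simp
  qed
  then have "0 \<le> (\<Sum>b\<in>Basis. (\<Sum>i\<in>I. \<Sum>j\<in>I. J b i j) + 2 * T b * (\<Sum>i\<in>I. A b i) + (T b)\<^sup>2 * k x\<^sub>0 x\<^sub>0)"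
    by (rule sum_nonneg)
  also have "\<dots> = (\<Sum>b\<in>Basis. \<Sum>i\<in>I. \<Sum>j\<in>I. J b i j) + (\<Sum>b\<in>Basis. 2 * T b * (\<Sum>i\<in>I. A b i))
      + (\<Sum>b\<in>Basis. (T b)\<^sup>2 * k x\<^sub>0 x\<^sub>0)"
    by (simp add: sum.distrib)
  also have "(\<Sum>b\<in>Basis. 2 * T b * (\<Sum>i\<in>I. A b i)) = 2 * (t * real (card I)) * (\<Sum>i\<in>I. A b\<^sub>0 i)"
    using b0 by (subst sum.remove[OF finite_Basis b0]) (simp add: T_def)
  also have "(\<Sum>b\<in>Basis. (T b)\<^sup>2 * k x\<^sub>0 x\<^sub>0) = (t * real (card I))\<^sup>2 * k x\<^sub>0 x\<^sub>0"
    using b0 by (subst sum.remove[OF finite_Basis b0]) (simp add: T_def)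
  also have "(\<Sum>b\<in>Basis. \<Sum>i\<in>I. \<Sum>j\<in>I. J b i j) = (\<Sum>i\<in>I. \<Sum>j\<in>I. stein_kernel S k p (z i) (z j))"
    unfolding stein_kernel_eq_jets J_def
    by (subst sum.swap, intro sum.cong refl, subst sum.swap, rule refl)
  finally show ?thesis
    by (simp add: sum.distrib A_def power2_eq_square sum_distrib_left[symmetric] algebra_simps)
qed

end

section \<open>Positivity of the discrepancy\<close>

lemma quadratic_nonneg_imp_linear_zero:
  fixes e \<kappa> c :: real
  assumes "\<And>t. 0 \<le> c + 2 * t * e + t\<^sup>2 * \<kappa>" and "c \<le> 0"
  shows "e = 0"
proof (rule ccontr)
  assume e: "e \<noteq> 0"
  \<comment> \<open>At \<open>t = - s e\<close> the linear term dominates the quadratic one.\<close>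
  define s where "s = 1 / (\<bar>\<kappa>\<bar> + 1)"
  have s: "0 < s" "s * \<bar>\<kappa>\<bar> \<le> 1"
    by (auto simp: s_def divide_simps)
  have "0 \<le> c + 2 * (- (s * e)) * e + (- (s * e))\<^sup>2 * \<kappa>"
    by (rule assms(1))
  also have "\<dots> \<le> 2 * (- (s * e)) * e + (- (s * e))\<^sup>2 * \<bar>\<kappa>\<bar>"
    using assms(2) by (intro add_mono mult_left_mono) auto
  also have "\<dots> = s * e\<^sup>2 * (s * \<bar>\<kappa>\<bar> - 2)"
    by (simp add: power2_eq_square algebra_simps)
  also have "\<dots> < 0"
    using s e by (intro mult_pos_neg) auto
  finally show False by simp
qed

text \<open>
If the squared discrepancy is not positive, the mean embedding \<open>E \<xi>(X)\<close> is orthogonal to every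
\<open>k(x\<^sub>0, \<cdot>)\<close>. Integrating the bordered Gram kernel gives a polynomial in \<open>t\<close> that is nonnegative, with
constant term the squared discrepancy and linear coefficient twice the integral in question.
\<close>

lemma (in C2_kernel) stein_op_integral_zero:
  assumes iid: "iid_sample M Q X" and S: "S \<in> sets Q" "AE x in Q. x \<in> S"
    and h: "set_integrable (Q \<Otimes>\<^sub>M Q) (S \<times> S) (\<lambda>(x, y). stein_kernel S k p x y)"
    and a: "set_integrable Q S (stein_op p b x\<^sub>0)"
    and x0: "x\<^sub>0 \<in> S" and b: "b \<in> Basis" and nonpos: "KSD2 S k Q p \<le> 0"
  shows "(LINT x:S|Q. stein_op p b x\<^sub>0 x) = 0"
proof (rule quadratic_nonneg_imp_linear_zero)
  interpret iid_sample M Q X by (rule iid)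
  interpret Q: prob_space Q by (rule prob_space_Q)
  interpret QQ: pair_prob_space Q Q ..
  fix t :: real
  define H where "H x y = indicator (S \<times> S) (x, y) * stein_kernel S k p x y" for x y
  define A where "A x = indicator S x * stein_op p b x\<^sub>0 x" for x
  define G where "G x y = H x y + (t * A x + t * A y + t\<^sup>2 * k x\<^sub>0 x\<^sub>0)" for x y
  have H_int: "integrable (Q \<Otimes>\<^sub>M Q) (\<lambda>(x, y). H x y)"
    using h by (simp add: set_integrable_def H_def case_prod_unfold)
  have A_int: "integrable Q A"
    using a by (simp add: set_integrable_def A_def[abs_def])
  note A12 = integrable_fst_snd[OF A_int]
  have G_int: "integrable (Q \<Otimes>\<^sub>M Q) (\<lambda>(x, y). G x y)"
    unfolding G_def using H_int A12(1,2) by (simp add: case_prod_unfold)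
  have "0 \<le> (\<integral>(x, y). G x y \<partial>(Q \<Otimes>\<^sub>M Q))"
  proof (rule pos_def_integral_nonneg[OF G_int S])
    fix I :: "nat set" and z assume I: "finite I" and z: "\<And>i. i \<in> I \<Longrightarrow> z i \<in> S"
    have "(\<Sum>i\<in>I. \<Sum>j\<in>I. G (z i) (z j)) = (\<Sum>i\<in>I. \<Sum>j\<in>I. stein_kernel S k p (z i) (z j)
        + t * (stein_op p b x\<^sub>0 (z i) + stein_op p b x\<^sub>0 (z j)) + t\<^sup>2 * k x\<^sub>0 x\<^sub>0)"
      using z by (intro sum.cong refl) (simp add: G_def H_def A_def algebra_simps)
    then show "0 \<le> (\<Sum>i\<in>I. \<Sum>j\<in>I. G (z i) (z j))"
      using stein_kernel_bordered_pos_def[OF I z x0 b] by simp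
  qed
  also have "(\<integral>(x, y). G x y \<partial>(Q \<Otimes>\<^sub>M Q)) = (\<integral>(x, y). H x y \<partial>(Q \<Otimes>\<^sub>M Q))
      + (t * (\<integral>x. A x \<partial>Q) + t * (\<integral>x. A x \<partial>Q) + t\<^sup>2 * k x\<^sub>0 x\<^sub>0)"
    unfolding G_def A12(3)[symmetric] using H_int A12 by (simp add: case_prod_unfold QQ.P.prob_space)
  also have "(\<integral>(x, y). H x y \<partial>(Q \<Otimes>\<^sub>M Q)) = KSD2 S k Q p"
    by (simp add: KSD2_def set_lebesgue_integral_def H_def case_prod_unfold)
  also have "(\<integral>x. A x \<partial>Q) = (LINT x:S|Q. stein_op p b x\<^sub>0 x)"
    by (simp add: set_lebesgue_integral_def A_def)
  finally show "0 \<le> KSD2 S k Q p + 2 * t * (LINT x:S|Q. stein_op p b x\<^sub>0 x) + t\<^sup>2 * k x\<^sub>0 x\<^sub>0"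
    by simp
qed (rule nonpos)

text \<open>
The logarithm of the quotient has vanishing partial derivatives in the connected interior; proportionality
extends to the rest of the set by continuity.
\<close>

lemma same_score_imp_proportional:
  fixes S :: "'a::euclidean_space set"
  assumes S: "S \<subseteq> closure (interior S)" "connected (interior S)" "interior S \<noteq> {}"
    and p: "Ck_on 1 S p" "\<And>x. x \<in> S \<Longrightarrow> 0 < p x" and q: "Ck_on 1 S q" "\<And>x. x \<in> S \<Longrightarrow> 0 < q x"
    and eq: "\<And>x. x \<in> interior S \<Longrightarrow> score S p x = score S q x"
  obtains c where "0 < c" "\<And>x. x \<in> S \<Longrightarrow> p x = c * q x"
proof -
  have I: "x \<in> S" if "x \<in> interior S" for x
    using that interior_subset by blast
  obtain x1 where x1: "x1 \<in> interior S"
    using S(3) by blast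
  define c where "c = p x1 / q x1"
  have ln_eq: "ln (p x) - ln (q x) = ln (p x1) - ln (q x1)" if x: "x \<in> interior S" for x
  proof (rule constant_of_partials_zero[OF open_interior S(2) _ x x1])
    fix y b :: 'a assume b: "b \<in> Basis" and y: "y \<in> interior S"
    have "score S p y \<bullet> b = score S q y \<bullet> b"
      using eq[OF y] by simp
    then have "pdiff S b p y / p y = pdiff S b q y / q y"
      by (simp add: score_inner[OF S(1) p b I[OF y]] score_inner[OF S(1) q b I[OF y]])
    then show "((\<lambda>t. ln (p (y + t *\<^sub>R b)) - ln (q (y + t *\<^sub>R b))) has_real_derivative 0) (at 0)"
      using p(2)[OF I[OF y]] q(2)[OF I[OF y]] p(1) q(1) b y
      by (auto intro!: derivative_eq_intros pdiff_derivative[of 0])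
  qed
  have interior: "p x = c * q x" if x: "x \<in> interior S" for x
  proof -
    have pos: "0 < p x" "0 < q x" "0 < p x1" "0 < q x1"
      using p(2) q(2) I x x1 by auto
    then have "ln (p x / q x) = ln (p x1 / q x1)"
      using ln_eq[OF x] by (simp add: ln_div)
    then have "p x / q x = c"
      using pos by (simp add: c_def)
    then show ?thesis
      using pos by (simp add: field_simps)
  qed
  have "p x = c * q x" if x: "x \<in> S" for x
  proof -
    obtain s where s: "\<And>n. s n \<in> interior S" "s \<longlonglongrightarrow> x"
      using S(1) x unfolding closure_sequential subset_iff by blast
    have "(\<lambda>n. p (s n)) \<longlonglongrightarrow> p x"
      using x s I by (intro continuous_on_tendsto_compose[OF Ck_on_continuous[OF p(1)]]) (auto intro!: always_eventually)
    moreover have "(\<lambda>n. c * q (s n)) \<longlonglongrightarrow> c * q x"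
      using x s I by (intro tendsto_intros continuous_on_tendsto_compose[OF Ck_on_continuous[OF q(1)]]) (auto intro!: always_eventually)
    ultimately show ?thesis
      using s(1) interior by (simp add: LIMSEQ_unique)
  qed
  moreover have "0 < c"
    using p(2)[OF I[OF x1]] q(2)[OF I[OF x1]] by (simp add: c_def)
  ultimately show thesis
    using that by blast
qed

lemma proportional_densities_eq:
  assumes P: "prob_space P" "P = density lborel (\<lambda>x. ennreal (p x) * indicator S x)"
    and Q: "prob_space Q" "Q = density lborel (\<lambda>x. ennreal (q x) * indicator S x)"
    and c: "0 < c" "\<And>x. x \<in> S \<Longrightarrow> p x = c * q x" "\<And>x. x \<in> S \<Longrightarrow> 0 < q x"
    and meas: "(\<lambda>x. ennreal (q x) * indicator S x) \<in> borel_measurable lborel"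
  shows "P = Q"
proof -
  let ?q = "\<lambda>x. ennreal (q x) * indicator S x"
  have p_eq: "(\<lambda>x. ennreal (p x) * indicator S x) = (\<lambda>x. ennreal c * ?q x)"
    using c by (auto simp: fun_eq_iff indicator_def ennreal_mult less_imp_le)
  have "1 = emeasure Q UNIV"
    using prob_space.emeasure_space_1[OF Q(1)] by (simp add: Q(2))
  then have q1: "(\<integral>\<^sup>+x. ?q x \<partial>lborel) = 1"
    unfolding Q(2) using meas by (subst (asm) emeasure_density) auto
  have "1 = emeasure P UNIV"
    using prob_space.emeasure_space_1[OF P(1)] by (simp add: P(2))
  then have "(\<integral>\<^sup>+x. ennreal c * ?q x \<partial>lborel) = 1"
    unfolding P(2) p_eq using meas by (subst (asm) emeasure_density) auto
  then have "ennreal c = 1"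
    using meas by (simp add: nn_integral_cmult q1)
  then show ?thesis
    unfolding P(2) Q(2) p_eq by simp
qed

lemma continuous_AE_zero:
  fixes g :: "'a::euclidean_space \<Rightarrow> real"
  assumes U: "open U" and g: "continuous_on U g" and ae: "AE x in lborel. x \<in> U \<longrightarrow> g x = 0" and x: "x \<in> U"
  shows "g x = 0"
proof (rule ccontr)
  assume "g x \<noteq> 0"
  let ?V = "U \<inter> g -` (- {0})"
  have V: "open ?V"
    using g U by (intro continuous_open_preimage) auto
  have "?V \<in> null_sets lborel"
    using ae V by (subst (asm) AE_iff_null) (auto simp: Int_def vimage_def)
  then have "negligible ?V"
    by (simp add: negligible_iff_null_sets null_sets_completionI)
  with open_not_negligible[OF V] x \<open>g x \<noteq> 0\<close> show False
    by blast
qed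

lemma sets_C1_density:
  "has_C1_pos_density Q S q \<Longrightarrow> sets Q = sets borel" "has_C1_pos_density Q S q \<Longrightarrow> space Q = UNIV"
  by (auto simp: has_C1_pos_density_def)

lemma C1_density_measurable:
  assumes "has_C1_pos_density Q S q" "S \<in> sets borel"
  shows "(\<lambda>x. indicator S x * q x) \<in> borel_measurable borel"
  using borel_measurable_continuous_on_indicator[of S q] assms
  by (simp add: has_C1_pos_density_def Ck_on_continuous)

lemma C1_density_eq:
  assumes "has_C1_pos_density Q S q"
  shows "Q = density lborel (\<lambda>x. ennreal (indicator S x * q x))"
proof -
  have "(\<lambda>x. ennreal (indicator S x * q x)) = (\<lambda>x. ennreal (q x) * indicator S x)"
    by (auto simp: indicator_def)
  then show ?thesis
    using assms by (simp add: has_C1_pos_density_def)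
qed

lemma C1_density_nonneg:
  assumes "has_C1_pos_density Q S q"
  shows "0 \<le> indicator S x * q x"
  using assms by (auto simp: has_C1_pos_density_def indicator_def less_imp_le)

lemma C1_density_AE_in:
  assumes Q: "has_C1_pos_density Q S q" and S: "S \<in> sets borel"
  shows "AE x in Q. x \<in> S"
  unfolding C1_density_eq[OF Q] using C1_density_measurable[OF Q S]
  by (subst AE_density) (auto simp: indicator_def)

lemma C1_density_integral:
  fixes f :: "'a::euclidean_space \<Rightarrow> real"
  assumes Q: "has_C1_pos_density Q S q" and S: "S \<in> sets borel"
    and f: "(\<lambda>x. indicator S x * f x) \<in> borel_measurable borel"
  shows "set_integrable Q S f \<longleftrightarrow> set_integrable lborel S (\<lambda>x. q x * f x)"
    and "(LINT x:S|Q. f x) = (LINT x:S|lborel. q x * f x)"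
proof -
  have *: "(indicator S x * q x) * (indicator S x * f x) = indicator S x * (q x * f x)" for x
    by (auto simp: indicator_def)
  have m: "(\<lambda>x. indicator S x * q x) \<in> borel_measurable lborel"
    using C1_density_measurable[OF Q S] by simp
  have f': "(\<lambda>x. indicator S x * f x) \<in> borel_measurable lborel"
    using f by simp
  show "set_integrable Q S f \<longleftrightarrow> set_integrable lborel S (\<lambda>x. q x * f x)"
    using integrable_density[OF f' m] C1_density_nonneg[OF Q]
    by (simp add: set_integrable_def * C1_density_eq[OF Q, symmetric])
  show "(LINT x:S|Q. f x) = (LINT x:S|lborel. q x * f x)"
    using integral_density[OF f' m] C1_density_nonneg[OF Q]
    by (simp add: set_lebesgue_integral_def * C1_density_eq[OF Q, symmetric])
qed

text \<open>
The discrepancy separates a model from the data distribution. Otherwise \<open>stein_op_integral_zero\<close> and the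
Stein class of \<open>k(x\<^sub>0, \<cdot>)\<close> give \<open>\<integral> k(x\<^sub>0, y) g(y) dy = 0\<close> for every \<open>x\<^sub>0\<close>, where \<open>g\<close> is a component of
\<open>q (s\<^sub>p - s\<^sub>q)\<close>, and integral strict positive definiteness makes \<open>g\<close> vanish almost everywhere.
\<close>

theorem KSD2_pos:
  fixes S :: "'a::euclidean_space set"
  assumes iid: "iid_sample M Q X"
    and S: "S \<in> sets borel" "S \<subseteq> closure (interior S)" "connected (interior S)" "interior S \<noteq> {}"
    and Q: "has_C1_pos_density Q S q"
    and P: "has_C1_pos_density P S p" "prob_space P" "P \<noteq> Q"
    and k: "kernel_stein_class S q k" "int_strictly_pos_def S k"
    and kB: "\<And>x y. x \<in> S \<Longrightarrow> y \<in> S \<Longrightarrow> \<bar>k x y\<bar> \<le> B"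
    and gB: "\<And>x y. x \<in> S \<Longrightarrow> y \<in> S \<Longrightarrow> norm (grad2 S k x y) \<le> B"
    and s_int: "set_integrable Q S (score S p)"
    and h: "set_integrable (Q \<Otimes>\<^sub>M Q) (S \<times> S) (\<lambda>(x, y). stein_kernel S k p x y)"
    and L2: "(\<integral>\<^sup>+x\<in>S. ennreal ((norm (q x *\<^sub>R (score S p x - score S q x)))\<^sup>2) \<partial>lborel) < \<infinity>"
  shows "0 < KSD2 S k Q p"
proof (rule ccontr)
  assume "\<not> 0 < KSD2 S k Q p"
  then have nonpos: "KSD2 S k Q p \<le> 0" by simp
  interpret iid_sample M Q X by (rule iid)
  interpret Q: prob_space Q by (rule prob_space_Q)
  interpret C2_kernel S k
    using S(2) k(1) by (unfold_locales) (auto simp: kernel_stein_class_def)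
  have S_Q: "S \<in> sets Q" "AE x in Q. x \<in> S"
    using S(1) sets_C1_density[OF Q] C1_density_AE_in[OF Q S(1)] by auto
  have p: "Ck_on 1 S p" "\<And>x. x \<in> S \<Longrightarrow> 0 < p x" and q: "Ck_on 1 S q" "\<And>x. x \<in> S \<Longrightarrow> 0 < q x"
    using P(1) Q by (auto simp: has_C1_pos_density_def)
  have cont: "continuous_on S (score S p)" "continuous_on S (score S q)" "continuous_on S q"
    using score_continuous[OF S(2) p] score_continuous[OF S(2) q] Ck_on_continuous[OF q(1)] by auto
  have B0: "0 \<le> B"
    using S(4) interior_subset[of S] kB by (metis abs_ge_zero ex_in_conv order_trans subsetD)
  define g where "g b x = indicator S x * (q x * ((score S p x - score S q x) \<bullet> b))" for b x
  have g_meas: "g b \<in> borel_measurable borel" for b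
  proof -
    have "continuous_on S (\<lambda>x. q x * ((score S p x - score S q x) \<bullet> b))"
      by (intro continuous_intros cont)
    from borel_measurable_continuous_on_indicator[OF S(1) this] show ?thesis
      by (simp add: g_def[abs_def])
  qed
  have inner_zero: "(LINT y:S|lborel. k x\<^sub>0 y * g b y) = 0" if x0: "x\<^sub>0 \<in> S" and b: "b \<in> Basis" for x\<^sub>0 b
  proof -
    let ?A = "stein_op p b x\<^sub>0"
    let ?B = "\<lambda>y. D2 b x\<^sub>0 y * q y + k x\<^sub>0 y * pdiff S b q y"
    have k_cont: "continuous_on S (k x\<^sub>0)"
      using k(1) x0 by (auto simp: kernel_stein_class_def stein_class_def)
    have D2_cont: "continuous_on S (D2 b x\<^sub>0)"
    proof -
      have "continuous_on S (\<lambda>y. (\<lambda>(x, y). D2 b x y) (x\<^sub>0, y))"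
        by (rule continuous_on_compose2[OF D2_continuous[OF b]]) (use x0 in \<open>auto intro!: continuous_intros\<close>)
      then show ?thesis by simp
    qed
    have A_meas: "(\<lambda>x. indicator S x * ?A x) \<in> borel_measurable borel"
    proof -
      have "continuous_on S ?A"
        unfolding stein_op_def[abs_def] by (intro continuous_intros cont k_cont D2_cont)
      from borel_measurable_continuous_on_indicator[OF S(1) this] show ?thesis
        by simp
    qed
    have A_int: "set_integrable Q S ?A"
      unfolding set_integrable_def
    proof (rule Bochner_Integration.integrable_bound)
      show "integrable Q (\<lambda>x. B * norm (indicator S x *\<^sub>R score S p x) + B)"
        using integrable_norm[OF s_int[unfolded set_integrable_def]]
        by (intro Bochner_Integration.integrable_add integrable_mult_right) auto
      show "(\<lambda>x. indicator S x *\<^sub>R ?A x) \<in> borel_measurable Q"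
        using A_meas sets_C1_density[OF Q] by (simp cong: measurable_cong_sets)
      show "AE x in Q. norm (indicator S x *\<^sub>R ?A x) \<le> norm (B * norm (indicator S x *\<^sub>R score S p x) + B)"
      proof (rule AE_I2)
        fix x
        have "\<bar>?A x\<bar> \<le> B * norm (score S p x) + B" if x: "x \<in> S"
        proof -
          have "\<bar>score S p x \<bullet> b\<bar> \<le> norm (score S p x)"
            using Basis_le_norm[OF b] by blast
          then have "\<bar>(score S p x \<bullet> b) * k x\<^sub>0 x\<bar> \<le> norm (score S p x) * B"
            unfolding abs_mult using kB[OF x0 x] by (intro mult_mono) auto
          moreover have "grad2 S k x\<^sub>0 x \<bullet> b = D2 b x\<^sub>0 x"
            using b by (simp add: grad2_def D2_def inner_sum_left inner_Basis if_distrib cong: if_cong)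
          then have "\<bar>D2 b x\<^sub>0 x\<bar> \<le> B"
            using Basis_le_norm[OF b, of "grad2 S k x\<^sub>0 x"] gB[OF x0 x] by simp
          ultimately show ?thesis
            unfolding stein_op_def by (simp add: mult.commute)
        qed
        then show "norm (indicator S x *\<^sub>R ?A x) \<le> norm (B * norm (indicator S x *\<^sub>R score S p x) + B)"
          using B0 by (auto simp: indicator_def)
      qed
    qed
    have A_zero: "(LINT x:S|Q. ?A x) = 0"
      by (rule stein_op_integral_zero[OF iid S_Q h A_int x0 b nonpos])
    have A_leb: "set_integrable lborel S (\<lambda>y. q y * ?A y)" "(LINT y:S|lborel. q y * ?A y) = 0"
      using A_int A_zero C1_density_integral[OF Q S(1) A_meas] by simp_all
    have stein: "set_integrable lborel S (grad S (\<lambda>y. k x\<^sub>0 y * q y))"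
        "(LINT y:S|lborel. grad S (\<lambda>y. k x\<^sub>0 y * q y) y) = 0"
      using k(1) x0 by (auto simp: kernel_stein_class_def stein_class_def)
    have grad_eq: "indicator S y * ?B y = (indicator S y *\<^sub>R grad S (\<lambda>y. k x\<^sub>0 y * q y) y) \<bullet> b" for y
    proof (cases "y \<in> S")
      case True
      have "Ck_on 1 S (k x\<^sub>0)"
        using k(1) x0 by (auto simp: kernel_stein_class_def stein_class_def)
      then show ?thesis
        using pdiff_mult[OF S(2) _ q(1) b True, of "k x\<^sub>0"] pdiff_slice[OF b x0 True] True
        by (simp add: grad_inner[OF b])
    qed simp
    have B_leb: "set_integrable lborel S ?B" "(LINT y:S|lborel. ?B y) = 0"
    proof -
      note i = stein(1)[unfolded set_integrable_def]
      show "set_integrable lborel S ?B"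
        unfolding set_integrable_def real_scaleR_def grad_eq by (rule integrable_inner_left[OF i])
      show "(LINT y:S|lborel. ?B y) = 0"
        using integral_inner_left[OF i, of b] stein(2)
        unfolding set_lebesgue_integral_def real_scaleR_def grad_eq by simp
    qed
    \<comment> \<open>The derivative of \<open>k(x\<^sub>0, \<cdot>)\<close> occurs in both identities and cancels.\<close>
    have diff: "k x\<^sub>0 y * g b y = q y * ?A y - ?B y" if y: "y \<in> S" for y
      using y q(2)[OF y] score_inner[OF S(2) q b y]
      by (simp add: g_def stein_op_def inner_diff_left algebra_simps)
    have "(LINT y:S|lborel. k x\<^sub>0 y * g b y) = (LINT y:S|lborel. q y * ?A y - ?B y)"
      using S(1) by (intro set_lebesgue_integral_cong) (auto simp: diff)
    also have "\<dots> = 0"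
      using A_leb B_leb by (simp add: set_integral_diff)
    finally show ?thesis .
  qed
  have g_null: "(\<integral>\<^sup>+x\<in>S. ennreal ((g b x)\<^sup>2) \<partial>lborel) = 0" if b: "b \<in> Basis" for b
  proof (rule ccontr)
    assume "\<not> ?thesis"
    then have pos: "0 < (\<integral>\<^sup>+x\<in>S. ennreal ((g b x)\<^sup>2) \<partial>lborel)"
      by (simp add: zero_less_iff_neq_zero)
    have "(\<integral>\<^sup>+x\<in>S. ennreal ((g b x)\<^sup>2) \<partial>lborel)
        \<le> (\<integral>\<^sup>+x\<in>S. ennreal ((norm (q x *\<^sub>R (score S p x - score S q x)))\<^sup>2) \<partial>lborel)"
    proof (intro nn_integral_mono mult_right_mono ennreal_leI)
      fix x
      have "\<bar>g b x\<bar> \<le> norm (q x *\<^sub>R (score S p x - score S q x))"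
        using Basis_le_norm[OF b, of "q x *\<^sub>R (score S p x - score S q x)"] by (auto simp: g_def indicator_def)
      then show "(g b x)\<^sup>2 \<le> (norm (q x *\<^sub>R (score S p x - score S q x)))\<^sup>2"
        by (metis abs_ge_zero power2_abs power_mono)
    qed simp
    also note L2
    finally have "0 < (LINT x:S|lborel. LINT y:S|lborel. g b x * k x y * g b y)"
      using k(2) g_meas[of b] pos unfolding int_strictly_pos_def_def by blast
    also have "\<dots> = (LINT x:S|lborel. 0)"
      using S(1) inner_zero[OF _ b] by (intro set_lebesgue_integral_cong) (auto simp: mult.assoc)
    finally show False
      by (simp add: set_lebesgue_integral_def)
  qed
  have "score S p x = score S q x" if x: "x \<in> interior S" for x
  proof (rule euclidean_eqI)
    fix b :: 'a assume b: "b \<in> Basis"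
    have "AE x in lborel. ennreal ((g b x)\<^sup>2) * indicator S x = 0"
      using g_null[OF b] g_meas[of b] S(1) by (subst (asm) nn_integral_0_iff_AE) auto
    then have ae: "AE x in lborel. x \<in> interior S \<longrightarrow> (score S p x - score S q x) \<bullet> b = 0"
    proof eventually_elim
      case (elim x)
      show ?case
      proof
        assume "x \<in> interior S"
        then have "x \<in> S"
          using interior_subset by blast
        then show "(score S p x - score S q x) \<bullet> b = 0"
          using elim q(2)[of x] by (simp add: g_def)
      qed
    qed
    have "continuous_on (interior S) (\<lambda>x. (score S p x - score S q x) \<bullet> b)"
      using cont by (intro continuous_intros) (auto intro: continuous_on_subset[OF _ interior_subset])
    from continuous_AE_zero[OF open_interior this ae x]
    show "score S p x \<bullet> b = score S q x \<bullet> b"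
      by (simp add: inner_diff_left)
  qed
  then obtain c where c: "0 < c" "\<And>x. x \<in> S \<Longrightarrow> p x = c * q x"
    using same_score_imp_proportional[OF S(2-4) p q] by blast
  have "(\<lambda>x. ennreal (q x) * indicator S x) = (\<lambda>x. ennreal (indicator S x * q x))"
    by (auto simp: indicator_def)
  then have "(\<lambda>x. ennreal (q x) * indicator S x) \<in> borel_measurable lborel"
    using C1_density_measurable[OF Q S(1)] by simp
  then have "P = Q"
    using P(1) Q by (intro proportional_densities_eq[OF P(2) _ prob_space_Q _ c q(2)]) (auto simp: has_C1_pos_density_def)
  with P(3) show False by simp
qed

section \<open>Positive limit inferior of the estimated discrepancy\<close>

lemma norm1_deriv_0: "norm1_deriv 0 T F x = (\<Sum>i\<in>Basis. \<bar>F x \<bullet> i\<bar>)"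
proof -
  have "{bs :: 'a list. length bs = 0 \<and> set bs \<subseteq> Basis} = {[]}"
    by auto
  then show ?thesis
    by (simp add: norm1_deriv_def)
qed

text \<open>
A supremum over a possibly uncountable set \<open>\<Theta>\<close> need not be measurable, so its moment bound is a statement
about a lower integral only. Continuity in the parameter replaces \<open>\<Theta>\<close> by a countable dense subset, whose
supremum is measurable, finite and integrable.
\<close>

lemma (in iid_sample) sup_envelope_integrable:
  fixes n :: "'t::{metric_space, second_countable_topology} \<Rightarrow> 'a \<Rightarrow> real"
  assumes comp: "compact \<Theta>" and ne: "\<Theta> \<noteq> {}"
    and meas: "\<And>\<theta>. \<theta> \<in> \<Theta> \<Longrightarrow> n \<theta> \<in> borel_measurable Q"
    and cont: "\<And>x. continuous_on \<Theta> (\<lambda>\<theta>. n \<theta> x)"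
    and nonneg: "\<And>\<theta> x. 0 \<le> n \<theta> x"
    and moment: "(\<integral>\<^sup>+x. (SUP \<theta>\<in>\<Theta>. ennreal (n \<theta> x ^ 4)) \<partial>Q) < \<infinity>"
  obtains s where "integrable Q s" "\<And>\<theta> x. \<theta> \<in> \<Theta> \<Longrightarrow> n \<theta> x \<le> s x" "\<And>x. 0 \<le> s x"
proof -
  interpret Q: prob_space Q by (rule prob_space_Q)
  obtain D where D: "countable D" "D \<subseteq> \<Theta>" "\<Theta> \<subseteq> closure D"
    using separable[of \<Theta>] by blast
  define u where "u x = (SUP \<theta>\<in>D. ennreal (n \<theta> x))" for x
  define w where "w x = (SUP \<theta>\<in>D. ennreal (n \<theta> x ^ 4))" for x
  have u_meas [measurable]: "u \<in> borel_measurable Q"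
    unfolding u_def[abs_def] using D meas by (intro borel_measurable_SUP) auto
  have w_meas [measurable]: "w \<in> borel_measurable Q"
    unfolding w_def[abs_def] using D meas
    by (intro borel_measurable_SUP measurable_compose[OF _ measurable_ennreal] borel_measurable_power) auto
  have u_ge: "ennreal (n \<theta> x) \<le> u x" if \<theta>: "\<theta> \<in> \<Theta>" for \<theta> x
  proof -
    obtain d where d: "\<And>m. d m \<in> D" "d \<longlonglongrightarrow> \<theta>"
      using D(3) \<theta> unfolding closure_sequential subset_iff by blast
    have "(\<lambda>m. n (d m) x) \<longlonglongrightarrow> n \<theta> x"
      using \<theta> d D(2) by (intro continuous_on_tendsto_compose[OF cont]) (auto intro!: always_eventually)
    then have "(\<lambda>m. ennreal (n (d m) x)) \<longlonglongrightarrow> ennreal (n \<theta> x)"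
      by (rule tendsto_ennrealI)
    then show ?thesis
      by (rule LIMSEQ_le_const2) (auto simp: u_def intro!: SUP_upper d(1))
  qed
  have u_fin: "u x < \<infinity>" for x
  proof -
    have "bounded ((\<lambda>\<theta>. n \<theta> x) ` \<Theta>)"
      using compact_continuous_image[OF cont comp] by (rule compact_imp_bounded)
    then obtain b where b: "\<And>\<theta>. \<theta> \<in> \<Theta> \<Longrightarrow> \<bar>n \<theta> x\<bar> \<le> b"
      unfolding bounded_iff by auto
    have "u x \<le> ennreal b"
      unfolding u_def using b D(2) by (intro SUP_least ennreal_leI) (force simp: abs_le_iff)
    then show ?thesis
      by (rule le_less_trans) simp
  qed
  \<comment> \<open>From \<open>a \<le> 1 + a\<^sup>4\<close>; both sides are measurable, so the integral of the right side splits.\<close>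
  have u_le: "u x \<le> 1 + w x" for x
    unfolding u_def
  proof (rule SUP_least)
    fix \<theta> assume \<theta>: "\<theta> \<in> D"
    have "n \<theta> x \<le> 1 + n \<theta> x ^ 4"
    proof (cases "n \<theta> x \<le> 1")
      case False
      then have "n \<theta> x ^ 1 \<le> n \<theta> x ^ 4"
        by (intro power_increasing) auto
      then show ?thesis by simp
    qed (simp add: nonneg add_increasing2)
    then have "ennreal (n \<theta> x) \<le> ennreal (1 + n \<theta> x ^ 4)"
      by (rule ennreal_leI)
    also have "\<dots> = 1 + ennreal (n \<theta> x ^ 4)"
      by (simp add: ennreal_plus nonneg)
    also have "\<dots> \<le> 1 + w x"
      unfolding w_def using \<theta> by (intro add_left_mono SUP_upper)
    finally show "ennreal (n \<theta> x) \<le> 1 + w x" .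
  qed
  have "(\<integral>\<^sup>+x. u x \<partial>Q) \<le> (\<integral>\<^sup>+x. 1 + w x \<partial>Q)"
    by (intro nn_integral_mono u_le)
  also have "\<dots> = 1 + (\<integral>\<^sup>+x. w x \<partial>Q)"
    by (subst nn_integral_add) (auto simp: Q.emeasure_space_1)
  also have "(\<integral>\<^sup>+x. w x \<partial>Q) \<le> (\<integral>\<^sup>+x. (SUP \<theta>\<in>\<Theta>. ennreal (n \<theta> x ^ 4)) \<partial>Q)"
    unfolding w_def using D(2) by (intro nn_integral_mono SUP_subset_mono) auto
  also note moment
  finally have fin: "(\<integral>\<^sup>+x. u x \<partial>Q) < \<infinity>"
    by (auto simp: less_top ennreal_add_eq_top)
  define s where "s x = enn2real (u x)" for x
  have s_u: "ennreal (s x) = u x" for x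
    using u_fin[of x] by (simp add: s_def)
  have "integrable Q s"
  proof (rule integrableI_nonneg)
    show "s \<in> borel_measurable Q"
      unfolding s_def[abs_def] by measurable
    show "(\<integral>\<^sup>+x. ennreal (s x) \<partial>Q) < \<infinity>"
      using fin by (simp only: s_u)
  qed (simp add: s_def)
  moreover have "n \<theta> x \<le> s x" if "\<theta> \<in> \<Theta>" for \<theta> x
    using u_ge[OF that, of x] unfolding s_u[symmetric] by (simp add: s_def ennreal_le_iff)
  moreover have "0 \<le> s x" for x
    by (simp add: s_def)
  ultimately show thesis
    using that by blast
qed

text \<open>
The kernels \<open>h\<close> to which the uniform lower bound is applied are Stein kernels cut off outside \<open>G \<times> G\<close>,
where \<open>G\<close> is a measurable set of full measure on which the scores are continuous in the parameter. They are
dominated by \<open>C\<close>, built from an integrable envelope \<open>s\<close> of the scores, plus the trace of mixed derivatives.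
The trace is the difference of one integrable Stein kernel and terms bounded by \<open>C\<close>, hence integrable, and
since the parameter does not enter it, it can be part of the dominating function.
\<close>

theorem theorem2:
  fixes \<X> :: "(real ^ 'd) set"
    and Q :: "(real ^ 'd) measure" and q :: "real ^ 'd \<Rightarrow> real"
    and M :: "'w measure" and X :: "nat \<Rightarrow> 'w \<Rightarrow> real ^ 'd"
    and k :: "real ^ 'd \<Rightarrow> real ^ 'd \<Rightarrow> real"
    and \<Theta> :: "(real ^ 'p) set" and \<theta>\<^sub>0 :: "real ^ 'p"
    and P :: "real ^ 'p \<Rightarrow> (real ^ 'd) measure" and p :: "real ^ 'p \<Rightarrow> real ^ 'd \<Rightarrow> real"
    and \<theta>hat :: "nat \<Rightarrow> 'w \<Rightarrow> real ^ 'p"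
  assumes X_borel: "\<X> \<in> sets borel"
    and X_interior: "interior \<X> \<noteq> {}"
    and X_regular: "\<X> \<subseteq> closure (interior \<X>)"
    and X_connected: "connected (interior \<X>)"
    and Q_prob: "prob_space Q" and Q_support: "has_support Q \<X>"
    and Q_density: "has_C1_pos_density Q \<X> q"
    and M_prob: "prob_space M"
    and X_indep: "prob_space.indep_vars M (\<lambda>_. borel) X {1..}"
    and X_distr: "\<And>i. i \<ge> 1 \<Longrightarrow> distr M borel (X i) = Q"
    and Theta: "compact \<Theta>" "convex \<Theta>" "interior \<Theta> \<noteq> {}"
    and KSD_def: "\<And>\<theta>. \<theta> \<in> \<Theta> \<Longrightarrow> KSD_defined \<X> k Q q (p \<theta>)"
    and argmin: "is_arg_min (\<lambda>\<theta>. KSD \<X> k Q (p \<theta>)) (\<lambda>\<theta>. \<theta> \<in> \<Theta>) \<theta>\<^sub>0"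
    and theta0_interior: "\<theta>\<^sub>0 \<in> interior \<Theta>"
    and k_bounded: "\<exists>B. \<forall>x\<in>\<X>. \<forall>y\<in>\<X>. \<bar>k x y\<bar> \<le> B"
    and k_ispd: "int_strictly_pos_def \<X> k"
    and k_stein: "kernel_stein_class \<X> q k"
    and k_deriv_bounded:
      "\<exists>B. \<forall>x\<in>\<X>. \<forall>y\<in>\<X>. norm (grad1 \<X> k x y) \<le> B \<and> norm (grad2 \<X> k x y) \<le> B"
    and identifiable: "inj_on P \<Theta>"
    and P_prob: "\<And>\<theta>. \<theta> \<in> \<Theta> \<Longrightarrow> prob_space (P \<theta>)"
    and P_support: "\<And>\<theta>. \<theta> \<in> \<Theta> \<Longrightarrow> has_support (P \<theta>) \<X>"
    and P_density: "\<And>\<theta>. \<theta> \<in> \<Theta> \<Longrightarrow> has_C1_pos_density (P \<theta>) \<X> (p \<theta>)"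
    and p_C4: "\<And>x. x \<in> \<X> \<Longrightarrow> Ck_on 4 \<Theta> (\<lambda>\<theta>. p \<theta> x)"
    and score_C3: "AE x in Q. \<forall>i\<in>Basis. Ck_on 3 \<Theta> (\<lambda>\<theta>. score \<X> (p \<theta>) x \<bullet> i)"
    and score_moment4: "\<And>m. m \<in> {0, 1} \<Longrightarrow>
      (\<integral>\<^sup>+x. (SUP \<theta>\<in>\<Theta>. ennreal (norm1_deriv m \<Theta> (\<lambda>\<eta>. score \<X> (p \<eta>) x) \<theta> ^ 4)) \<partial>Q) < \<infinity>"
    and score_moment2: "\<And>m. m \<in> {2, 3} \<Longrightarrow>
      (\<integral>\<^sup>+x. (SUP \<theta>\<in>\<Theta>. ennreal (norm1_deriv m \<Theta> (\<lambda>\<eta>. score \<X> (p \<eta>) x) \<theta> ^ 2)) \<partial>Q) < \<infinity>"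
    and score_diff_L2: "\<And>\<theta>. \<theta> \<in> \<Theta> \<Longrightarrow>
      (\<integral>\<^sup>+x\<in>\<X>. ennreal ((norm (q x *\<^sub>R (score \<X> (p \<theta>) x - score \<X> q x)))\<^sup>2) \<partial>lborel) < \<infinity>"
    and H1: "Q \<notin> P ` \<Theta>"
    and thetahat_Theta: "\<And>n \<omega>. \<omega> \<in> space M \<Longrightarrow> \<theta>hat n \<omega> \<in> \<Theta>"
    and thetahat_estimator: "\<And>n. \<exists>T \<in> (\<Pi>\<^sub>M i\<in>{1..n}. borel) \<rightarrow>\<^sub>M borel.
      \<forall>\<omega>\<in>space M. \<theta>hat n \<omega> = T (\<lambda>i\<in>{1..n}. X i \<omega>)"
  shows "AE \<omega> in M.
    liminf (\<lambda>n. ereal (KSD2_hat \<X> k n (\<lambda>i. X i \<omega>) (p (\<theta>hat n \<omega>)))) > 0"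
proof -
  have Q_sets: "sets Q = sets borel" "space Q = UNIV"
    using sets_C1_density[OF Q_density] by auto
  interpret iid_sample M Q X
    by (rule iid_sample_borel[OF M_prob X_indep X_distr Q_sets(1)])
  interpret C2_kernel \<X> k
    using X_regular k_stein by (unfold_locales) (auto simp: kernel_stein_class_def)
  have \<theta>0: "\<theta>\<^sub>0 \<in> \<Theta>"
    using theta0_interior interior_subset by blast
  have p: "Ck_on 1 \<X> (p \<theta>)" "\<And>x. x \<in> \<X> \<Longrightarrow> 0 < p \<theta> x" if "\<theta> \<in> \<Theta>" for \<theta>
    using P_density[OF that] by (auto simp: has_C1_pos_density_def)
  have score_cont: "continuous_on \<X> (score \<X> (p \<theta>))" if "\<theta> \<in> \<Theta>" for \<theta>
    using score_continuous[OF X_regular p[OF that]] .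
  obtain B1 B2 where "\<forall>x\<in>\<X>. \<forall>y\<in>\<X>. \<bar>k x y\<bar> \<le> B1"
      "\<forall>x\<in>\<X>. \<forall>y\<in>\<X>. norm (grad1 \<X> k x y) \<le> B2 \<and> norm (grad2 \<X> k x y) \<le> B2"
    using k_bounded k_deriv_bounded by blast
  then obtain B where B: "0 \<le> B" "\<And>x y. x \<in> \<X> \<Longrightarrow> y \<in> \<X> \<Longrightarrow> \<bar>k x y\<bar> \<le> B"
      "\<And>x y. x \<in> \<X> \<Longrightarrow> y \<in> \<X> \<Longrightarrow> norm (grad1 \<X> k x y) \<le> B"
      "\<And>x y. x \<in> \<X> \<Longrightarrow> y \<in> \<X> \<Longrightarrow> norm (grad2 \<X> k x y) \<le> B"
    using that[of "max 0 (max B1 B2)"] by (fastforce simp: le_max_iff_disj)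
  have "AE x in Q. x \<in> \<X> \<and> (\<forall>i\<in>Basis. continuous_on \<Theta> (\<lambda>\<theta>. score \<X> (p \<theta>) x \<bullet> i))"
    using score_C3 C1_density_AE_in[OF Q_density X_borel]
    by eventually_elim (auto intro: Ck_on_continuous)
  then obtain N where N: "N \<in> null_sets Q"
      "{x\<in>space Q. \<not> (x \<in> \<X> \<and> (\<forall>i\<in>Basis. continuous_on \<Theta> (\<lambda>\<theta>. score \<X> (p \<theta>) x \<bullet> i)))} \<subseteq> N"
    unfolding eventually_ae_filter by blast
  \<comment> \<open>The exceptional null set is enlarged to a measurable one, so that its complement can serve as an indicator.\<close>
  define G where "G = - N"
  have G_sub: "x \<in> \<X>" and G_cont: "\<And>i. i \<in> Basis \<Longrightarrow> continuous_on \<Theta> (\<lambda>\<theta>. score \<X> (p \<theta>) x \<bullet> i)"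
    if "x \<in> G" for x
    using that N(2) Q_sets(2) by (auto simp: G_def)
  have "N \<in> sets Q"
    using N(1) by auto
  then have G: "G \<in> sets Q" "AE x in Q. x \<in> G"
    using AE_not_in[OF N(1)] Q_sets by (auto simp: G_def Compl_eq_Diff_UNIV)
  define n where "n \<theta> x = indicator G x * (\<Sum>i\<in>Basis. \<bar>score \<X> (p \<theta>) x \<bullet> i\<bar>)" for \<theta> x
  have score_meas: "(\<lambda>x. indicator \<X> x *\<^sub>R score \<X> (p \<theta>) x) \<in> borel_measurable Q" if "\<theta> \<in> \<Theta>" for \<theta>
    using borel_measurable_continuous_on_indicator[OF X_borel score_cont[OF that]] Q_sets(1)
    by (simp cong: measurable_cong_sets)
  have n_meas: "n \<theta> \<in> borel_measurable Q" if "\<theta> \<in> \<Theta>" for \<theta>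
  proof -
    note [measurable] = score_meas[OF that] G(1)
    have "n \<theta> = (\<lambda>x. indicator G x * (\<Sum>i\<in>Basis. \<bar>(indicator \<X> x *\<^sub>R score \<X> (p \<theta>) x) \<bullet> i\<bar>))"
      using G_sub by (auto simp: n_def fun_eq_iff indicator_def)
    also have "\<dots> \<in> borel_measurable Q"
      by measurable
    finally show ?thesis .
  qed
  have n_cont: "continuous_on \<Theta> (\<lambda>\<theta>. n \<theta> x)" for x
    by (cases "x \<in> G") (auto simp: n_def intro!: continuous_intros G_cont)
  have n_moment: "(\<integral>\<^sup>+x. (SUP \<theta>\<in>\<Theta>. ennreal (n \<theta> x ^ 4)) \<partial>Q) < \<infinity>"
  proof -
    have "(\<integral>\<^sup>+x. (SUP \<theta>\<in>\<Theta>. ennreal (n \<theta> x ^ 4)) \<partial>Q)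
        \<le> (\<integral>\<^sup>+x. (SUP \<theta>\<in>\<Theta>. ennreal (norm1_deriv 0 \<Theta> (\<lambda>\<eta>. score \<X> (p \<eta>) x) \<theta> ^ 4)) \<partial>Q)"
      by (intro nn_integral_mono SUP_mono' ennreal_leI power_mono)
        (auto simp: norm1_deriv_0 n_def indicator_def intro!: sum_nonneg)
    also have "\<dots> < \<infinity>"
      by (rule score_moment4) simp
    finally show ?thesis .
  qed
  obtain s where s: "integrable Q s" "\<And>\<theta> x. \<theta> \<in> \<Theta> \<Longrightarrow> n \<theta> x \<le> s x" "\<And>x. 0 \<le> s x"
    using sup_envelope_integrable[OF Theta(1) _ n_meas n_cont _ n_moment] \<theta>0
    by (auto simp: n_def sum_nonneg)
  have score_le: "norm (score \<X> (p \<theta>) x) \<le> s x" if "\<theta> \<in> \<Theta>" "x \<in> G" for \<theta> x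
    using norm_le_l1[of "score \<X> (p \<theta>) x"] s(2)[OF that(1), of x] that(2) by (simp add: n_def)
  have score_int: "set_integrable Q \<X> (score \<X> (p \<theta>))" if "\<theta> \<in> \<Theta>" for \<theta>
    unfolding set_integrable_def
  proof (rule Bochner_Integration.integrable_bound[OF s(1) score_meas[OF that]])
    show "AE x in Q. norm (indicator \<X> x *\<^sub>R score \<X> (p \<theta>) x) \<le> norm (s x)"
      using G(2) by eventually_elim (use score_le[OF that] s(3) in \<open>auto simp: indicator_def\<close>)
  qed
  have KSD_pos: "0 < KSD2 \<X> k Q (p \<theta>)" if "\<theta> \<in> \<Theta>" for \<theta>
  proof (rule KSD2_pos[OF iid_sample_axioms X_borel X_regular X_connected X_interior Q_density P_density[OF that] P_prob[OF that] _
        k_stein k_ispd B(2,4) score_int[OF that] _ score_diff_L2[OF that]])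
    show "P \<theta> \<noteq> Q"
      using H1 that by auto
    show "set_integrable (Q \<Otimes>\<^sub>M Q) (\<X> \<times> \<X>) (\<lambda>(x, y). stein_kernel \<X> k (p \<theta>) x y)"
      using KSD_def[OF that] by (simp add: KSD_defined_def)
  qed
  define h where "h \<theta> x y = indicator (G \<times> G) (x, y) * stein_kernel \<X> k (p \<theta>) x y" for \<theta> x y
  define C where "C x y = B * (s x * s y) + B * s x + B * s y" for x y
  define tr where "tr x y = indicator (G \<times> G) (x, y) * mixed_trace \<X> k x y" for x y
  have h_eq: "(case z of (x, y) \<Rightarrow> h \<theta> x y)
      = indicator (G \<times> G) z *\<^sub>R (indicator (\<X> \<times> \<X>) z *\<^sub>R (case z of (x, y) \<Rightarrow> stein_kernel \<X> k (p \<theta>) x y))" for z \<theta>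
    using G_sub by (cases z) (auto simp: h_def indicator_def)
  have GG: "G \<times> G \<in> sets (Q \<Otimes>\<^sub>M Q)"
    using G(1) by auto
  have stein_int: "integrable (Q \<Otimes>\<^sub>M Q) (\<lambda>z. indicator (\<X> \<times> \<X>) z *\<^sub>R (case z of (x, y) \<Rightarrow> stein_kernel \<X> k (p \<theta>) x y))"
    if "\<theta> \<in> \<Theta>" for \<theta>
    using KSD_def[OF that] by (simp add: KSD_defined_def set_integrable_def)
  have h_int: "integrable (Q \<Otimes>\<^sub>M Q) (\<lambda>(x, y). h \<theta> x y)" if "\<theta> \<in> \<Theta>" for \<theta>
    unfolding h_eq by (rule integrable_mult_indicator[OF GG stein_int[OF that]])
  have h_integral: "(\<integral>(x, y). h \<theta> x y \<partial>(Q \<Otimes>\<^sub>M Q)) = KSD2 \<X> k Q (p \<theta>)" if "\<theta> \<in> \<Theta>" for \<theta>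
    unfolding KSD2_def set_lebesgue_integral_def
  proof (rule integral_cong_AE)
    show "AE z in Q \<Otimes>\<^sub>M Q. (case z of (x, y) \<Rightarrow> h \<theta> x y)
        = indicator (\<X> \<times> \<X>) z *\<^sub>R (case z of (x, y) \<Rightarrow> stein_kernel \<X> k (p \<theta>) x y)"
      using AE_product[OF G] by eventually_elim (simp add: h_eq)
  qed (use h_int[OF that] stein_int[OF that] in auto)
  have C_int: "integrable (Q \<Otimes>\<^sub>M Q) (\<lambda>(x, y). C x y)"
    using integrable_product[OF s(1)] integrable_fst_snd(1,2)[OF s(1)]
    by (simp add: C_def case_prod_unfold)
  have rest_le: "\<bar>h \<theta> x y - tr x y\<bar> \<le> C x y" if "\<theta> \<in> \<Theta>" for \<theta> x y
  proof (cases "x \<in> G \<and> y \<in> G")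
    case True
    then have xy: "x \<in> G" "y \<in> G" "x \<in> \<X>" "y \<in> \<X>"
      using G_sub by auto
    let ?s = "score \<X> (p \<theta>)"
    have "\<bar>?s x \<bullet> ?s y\<bar> \<le> s x * s y"
      using Cauchy_Schwarz_ineq2[of "?s x" "?s y"] score_le[OF that xy(1)] score_le[OF that xy(2)] s(3)
      by (meson mult_mono norm_ge_zero order_trans)
    then have 1: "\<bar>k x y * (?s x \<bullet> ?s y)\<bar> \<le> B * (s x * s y)"
      unfolding abs_mult using B(1) B(2)[OF xy(3,4)] by (intro mult_mono) auto
    have 2: "\<bar>?s x \<bullet> grad2 \<X> k x y\<bar> \<le> B * s x"
      using Cauchy_Schwarz_ineq2[of "?s x" "grad2 \<X> k x y"] score_le[OF that xy(1)] B(4)[OF xy(3,4)] s(3)[of x]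
      by (metis mult.commute mult_mono norm_ge_zero order_trans)
    have 3: "\<bar>grad1 \<X> k x y \<bullet> ?s y\<bar> \<le> B * s y"
      using Cauchy_Schwarz_ineq2[of "grad1 \<X> k x y" "?s y"] score_le[OF that xy(2)] B(1) B(3)[OF xy(3,4)]
      by (meson mult_mono norm_ge_zero order_trans)
    have "h \<theta> x y - tr x y = k x y * (?s x \<bullet> ?s y) + ?s x \<bullet> grad2 \<X> k x y + grad1 \<X> k x y \<bullet> ?s y"
      using xy by (simp add: h_def tr_def stein_kernel_def)
    with 1 2 3 show ?thesis
      unfolding C_def by linarith
  next
    case False
    then show ?thesis
      using B(1) s(3)[of x] s(3)[of y] by (auto simp: h_def tr_def C_def)
  qed
  have tr_int: "integrable (Q \<Otimes>\<^sub>M Q) (\<lambda>(x, y). tr x y)"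
  proof -
    have "continuous_on (\<X> \<times> \<X>) (\<lambda>(x, y). mixed_trace \<X> k x y)"
      using D12_continuous by (auto simp: mixed_trace_def D12_def case_prod_unfold intro!: continuous_on_sum)
    moreover have "\<X> \<times> \<X> \<in> sets borel"
      using X_borel by (rule borel_Times) (rule X_borel)
    ultimately have "(\<lambda>z. indicator (\<X> \<times> \<X>) z *\<^sub>R (case z of (x, y) \<Rightarrow> mixed_trace \<X> k x y)) \<in> borel_measurable borel"
      by (intro borel_measurable_continuous_on_indicator)
    moreover have QQ_sets: "sets (Q \<Otimes>\<^sub>M Q) = sets borel"
      using Q_sets(1) by (simp add: borel_prod[symmetric] cong: sets_pair_measure_cong)
    ultimately have m [measurable]: "(\<lambda>z. indicator (\<X> \<times> \<X>) z *\<^sub>R (case z of (x, y) \<Rightarrow> mixed_trace \<X> k x y)) \<in> borel_measurable (Q \<Otimes>\<^sub>M Q)"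
      by (simp cong: measurable_cong_sets)
    have "(\<lambda>(x, y). tr x y) = (\<lambda>z. indicator (G \<times> G) z *\<^sub>R (indicator (\<X> \<times> \<X>) z *\<^sub>R (case z of (x, y) \<Rightarrow> mixed_trace \<X> k x y)))"
      using G_sub by (auto simp: tr_def fun_eq_iff indicator_def)
    also have "\<dots> \<in> borel_measurable (Q \<Otimes>\<^sub>M Q)"
      by (rule borel_measurable_scaleR[OF borel_measurable_indicator[OF GG] m])
    finally have tr_meas: "(\<lambda>(x, y). tr x y) \<in> borel_measurable (Q \<Otimes>\<^sub>M Q)" .
    have "integrable (Q \<Otimes>\<^sub>M Q) (\<lambda>(x, y). h \<theta>\<^sub>0 x y - tr x y)"
    proof (rule Bochner_Integration.integrable_bound[OF C_int])
      show "(\<lambda>(x, y). h \<theta>\<^sub>0 x y - tr x y) \<in> borel_measurable (Q \<Otimes>\<^sub>M Q)"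
        using borel_measurable_diff[OF borel_measurable_integrable[OF h_int[OF \<theta>0]] tr_meas]
        by (simp add: case_prod_unfold)
      show "AE z in Q \<Otimes>\<^sub>M Q. norm (case z of (x, y) \<Rightarrow> h \<theta>\<^sub>0 x y - tr x y) \<le> norm (case z of (x, y) \<Rightarrow> C x y)"
        using rest_le[OF \<theta>0] by (auto simp: case_prod_unfold intro!: AE_I2 order_trans[OF _ abs_ge_self])
    qed
    from Bochner_Integration.integrable_diff[OF h_int[OF \<theta>0] this] show ?thesis
      by (simp add: case_prod_unfold)
  qed
  have "AE \<omega> in M. \<exists>c>0. \<forall>\<^sub>F n in sequentially. \<forall>\<theta>\<in>\<Theta>. c \<le> ustat (h \<theta>) n (\<lambda>i. X i \<omega>)"
  proof (rule ustat_uniformly_positive[OF Theta(1)])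
    show "(\<lambda>(a, b). h \<theta> a b) \<in> borel_measurable (Q \<Otimes>\<^sub>M Q)" if "\<theta> \<in> \<Theta>" for \<theta>
      using h_int[OF that] by simp
    show "0 < (\<integral>(a, b). h \<theta> a b \<partial>(Q \<Otimes>\<^sub>M Q))" if "\<theta> \<in> \<Theta>" for \<theta>
      using h_integral[OF that] KSD_pos[OF that] by simp
    show "integrable (Q \<Otimes>\<^sub>M Q) (\<lambda>(a, b). C a b + \<bar>tr a b\<bar>)"
      using Bochner_Integration.integrable_add[OF C_int integrable_abs[OF tr_int]] by (simp add: case_prod_unfold)
    show "\<bar>h \<theta> a b\<bar> \<le> C a b + \<bar>tr a b\<bar>" if "\<theta> \<in> \<Theta>" for \<theta> a b
      using rest_le[OF that, of a b] by linarith
    show "continuous_on \<Theta> (\<lambda>\<theta>. h \<theta> a b)" for a b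
    proof (cases "a \<in> G \<and> b \<in> G")
      case True
      then have "h \<theta> a b = (\<Sum>i\<in>Basis. jet i (score \<X> (p \<theta>) a \<bullet> i) 1 a (score \<X> (p \<theta>) b \<bullet> i) 1 b)" for \<theta>
        by (simp add: h_def stein_kernel_eq_jets)
      then show ?thesis
        unfolding jet_def using True by (auto intro!: continuous_intros G_cont)
    qed (auto simp: h_def)
  qed
  with AE_sample[OF G(2)] AE_space show ?thesis
  proof eventually_elim
    case (elim \<omega>)
    then obtain c where c: "0 < c" "\<forall>\<^sub>F n in sequentially. \<forall>\<theta>\<in>\<Theta>. c \<le> ustat (h \<theta>) n (\<lambda>i. X i \<omega>)"
      by blast
    have "ustat (h \<theta>) n (\<lambda>i. X i \<omega>) = KSD2_hat \<X> k n (\<lambda>i. X i \<omega>) (p \<theta>)" for n \<theta>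
      unfolding ustat_def KSD2_hat_def using elim
      by (intro arg_cong2[where f = "(*)"] sum.cong refl) (simp add: h_def)
    with c(2) have "\<forall>\<^sub>F n in sequentially. ereal c \<le> ereal (KSD2_hat \<X> k n (\<lambda>i. X i \<omega>) (p (\<theta>hat n \<omega>)))"
      using thetahat_Theta elim by (auto elim!: eventually_mono)
    then have "ereal c \<le> liminf (\<lambda>n. ereal (KSD2_hat \<X> k n (\<lambda>i. X i \<omega>) (p (\<theta>hat n \<omega>))))"
      by (rule Liminf_bounded)
    then show ?case
      using c(1) by (metis ereal_less(2) less_le_trans)
  qed
qed

end
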